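(* Let $g:\mathbb{N}\to\mathbb{R}$ be an additive function belonging to $\mathcal{A}_s$, and suppose $|\mathcal{B}(X)|=o(X)$ as $X\to\infty$. Then there is a function $\lambda=\lambda(X)$, defined for large $X\ge10$, with $|\lambda(X)|\ll B_g(X)/\log X$, such that $$\sum_{p^k\le X}\frac{|g(p^k)-\lambda(X)\log p^k|^2}{p^k}=o\left(\sum_{p^k\le X}\frac{g(p^k)^2}{p^k}\right)\quad\text{as }X\to\infty.$$ Moreover, for every fixed $0<u\le1$, $\lambda(X)=\lambda(X^u)+o\left(\frac{B_g(X)}{\log X}\right)$ as $X\to\infty$.
   Context: An arithmetic function $g$ is additive if $g(nm)=g(n)+g(m)$ whenever $\gcd(n,m)=1$. Sums over $p^k$ run over prime powers with $k\ge1$. $B_g(X):=\left(\sum_{p^k\le X}|g(p^k)|^2p^{-k}\right)^{1/2}$. For $\varepsilon>0$, $F_g(\varepsilon):=\limsup_{X\to\infty}\frac{1}{B_g(X)^2}\sum_{p\le X,\ |g(p)|>\varepsilon^{-1}B_g(X)}\frac{|g(p)|^2}{p}$. $\mathcal{A}$ is the class of additive $g$ with $B_g(X)\to\infty$ and $\limsup_{X\to\infty}B_g(X)^{-2}\sum_{p^k\le X,\,k\ge2}|g(p^k)|^2p^{-k}=0$; $\mathcal{A}_s$ consists of those $g\in\mathcal{A}$ with $\lim_{\varepsilon\to0^+}F_g(\varepsilon)=0$. With the convention $g(0):=0$, $\mathcal{B}:=\{n\in\mathbb{N}:g(n)<g(n-1)\}$ and $\mathcal{B}(X):=\mathcal{B}\cap[1,X]$.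 *)

theory Defs
  imports
    "HOL-Analysis.Analysis"
    "HOL-Library.Landau_Symbols"
    "HOL-Number_Theory.Prime_Powers"
begin

(* The natural numbers of the source start at 1; the value at 0 is not constrained here. *)
definition additive_function :: "(nat \<Rightarrow> real) \<Rightarrow> bool" where
  "additive_function g \<longleftrightarrow>
     (\<forall>m n. m > 0 \<longrightarrow> n > 0 \<longrightarrow> coprime m n \<longrightarrow> g (m * n) = g m + g n)"

(* A prime power determines its prime and its exponent, so sums over pairs (p, k) with
   p^k \<le> X are written as sums over the values q = p^k. *)
definition prime_powers_upto :: "real \<Rightarrow> nat set" where
  "prime_powers_upto X = {q. primepow q \<and> real q \<le> X}"

definition higher_prime_powers_upto :: "real \<Rightarrow> nat set" where
  "higher_prime_powers_upto X = {q. (\<exists>p k. prime p \<and> k \<ge> 2 \<and> q = p ^ k) \<and> real q \<le> X}"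

definition B_add :: "(nat \<Rightarrow> real) \<Rightarrow> real \<Rightarrow> real" where
  "B_add g X = sqrt (\<Sum>q\<in>prime_powers_upto X. \<bar>g q\<bar>\<^sup>2 / real q)"

definition F_add :: "(nat \<Rightarrow> real) \<Rightarrow> real \<Rightarrow> ereal" where
  "F_add g \<epsilon> = Limsup at_top (\<lambda>X::real. ereal (1 / (B_add g X)\<^sup>2 *
     (\<Sum>p | prime p \<and> real p \<le> X \<and> \<bar>g p\<bar> > inverse \<epsilon> * B_add g X. \<bar>g p\<bar>\<^sup>2 / real p)))"

definition class_A :: "(nat \<Rightarrow> real) set" where
  "class_A = {g. additive_function g \<and> filterlim (B_add g) at_top at_top \<and>
     Limsup at_top (\<lambda>X::real. ereal (1 / (B_add g X)\<^sup>2 *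
       (\<Sum>q\<in>higher_prime_powers_upto X. \<bar>g q\<bar>\<^sup>2 / real q))) = 0}"

definition class_A_s :: "(nat \<Rightarrow> real) set" where
  "class_A_s = {g \<in> class_A. (F_add g \<longlongrightarrow> 0) (at_right 0)}"

(* To be used for g with g 0 = 0, which fixes the meaning of the condition at n = 1. *)
definition decrease_set :: "(nat \<Rightarrow> real) \<Rightarrow> nat set" where
  "decrease_set g = {n. n \<ge> 1 \<and> g n < g (n - 1)}"

definition decrease_set_upto :: "(nat \<Rightarrow> real) \<Rightarrow> real \<Rightarrow> nat set" where
  "decrease_set_upto g X = {n \<in> decrease_set g. real n \<le> X}"

end

theory Submission
  imports Defs "HOL-Real_Asymp.Real_Asymp" "HOL-Number_Theory.Cong"
begin

text \<open>
  Telescoping and the Cauchy--Schwarz inequality on the sparse set of descents show that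
  g n - g (n - 1) is o(B) in mean; a truncation with bounded exponential moments upgrades this
  to mean square. Hence g is close, in mean square, to its average over a short window of length H.
  Restrict this to the multiples of a prime p: the left side averages to g p + A (N / p), where
  A z is the sum of g q / q over primes q up to z, while the right side averages g over H residue
  classes modulo p. By an almost orthogonality (dual Turan--Kubilius) argument the latter differs
  from A N by at most B / sqrt H, in the mean square over p with weight 1 / p. Letting H tend
  to infinity, g p is close to A N - A (N / p) for all p up to the cube root of N. Comparing the
  values N = b ^ k for a fixed range of k makes the increments of k \<mapsto> A (b ^ k) nearly constant,
  so that A N - A (N / p) is nearly a multiple of ln p.
\<close>

section \<open>Chebyshev and Mertens estimates\<close>

text \<open>Few descents control only the first moment of the increments; a sparse set could still
  carry their squares. The condition defining \<open>class_A_s\<close> excludes this: primes with |g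
  p| > K B add little variance, and the rest of g has a fourth moment of order B to the fourth. The
  same condition keeps B from growing quickly, since the primes between Y and a slightly larger
  power of Y have small reciprocal sum. Hence B at X^5 is O(B at X), which pays for an approximation
  up to b^J whose error is measured by B at b^(4J).

  The cube root comes from the Bessel inequality, whose off-diagonal error of order z^2 for primes
  up to z must be small against the gain N / H. The functional equation yields information on A
  alone because g p does not involve N: at N = b^k and p just below b it says that A moves by about
  g p between b^(k-1) and b^k, for every k in the range. The slope found this way depends on b and
  J; projecting g onto the logarithm replaces it by one canonical coefficient at each X.\<close>

abbreviation primes_le :: "nat \<Rightarrow> nat set" where
  "primes_le N \<equiv> {p. prime p \<and> p \<le> N}"

lemma finite_primes_le [simp]: "finite (primes_le N)"
  by (rule finite_subset[of _ "{..N}"]) auto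

lemma sum_divisors_swap:
  fixes F :: "nat \<Rightarrow> nat \<Rightarrow> real"
  shows "(\<Sum>n=1..N. \<Sum>d | d dvd n. F d (n div d)) = (\<Sum>d=1..N. \<Sum>m=1..N div d. F d m)"
proof -
  have "(\<Sum>n=1..N. \<Sum>d | d dvd n. F d (n div d)) =
      (\<Sum>(n,d)\<in>Sigma {1..N} (\<lambda>n. {d. d dvd n}). F d (n div d))"
    by (subst sum.Sigma) auto
  also have "\<dots> = (\<Sum>(d,m)\<in>Sigma {1..N} (\<lambda>d. {1..N div d}). F d m)"
    by (rule sum.reindex_bij_witness[where i = "\<lambda>(d,m). (d*m, d)" and j = "\<lambda>(n,d). (d, n div d)"])
       (auto simp: div_le_mono dvd_imp_le less_eq_div_iff_mult_less_eq mult.commute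
         dvd_div_eq_0_iff Suc_le_eq dvd_pos_nat elim: dvdE intro: order_trans[OF dvd_imp_le])
  also have "\<dots> = (\<Sum>d=1..N. \<Sum>m=1..N div d. F d m)"
    by (subst sum.Sigma) auto
  finally show ?thesis .
qed

definition psi :: "nat \<Rightarrow> real" where
  "psi N = (\<Sum>d=1..N. mangoldt d)"

text \<open>Legendre's formula in logarithmic form, and the only bridge from factorials to primes in
  this development.\<close>

lemma ln_fact_conv_mangoldt: "ln (fact N) = (\<Sum>d=1..N. mangoldt d * real (N div d))"
proof -
  have "ln (fact N) = (\<Sum>n=1..N. ln (real n))"
    by (induction N) (auto simp: ln_mult add.commute)
  also have "\<dots> = (\<Sum>n=1..N. \<Sum>d | d dvd n. mangoldt d)"
    by (intro sum.cong refl, subst mangoldt_sum) auto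
  also have "\<dots> = (\<Sum>d=1..N. mangoldt d * real (N div d))"
    using sum_divisors_swap[of "\<lambda>d m. mangoldt d" N] by (simp add: mult.commute)
  finally show ?thesis .
qed

text \<open>Chebyshev's argument: \<open>mangoldt d\<close> enters the logarithm of the central
  binomial coefficient with weight \<open>2 * m div d - 2 * (m div d)\<close>, which is never
  negative and at least 1 for m < d \<le> 2m, while the coefficient itself is at most 4^m.\<close>

lemma psi_double: "psi (2 * m) \<le> psi m + 2 * real m * ln 2"
proof -
  have split: "{1..2*m} = {1..m} \<union> {m+1..2*m}" by auto
  have "psi (2*m) - psi m = (\<Sum>d=m+1..2*m. mangoldt d)"
    unfolding psi_def split by (subst sum.union_disjoint) auto
  also have "\<dots> \<le> (\<Sum>d=m+1..2*m. mangoldt d * (real (2*m div d) - 2 * real (m div d)))"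
  proof (rule sum_mono)
    fix d assume d: "d \<in> {m+1..2*m}"
    have "1 * d \<le> 2 * m" using d by auto
    hence "1 \<le> 2 * m div d" using d by (subst less_eq_div_iff_mult_less_eq) auto
    moreover have "m div d = 0" using d by auto
    ultimately have "1 \<le> real (2*m div d) - 2 * real (m div d)" by simp
    thus "mangoldt d \<le> mangoldt d * (real (2*m div d) - 2 * real (m div d))"
      using mangoldt_nonneg[of d] by (metis mult.right_neutral mult_left_mono)
  qed
  also have "\<dots> \<le> (\<Sum>d=1..2*m. mangoldt d * (real (2*m div d) - 2 * real (m div d)))"
  proof (rule sum_mono2)
    fix d :: nat
    have "2 * (m div d) \<le> 2*m div d"
      by (cases "d = 0") (auto simp: less_eq_div_iff_mult_less_eq)
    hence "real (2*m div d) - 2 * real (m div d) \<ge> 0" by (simp flip: of_nat_mult)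
    thus "0 \<le> mangoldt d * (real (2*m div d) - 2 * real (m div d))"
      using mangoldt_nonneg[of d] by simp
  qed auto
  also have "\<dots> = ln (fact (2*m)) - 2 * ln (fact m)"
  proof -
    have "(\<Sum>d=1..m. mangoldt d * real (m div d)) = (\<Sum>d=1..2*m. mangoldt d * real (m div d))"
      by (rule sum.mono_neutral_left) auto
    thus ?thesis
      unfolding ln_fact_conv_mangoldt by (simp add: algebra_simps sum_subtractf sum_distrib_left)
  qed
  also have "\<dots> = ln (real ((2*m) choose m))"
  proof -
    have "real ((2*m) choose m) = fact (2*m) / (fact m * fact m)"
      by (subst binomial_fact) auto
    thus ?thesis by (simp add: ln_div ln_mult)
  qed
  also have "\<dots> \<le> ln (2 ^ (2*m))"
  proof -
    have "(2*m) choose m \<le> 2^(2*m)" by (rule binomial_le_pow2)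
    hence "real ((2*m) choose m) \<le> 2^(2*m)" by (metis of_nat_le_iff of_nat_numeral of_nat_power)
    thus ?thesis by (subst ln_le_cancel_iff) auto
  qed
  finally show ?thesis by (simp add: ln_realpow)
qed

text \<open>Strong induction through m = N div 2. Doubling costs 2m ln 2 \<le> 2m on top of 4m; the
  2m still available absorb \<open>mangoldt N \<le> N - 1\<close> when N is odd.\<close>

lemma psi_le: "psi N \<le> 4 * real N"
proof (induction N rule: less_induct)
  case (less N)
  show ?case
  proof (cases "N = 0")
    case True thus ?thesis by (simp add: psi_def)
  next
    case False
    define m where "m = N div 2"
    have m: "m < N" using False by (simp add: m_def)
    have l2: "ln (2::real) \<le> 1" using ln_2_less_1 by simp
    have b: "psi (2*m) \<le> 6 * real m"
      using psi_double[of m] less.IH[OF m] mult_left_mono[OF l2, of "2 * real m"] by simp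
    show ?thesis
    proof (cases "even N")
      case True
      hence "N = 2*m" by (simp add: m_def)
      thus ?thesis using b by simp
    next
      case odd: False
      hence N: "N = Suc (2*m)" by (simp add: m_def)
      have "mangoldt N \<le> ln (real N)" using False by (intro mangoldt_le) auto
      also have "\<dots> \<le> real N - 1" using False by (intro ln_le_minus_one) auto
      finally have "psi N \<le> psi (2*m) + 2 * real m" by (simp add: psi_def N)
      thus ?thesis using b N by simp
    qed
  qed
qed

lemma ln_fact_ge: "real N * ln (real N) - real N \<le> ln (fact N)"
proof (induction N)
  case (Suc N)
  show ?case
  proof (cases "N = 0")
    case False
    have "ln (real (Suc N)) - ln (real N) \<le> 1 / real N"
    proof -
      have "ln (real (Suc N) / real N) \<le> real (Suc N) / real N - 1"
        using False by (intro ln_le_minus_one) auto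
      thus ?thesis using False by (simp add: ln_div field_simps)
    qed
    hence "real N * (ln (real (Suc N)) - ln (real N)) \<le> 1"
      using False by (simp add: field_simps)
    moreover have "ln (fact (Suc N)) = ln (real (Suc N)) + ln (fact N)"
      by (simp add: ln_mult del: of_nat_Suc)
    ultimately show ?thesis using Suc by (simp add: algebra_simps del: fact_Suc)
  qed auto
qed auto

lemma ln_fact_le: "N \<ge> 1 \<Longrightarrow> ln (fact N) \<le> real N * ln (real N)"
proof -
  assume N: "N \<ge> 1"
  have "(fact N :: real) \<le> real N ^ N" using fact_le_power[of N] by simp
  hence "ln (fact N) \<le> ln (real N ^ N)" using N by (subst ln_le_cancel_iff) auto
  thus ?thesis using N by (simp add: ln_realpow)
qed

text \<open>Replacing \<open>N div d\<close> by N / d in Legendre's formula changes the sum by at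
  most \<open>psi N\<close>. The constants are asymmetric because 1 comes from the Stirling bound
  \<open>ln_fact_ge\<close> and 4 from \<open>psi_le\<close>.\<close>

lemma mertens_first:
  assumes "N \<ge> 1"
  shows "ln (real N) - 1 \<le> (\<Sum>d=1..N. mangoldt d / real d)"
    and "(\<Sum>d=1..N. mangoldt d / real d) \<le> ln (real N) + 4"
proof -
  have "real N * ln (real N) - real N \<le> (\<Sum>d=1..N. mangoldt d * real (N div d))"
    using ln_fact_ge[of N] by (simp add: ln_fact_conv_mangoldt)
  also have "\<dots> \<le> (\<Sum>d=1..N. mangoldt d * (real N / real d))"
    by (intro sum_mono mult_left_mono mangoldt_nonneg) (rule of_nat_div_le_of_nat)
  also have "\<dots> = real N * (\<Sum>d=1..N. mangoldt d / real d)"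
    by (simp add: sum_distrib_left mult_ac)
  finally have "real N * (ln (real N) - 1) \<le> real N * (\<Sum>d=1..N. mangoldt d / real d)"
    by (simp add: algebra_simps)
  thus "ln (real N) - 1 \<le> (\<Sum>d=1..N. mangoldt d / real d)" using assms by simp
  have "real N * (\<Sum>d=1..N. mangoldt d / real d) = (\<Sum>d=1..N. mangoldt d * (real N / real d))"
    by (simp add: sum_distrib_left mult_ac)
  also have "\<dots> \<le> (\<Sum>d=1..N. mangoldt d * (real (N div d) + 1))"
  proof (intro sum_mono mult_left_mono mangoldt_nonneg)
    fix d
    show "real N / real d \<le> real (N div d) + 1"
      using floor_divide_of_nat_eq[of N d, where ?'a = real] by linarith
  qed
  also have "\<dots> = ln (fact N) + psi N"
    by (simp add: ln_fact_conv_mangoldt psi_def algebra_simps sum.distrib)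
  also have "\<dots> \<le> real N * (ln (real N) + 4)"
    using ln_fact_le[OF assms] psi_le[of N] by (simp add: algebra_simps)
  finally show "(\<Sum>d=1..N. mangoldt d / real d) \<le> ln (real N) + 4" using assms by simp
qed

lemma mertens_interval:
  assumes "1 \<le> a" "a \<le> b"
  shows "(\<Sum>d=a+1..b. mangoldt d / real d) \<le> ln (real b) - ln (real a) + 5"
    and "(\<Sum>d=a+1..b. mangoldt d / real d) \<ge> ln (real b) - ln (real a) - 5"
proof -
  have "{1..b} = {1..a} \<union> {a+1..b}" using assms by auto
  hence "(\<Sum>d=1..b. mangoldt d / real d) =
      (\<Sum>d=1..a. mangoldt d / real d) + (\<Sum>d=a+1..b. mangoldt d / real d)"
    by (simp only:) (subst sum.union_disjoint, auto)
  thus "(\<Sum>d=a+1..b. mangoldt d / real d) \<le> ln (real b) - ln (real a) + 5"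
    "(\<Sum>d=a+1..b. mangoldt d / real d) \<ge> ln (real b) - ln (real a) - 5"
    using mertens_first[of a] mertens_first[of b] assms by linarith+
qed

text \<open>Each prime in the interval has \<open>mangoldt p \<ge> ln a\<close>, so Mertens' first
  estimate applies after division by ln a. This is cruder than ln (ln b / ln a), but of the right
  quality when b is at most a bounded power of a.\<close>

lemma sum_prime_recip_interval_le:
  assumes "2 \<le> a" "a \<le> b"
  shows "(\<Sum>p | prime p \<and> a < p \<and> p \<le> b. 1 / real p) \<le> (ln (real b) - ln (real a) + 5) / ln (real a)"
proof -
  have la: "ln (real a) > 0" using assms by simp
  have "(\<Sum>p | prime p \<and> a < p \<and> p \<le> b. 1 / real p) \<le>
      (\<Sum>p | prime p \<and> a < p \<and> p \<le> b. (mangoldt p / real p) / ln (real a))"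
  proof (rule sum_mono, goal_cases)
    case (1 p)
    hence "ln (real a) \<le> mangoldt p" using assms by simp
    thus ?case using la 1 assms by (auto simp: field_simps)
  qed
  also have "\<dots> \<le> (\<Sum>d=a+1..b. (mangoldt d / real d) / ln (real a))"
    using la by (intro sum_mono2) (auto intro!: divide_nonneg_nonneg mangoldt_nonneg)
  also have "\<dots> = (\<Sum>d=a+1..b. mangoldt d / real d) / ln (real a)"
    by (simp add: sum_divide_distrib)
  also have "\<dots> \<le> (ln (real b) - ln (real a) + 5) / ln (real a)"
    using mertens_interval(1)[of a b] assms la by (intro divide_right_mono) auto
  finally show ?thesis .
qed

lemma sum_ln_prime_div_le:
  assumes "N \<ge> 1"
  shows "(\<Sum>p\<in>primes_le N. ln (real p) / real p) \<le> ln (real N) + 4"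
proof -
  have "(\<Sum>p\<in>primes_le N. ln (real p) / real p) = (\<Sum>p\<in>primes_le N. mangoldt p / real p)"
    by (intro sum.cong) auto
  also have "\<dots> \<le> (\<Sum>d=1..N. mangoldt d / real d)"
    by (intro sum_mono2) (auto intro!: divide_nonneg_nonneg mangoldt_nonneg simp: prime_gt_0_nat Suc_le_eq)
  also have "\<dots> \<le> ln (real N) + 4" by (rule mertens_first(2)[OF assms])
  finally show ?thesis .
qed

text \<open>A prime above sqrt N contributes at least ln N / 2 to \<open>psi N\<close>, which gives
  the share 8; the at most sqrt N smaller ones account for the remaining 2.\<close>

lemma card_primes_le:
  assumes "N \<ge> 2"
  shows "real (card (primes_le N)) \<le> 10 * real N / ln (real N)"
proof -
  have lN: "ln (real N) > 0" using assms by simp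
  define S where "S = {p\<in>primes_le N. real p > sqrt (real N)}"
  define M where "M = nat \<lfloor>sqrt (real N)\<rfloor>"
  have "real (card S) * (ln (real N) / 2) = (\<Sum>p\<in>S. ln (real N) / 2)" by simp
  also have "\<dots> \<le> (\<Sum>p\<in>S. mangoldt p)"
  proof (rule sum_mono)
    fix p assume p: "p \<in> S"
    have "ln (real N) / 2 = ln (sqrt (real N))" using assms by (simp add: ln_sqrt)
    also have "\<dots> \<le> ln (real p)" using p assms by (subst ln_le_cancel_iff) (auto simp: S_def prime_gt_0_nat)
    finally show "ln (real N) / 2 \<le> mangoldt p" using p by (simp add: S_def)
  qed
  also have "\<dots> \<le> psi N" unfolding psi_def
    by (intro sum_mono2) (auto simp: S_def mangoldt_nonneg prime_gt_0_nat Suc_le_eq)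
  also have "\<dots> \<le> 4 * real N" by (rule psi_le)
  finally have cS: "real (card S) \<le> 8 * real N / ln (real N)" using lN by (simp add: field_simps)
  have "primes_le N \<subseteq> S \<union> {1..M}"
  proof
    fix p assume p: "p \<in> primes_le N"
    show "p \<in> S \<union> {1..M}"
      using p prime_gt_0_nat[of p]
      by (cases "real p > sqrt (real N)") (auto simp: S_def M_def Suc_le_eq le_nat_floor not_less)
  qed
  hence "card (primes_le N) \<le> card (S \<union> {1..M})" by (intro card_mono) (auto simp: S_def)
  also have "\<dots> \<le> card S + card {1..M}" by (rule card_Un_le)
  finally have "real (card (primes_le N)) \<le> real (card S) + real M" by simp
  also have "real M \<le> sqrt (real N)" by (simp add: M_def)
  also have "sqrt (real N) \<le> 2 * real N / ln (real N)"
  proof -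
    have "ln (real N) = 2 * ln (sqrt (real N))" using assms by (simp add: ln_sqrt)
    also have "\<dots> \<le> 2 * sqrt (real N)" using ln_le_minus_one[of "sqrt (real N)"] assms by simp
    finally have "sqrt (real N) * ln (real N) \<le> sqrt (real N) * (2 * sqrt (real N))"
      by (intro mult_left_mono) auto
    also have "\<dots> = 2 * real N" by simp
    finally show ?thesis using lN by (simp add: field_simps)
  qed
  finally show ?thesis using cS by (simp add: add_divide_distrib[symmetric])
qed

lemma sum_prime_recip_le:
  "\<exists>C>0. \<forall>N\<ge>2. (\<Sum>p\<in>primes_le N. 1 / real p) \<le> ln (ln (real N)) + C"
proof -
  define S where "S = (\<lambda>n::nat. \<Sum>p\<in>primes_le n. ln (real p) / real p)"
  define R where "R = (\<lambda>n::nat. \<Sum>p\<in>primes_le n. 1 / real p)"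
  text \<open>Abel summation, in the form of an induction on the truncation point.\<close>
  have main: "R n \<le> S n / ln (real n) + (ln (ln (real n)) - ln (ln 2)) + 4 * (1 / ln 2 - 1 / ln (real n))"
    if "n \<ge> 2" for n
    using that
  proof (induction n rule: dec_induct)
    case base
    have "primes_le 2 = {2}" using prime_ge_2_nat by (auto intro: antisym)
    thus ?case by (simp add: R_def S_def)
  next
    case (step n)
    define l where "l = ln (real n)"
    define l' where "l' = ln (real (Suc n))"
    have l: "l > 0" "l' > l" using step by (auto simp: l_def l'_def)
    have Sn: "S n \<le> l + 4" unfolding S_def l_def using step by (intro sum_ln_prime_div_le) auto
    have lnl: "ln l' - ln l \<ge> (l' - l) / l'"
    proof -
      have "ln (l / l') \<le> l / l' - 1" using l by (intro ln_le_minus_one) auto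
      thus ?thesis using l by (simp add: ln_div field_simps)
    qed
    \<comment> \<open>A prime \<open>Suc n\<close> adds 1 / \<open>Suc n\<close> to R and
      \<open>l'\<close> / \<open>Suc n\<close> to S, so with the new logarithm as denominator the
      two gains cancel.\<close>
    have rec: "R (Suc n) - S (Suc n) / l' = R n - S n / l'"
    proof (cases "prime (Suc n)")
      case True
      have "primes_le (Suc n) = insert (Suc n) (primes_le n)" using True by (auto simp: le_Suc_eq)
      hence "R (Suc n) = R n + 1 / real (Suc n)" "S (Suc n) = S n + l' / real (Suc n)"
        by (auto simp: R_def S_def l'_def)
      thus ?thesis using l by (simp add: add_divide_distrib)
    next
      case False
      have "primes_le (Suc n) = primes_le n" using False by (auto simp: le_Suc_eq)
      thus ?thesis by (auto simp: R_def S_def l'_def)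
    qed
    \<comment> \<open>The main part l of the bound for S telescopes to ln ln, since (l' - l) / l' is
      at most ln l' - ln l; the additive 4 telescopes to the term 4 (1 / ln 2 - 1 / ln n) of the
      induction hypothesis.\<close>
    have "S n * (1/l - 1/l') \<le> (l + 4) * (1/l - 1/l')"
      using Sn l by (intro mult_right_mono) (auto simp: field_simps)
    also have "\<dots> = (l' - l)/l' + 4 * (1/l - 1/l')" using l by (simp add: field_simps)
    finally have "S n * (1/l - 1/l') \<le> (ln l' - ln l) + 4 * (1/l - 1/l')" using lnl by linarith
    moreover have "S n * (1/l - 1/l') = S n / l - S n / l'" by (simp add: algebra_simps)
    ultimately show ?case using step.IH rec unfolding l_def[symmetric] l'_def[symmetric] by argo
  qed
  define C where "C = 1 + 8 / ln 2 - ln (ln (2::real))"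
  have "C > 0"
  proof -
    have "ln (ln 2) \<le> (0::real)" using ln_2_less_1 by (subst ln_le_zero_iff) auto
    moreover have "8 / ln (2::real) > 0" by simp
    ultimately show ?thesis unfolding C_def by linarith
  qed
  moreover have "R n \<le> ln (ln (real n)) + C" if n: "n \<ge> 2" for n
  proof -
    have l2: "ln (real n) \<ge> ln 2" using n by simp
    hence lp: "ln (real n) > 0" using ln_gt_zero[of "2::real"] by linarith
    have "S n / ln (real n) \<le> (ln (real n) + 4) / ln (real n)"
      unfolding S_def using lp n by (intro divide_right_mono sum_ln_prime_div_le) auto
    also have "\<dots> = 1 + 4 / ln (real n)" using lp by (simp add: field_simps)
    also have "4 / ln (real n) \<le> 4 / ln 2" using l2 lp by (intro divide_left_mono) auto
    finally have "S n / ln (real n) \<le> 1 + 4 / ln 2" by simp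
    moreover have "1 / ln (real n) \<ge> 0" using lp by simp
    ultimately show ?thesis using main[OF n] unfolding C_def by argo
  qed
  ultimately show ?thesis unfolding R_def by blast
qed

section \<open>Sums over proper prime powers\<close>

lemma finite_higher_prime_powers_upto [simp]: "finite (higher_prime_powers_upto X)"
proof (rule finite_subset)
  show "higher_prime_powers_upto X \<subseteq> {..nat \<lfloor>X\<rfloor>}"
    by (auto simp: higher_prime_powers_upto_def le_nat_floor)
qed auto

lemma finite_prime_powers_upto [simp]: "finite (prime_powers_upto X)"
proof (rule finite_subset)
  show "prime_powers_upto X \<subseteq> {..nat \<lfloor>X\<rfloor>}"
    by (auto simp: prime_powers_upto_def le_nat_floor)
qed auto

text \<open>Since p^(k-2) \<ge> 2^(k-2), the double series over p and k is dominated by the product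
  of the convergent series of k^2 / 2^k and (ln p)^2 / p^2, up to the factor 4. The bound shows that
  proper prime powers are negligible against the energy (ln X)^2 of the logarithm.\<close>

lemma sum_higher_prime_powers_le:
  "\<exists>C>0. \<forall>X. (\<Sum>q\<in>higher_prime_powers_upto X. (ln (real q))\<^sup>2 / real q) \<le> C"
proof -
  define u where "u = (\<lambda>k::nat. (real k)\<^sup>2 * (1/2)^k)"
  define v where "v = (\<lambda>n::nat. (ln (real n))\<^sup>2 / (real n)\<^sup>2)"
  have su: "summable u" unfolding u_def
  proof (rule summable_comparison_test_bigo)
    show "summable (\<lambda>k. norm ((3/4::real)^k))" by (simp add: summable_geometric)
    show "(\<lambda>k. (real k)\<^sup>2 * (1/2)^k) \<in> O(\<lambda>k. (3/4::real)^k)" by real_asymp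
  qed
  have sv: "summable v" unfolding v_def
  proof (rule summable_comparison_test_bigo)
    show "summable (\<lambda>n. norm (real n powr (-3/2)))" by (simp add: summable_real_powr_iff)
    show "(\<lambda>n. (ln (real n))\<^sup>2 / (real n)\<^sup>2) \<in> O(\<lambda>n. real n powr (-3/2))" by real_asymp
  qed
  have u0: "u k \<ge> 0" and v0: "v k \<ge> 0" for k by (auto simp: u_def v_def)
  define C where "C = 1 + 4 * suminf u * suminf v"
  have C: "C > 0" unfolding C_def using suminf_nonneg[OF su u0] suminf_nonneg[OF sv v0]
    by (simp add: add_pos_nonneg)
  moreover have "(\<Sum>q\<in>higher_prime_powers_upto X. (ln (real q))\<^sup>2 / real q) \<le> C" for X
  proof -
    define M where "M = nat \<lfloor>X\<rfloor>"
    define I where "I = {2..M} \<times> {2..M}"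
    have sub: "higher_prime_powers_upto X \<subseteq> (\<lambda>(p,k). p ^ k) ` I"
    proof
      fix q assume "q \<in> higher_prime_powers_upto X"
      then obtain p k where pk: "prime p" "k \<ge> 2" "q = p^k" "real q \<le> X"
        by (auto simp: higher_prime_powers_upto_def)
      have p: "p \<ge> 2" using pk prime_ge_2_nat by simp
      have "k < p ^ k" using p by (simp add: power_gt_expt)
      moreover have "p \<le> p ^ k" using p pk by (simp add: self_le_power)
      moreover have "q \<le> M" using pk by (simp add: M_def le_nat_floor)
      ultimately show "q \<in> (\<lambda>(p,k). p ^ k) ` I" using pk p by (auto simp: I_def)
    qed
    have "(\<Sum>q\<in>higher_prime_powers_upto X. (ln (real q))\<^sup>2 / real q) \<le>
       (\<Sum>q\<in>(\<lambda>(p,k). p ^ k) ` I. (ln (real q))\<^sup>2 / real q)"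
      by (intro sum_mono2 sub) (auto simp: I_def)
    also have "\<dots> \<le> (\<Sum>(p,k)\<in>I. (ln (real (p^k)))\<^sup>2 / real (p^k))"
      using sum_image_le[of I "\<lambda>q. (ln (real q))\<^sup>2 / real q" "\<lambda>(p,k). p ^ k"]
      by (simp add: o_def case_prod_beta I_def)
    also have "\<dots> \<le> (\<Sum>(p,k)\<in>I. 4 * u k * v p)"
    proof (intro sum_mono, clarify)
      fix p k assume pk: "(p,k) \<in> I"
      hence pk: "p \<ge> 2" "k \<ge> 2" by (auto simp: I_def)
      obtain j where k: "k = j + 2" using pk by (metis add.commute le_Suc_ex)
      have "(ln (real (p^k)))\<^sup>2 / real (p^k) = (real k)\<^sup>2 * (ln (real p))\<^sup>2 / real p ^ k"
        using pk by (simp add: ln_realpow power_mult_distrib)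
      also have "\<dots> = (real k)\<^sup>2 * v p * (1 / real p) ^ j"
        using pk by (simp add: v_def k power_add power_divide power2_eq_square)
      also have "\<dots> \<le> (real k)\<^sup>2 * v p * (1 / 2) ^ j"
        using pk v0 by (intro mult_left_mono power_mono) (auto simp: field_simps)
      also have "\<dots> = 4 * u k * v p" by (simp add: u_def k power_add)
      finally show "(ln (real (p^k)))\<^sup>2 / real (p^k) \<le> 4 * u k * v p" .
    qed
    also have "\<dots> = 4 * sum u {2..M} * sum v {2..M}"
      by (simp add: I_def sum_product sum.cartesian_product[symmetric] sum_distrib_left mult_ac)
         (subst sum.swap, simp)
    also have "\<dots> \<le> 4 * suminf u * suminf v"
      using su sv u0 v0 by (intro mult_mono sum_le_suminf) (auto intro!: sum_nonneg mult_nonneg_nonneg suminf_nonneg)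
    finally show ?thesis by (simp add: C_def)
  qed
  ultimately show ?thesis by blast
qed

section \<open>Exponential moments of strongly additive functions\<close>

text \<open>The strongly additive function with prescribed values at primes. For an additive g,
  \<open>sadd g\<close> ignores multiplicities and hence can differ from g only where a prime square
  divides n.\<close>

definition sadd :: "(nat \<Rightarrow> real) \<Rightarrow> nat \<Rightarrow> real" where
  "sadd a n = (\<Sum>p\<in>prime_factors n. a p)"

text \<open>The expectation of \<open>sadd a\<close> in the model where p divides n with probability
  1 / p. For a = g it is the function A of the overview.\<close>

definition pmean :: "(nat \<Rightarrow> real) \<Rightarrow> nat \<Rightarrow> real" where
  "pmean a N = (\<Sum>p\<in>primes_le N. a p / real p)"

lemma sadd_0 [simp]: "sadd a 0 = 0" and sadd_1 [simp]: "sadd a (Suc 0) = 0"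
  by (simp_all add: sadd_def)

lemma sadd_prime_mult:
  assumes "prime p" "m > 0"
  shows "sadd a (p * m) = sadd a m + (if p dvd m then 0 else a p)"
proof -
  have "prime_factors (p * m) = insert p (prime_factors m)"
    using assms by (subst prime_factors_product) (auto simp: prime_factorization_prime prime_gt_0_nat)
  moreover have "p \<in> prime_factors m \<longleftrightarrow> p dvd m"
    using assms by (auto simp: prime_factors_dvd)
  ultimately show ?thesis
    unfolding sadd_def by (auto simp: insert_absorb)
qed

lemma sadd_primepow_mult:
  assumes "prime p" "m > 0" "k > 0"
  shows "sadd a (p ^ k * m) = sadd a m + (if p dvd m then 0 else a p)"
proof -
  have "prime_factors (p ^ k * m) = insert p (prime_factors m)"
    using assms by (subst prime_factors_product)
      (auto simp: prime_factorization_prime_power prime_gt_0_nat)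
  moreover have "p \<in> prime_factors m \<longleftrightarrow> p dvd m"
    using assms by (auto simp: prime_factors_dvd)
  ultimately show ?thesis
    unfolding sadd_def by (auto simp: insert_absorb)
qed

lemma card_multiples: "d > 0 \<Longrightarrow> card {n\<in>{1..N}. d dvd n} = N div d"
proof -
  assume d: "d > 0"
  have "{n\<in>{1..N}. d dvd n} = (\<lambda>m. d * m) ` {1..N div d}"
  proof (intro equalityI subsetI)
    fix n assume "n \<in> {n\<in>{1..N}. d dvd n}"
    then obtain m where "n = d * m" "1 \<le> n" "n \<le> N" by (auto elim: dvdE)
    thus "n \<in> (\<lambda>m. d * m) ` {1..N div d}"
      using d by (cases m) (auto simp: less_eq_div_iff_mult_less_eq algebra_simps intro!: image_eqI[of _ _ m])
  next
    fix n assume "n \<in> (\<lambda>m. d * m) ` {1..N div d}"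
    then obtain m where "n = d * m" "m \<in> {1..N div d}" by blast
    thus "n \<in> {n\<in>{1..N}. d dvd n}"
      using d by (auto simp: less_eq_div_iff_mult_less_eq mult.commute Suc_le_eq)
  qed
  moreover have "inj_on (\<lambda>m. d * m) {1..N div d}" using d by (auto simp: inj_on_def)
  ultimately show ?thesis by (simp add: card_image)
qed

lemma sadd_altdef:
  assumes "n \<in> {1..N}"
  shows "sadd a n = (\<Sum>p\<in>primes_le N. if p dvd n then a p else 0)"
proof -
  have "prime_factors n = {p\<in>primes_le N. p dvd n}"
    using assms by (auto simp: prime_factors_dvd dest: dvd_imp_le)
  thus ?thesis unfolding sadd_def by (simp only:) (rule sum.inter_filter, simp)
qed

lemma sum_sadd: "(\<Sum>n=1..N. sadd a n) = (\<Sum>p\<in>primes_le N. a p * real (N div p))"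
proof -
  have "(\<Sum>n=1..N. sadd a n) = (\<Sum>n=1..N. \<Sum>p\<in>primes_le N. if p dvd n then a p else 0)"
    by (intro sum.cong refl sadd_altdef)
  also have "\<dots> = (\<Sum>p\<in>primes_le N. \<Sum>n=1..N. if p dvd n then a p else 0)"
    by (rule sum.swap)
  also have "\<dots> = (\<Sum>p\<in>primes_le N. a p * real (N div p))"
  proof (intro sum.cong refl)
    fix p assume "p \<in> primes_le N"
    hence "card {n\<in>{1..N}. p dvd n} = N div p" by (intro card_multiples) (auto simp: prime_gt_0_nat)
    moreover have "(\<Sum>n=1..N. if p dvd n then a p else 0) = (\<Sum>n\<in>{n\<in>{1..N}. p dvd n}. a p)"
      by (rule sum.inter_filter[symmetric]) auto
    ultimately show "(\<Sum>n=1..N. if p dvd n then a p else 0) = a p * real (N div p)" by simp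
  qed
  finally show ?thesis .
qed

text \<open>Induction on the set of primes, splitting off the exact power of the new prime p. The
  weight depends on the exponent k only through k > 0, so the geometric series yields the local
  factor 1 + exp (a p) / (p - 1).\<close>

lemma euler_product_bound:
  assumes "finite Q" "\<And>p. p \<in> Q \<Longrightarrow> prime p"
  shows "(\<Sum>m | m \<in> {1..N} \<and> prime_factors m \<subseteq> Q. exp (sadd a m) / real m)
           \<le> (\<Prod>p\<in>Q. 1 + exp (a p) / (real p - 1))"
  using assms
proof (induction Q rule: finite_induct)
  case empty
  have "{m. m \<in> {1..N} \<and> prime_factors m \<subseteq> {}} \<subseteq> {1}"
    by (auto simp: prime_factorization_empty_iff)
  hence "(\<Sum>m | m \<in> {1..N} \<and> prime_factors m \<subseteq> {}. exp (sadd a m) / real m)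
      \<le> (\<Sum>m\<in>{1}. exp (sadd a m) / real m)"
    by (intro sum_mono2) auto
  thus ?case by simp
next
  case (insert p Q)
  define T where "T = {m. m \<in> {1..N} \<and> prime_factors m \<subseteq> Q}"
  define T' where "T' = {m. m \<in> {1..N} \<and> prime_factors m \<subseteq> insert p Q}"
  have p: "prime p" and p2: "p \<ge> 2" using insert prime_ge_2_nat by auto
  have [simp]: "finite T" "finite T'" by (auto simp: T_def T'_def)
  have sub: "T' \<subseteq> (\<lambda>(k,m). p^k * m) ` ({0..N} \<times> T)"
  proof
    fix m assume m: "m \<in> T'"
    hence m0: "m > 0" by (auto simp: T'_def)
    define k where "k = multiplicity p m"
    obtain m' where m': "m = p ^ k * m'" "\<not> p dvd m'"
      using multiplicity_decompose'[of m p] m0 p unfolding k_def by (metis not_prime_unit neq0_conv)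
    have m'0: "m' > 0" using m' m0 by (cases m') auto
    have "k < p ^ k" using p2 by (simp add: power_gt_expt)
    also have "p ^ k \<le> m" by (metis m'(1) m0 dvd_imp_le dvd_triv_left)
    finally have kN: "k \<le> N" using m by (auto simp: T'_def)
    have "prime_factors m' \<subseteq> prime_factors m" using m' m0 by (intro dvd_prime_factors) auto
    moreover have "p \<notin> prime_factors m'" using m' by (auto simp: prime_factors_dvd)
    moreover have "m' \<le> m" by (metis m'(1) m0 dvd_imp_le dvd_triv_right)
    ultimately have "m' \<in> T" using m m'0 by (auto simp: T_def T'_def)
    thus "m \<in> (\<lambda>(k,m). p^k * m) ` ({0..N} \<times> T)" using m' kN by force
  qed
  have geo: "(\<Sum>k=1..n. 1 / real p ^ k) = 1 / (real p - 1) - 1 / ((real p - 1) * real p ^ n)" for n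
  proof (induction n)
    case (Suc n)
    have st: "1 / (x * P) = 1 / ((x - 1) * P) - 1 / ((x - 1) * (x * P))" if "x > 1" "P > 0" for x P :: real
    proof -
      have "1 / ((x - 1) * P) = x / ((x - 1) * (x * P))" using that by simp
      also have "\<dots> - 1 / ((x - 1) * (x * P)) = (x - 1) / ((x - 1) * (x * P))"
        by (simp only: diff_divide_distrib)
      finally show ?thesis using that by simp
    qed
    have "1 / real p ^ Suc n = 1 / ((real p - 1) * real p ^ n) - 1 / ((real p - 1) * real p ^ Suc n)"
      using st[of "real p" "real p ^ n"] p2 by simp
    moreover have "(\<Sum>k=1..Suc n. 1 / real p ^ k) = (\<Sum>k=1..n. 1 / real p ^ k) + 1 / real p ^ Suc n" by simp
    ultimately show ?case using Suc by linarith
  qed auto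
  have "(\<Sum>m\<in>T'. exp (sadd a m) / real m) \<le> (\<Sum>m\<in>(\<lambda>(k,m). p^k * m) ` ({0..N} \<times> T). exp (sadd a m) / real m)"
    by (intro sum_mono2 sub) auto
  also have "\<dots> \<le> (\<Sum>(k,m)\<in>{0..N} \<times> T. exp (sadd a (p^k*m)) / real (p^k*m))"
    using sum_image_le[of "{0..N} \<times> T" "\<lambda>m. exp (sadd a m) / real m" "\<lambda>(k,m). p ^ k * m"]
    by (simp add: o_def case_prod_beta)
  also have "\<dots> = (\<Sum>(k,m)\<in>{0..N} \<times> T. (if k = 0 then 1 else exp (a p) / real p ^ k) * (exp (sadd a m) / real m))"
  proof (intro sum.cong refl, clarify)
    fix k m assume m: "m \<in> T"
    have m0: "m > 0" using m by (auto simp: T_def)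
    have "\<not> p dvd m" using m m0 insert p by (auto simp: T_def prime_factors_dvd)
    thus "exp (sadd a (p^k*m)) / real (p^k*m) = (if k = 0 then 1 else exp (a p) / real p ^ k) * (exp (sadd a m) / real m)"
      using sadd_primepow_mult[OF p m0, of k a] by (auto simp: exp_add)
  qed
  also have "\<dots> = (\<Sum>k=0..N. if k = 0 then 1 else exp (a p) / real p ^ k) * (\<Sum>m\<in>T. exp (sadd a m) / real m)"
    by (simp add: sum_product sum.cartesian_product)
  also have "(\<Sum>k=0..N. if k = 0 then 1 else exp (a p) / real p ^ k) = 1 + exp (a p) * (\<Sum>k=1..N. 1 / real p ^ k)"
    by (subst sum.atLeast_Suc_atMost) (auto simp: sum_distrib_left intro!: sum.cong)
  also have "\<dots> \<le> 1 + exp (a p) / (real p - 1)"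
    unfolding geo using p2 by (simp add: right_diff_distrib)
  also have "(1 + exp (a p) / (real p - 1)) * (\<Sum>m\<in>T. exp (sadd a m) / real m) \<le>
     (1 + exp (a p) / (real p - 1)) * (\<Prod>p\<in>Q. 1 + exp (a p) / (real p - 1))"
    using insert p2 by (intro mult_left_mono) (auto simp: T_def intro!: add_nonneg_nonneg divide_nonneg_nonneg)
  finally show ?case using insert by (simp add: T'_def mult_right_mono sum_nonneg)
qed

lemma exp_le_quadratic:
  fixes t K :: real
  assumes "\<bar>t\<bar> \<le> K"
  shows "exp t \<le> 1 + t + exp K * t\<^sup>2"
proof -
  obtain s where s: "\<bar>s\<bar> \<le> \<bar>t\<bar>" "exp t = (\<Sum>m<2. t ^ m / fact m) + exp s / fact 2 * t ^ 2"
    using Maclaurin_exp_le[of t 2] by blast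
  have "exp s / fact 2 \<le> exp K" using s assms exp_gt_zero[of s]
    by (intro order_trans[OF _ exp_le_cancel_iff[THEN iffD2, of s K]]) auto
  hence "exp s / fact 2 * t^2 \<le> exp K * t^2" by (intro mult_right_mono) auto
  thus ?thesis using s by (simp add: numeral_2_eq_2)
qed

lemma sum_recip_consecutive: "(\<Sum>p\<in>primes_le N. 1 / (real p * (real p - 1))) \<le> 1"
proof -
  have "(\<Sum>p\<in>primes_le N. 1 / (real p * (real p - 1))) \<le> (\<Sum>n=2..Suc N. 1 / (real n * (real n - 1)))"
    by (intro sum_mono2) (auto simp: prime_ge_2_nat)
  also have "(\<Sum>n=2..Suc N. 1 / (real n * (real n - 1))) = 1 - 1 / real (Suc N)"
  proof (induction N)
    case (Suc N)
    have "1 / (real (Suc (Suc N)) * (real (Suc (Suc N)) - 1)) = 1 / real (Suc N) - 1 / real (Suc (Suc N))"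
      by (simp add: field_simps)
    moreover have "(\<Sum>n=2..Suc (Suc N). 1 / (real n * (real n - 1))) =
      (\<Sum>n=2..Suc N. 1 / (real n * (real n - 1))) + 1 / (real (Suc (Suc N)) * (real (Suc (Suc N)) - 1))"
      by simp
    ultimately show ?case using Suc by linarith
  qed auto
  finally show ?thesis by (rule order_trans) simp
qed

text \<open>Comparing the logarithms of the integers with a sum over prime powers (as in the
  Hall--Tenenbaum inequality) reduces the mean value to an Euler product.\<close>
lemma exp_moment:
  fixes K :: real
  assumes K: "K \<ge> 0"
  shows "\<exists>C>0. \<forall>N\<ge>2. \<forall>a. (\<forall>p\<in>primes_le N. \<bar>a p\<bar> \<le> K) \<longrightarrow> (\<Sum>p\<in>primes_le N. (a p)\<^sup>2 / real p) \<le> 1 \<longrightarrow>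
     (\<Sum>n=1..N. exp (sadd a n)) \<le> C * real N * exp (pmean a N)"
proof -
  obtain C0 where C0: "C0 > 0" "\<And>N. N \<ge> 2 \<Longrightarrow> (\<Sum>p\<in>primes_le N. 1 / real p) \<le> ln (ln (real N)) + C0"
    using sum_prime_recip_le by blast
  define C where "C = (1 + 4 * exp K) * exp (C0 + 2 * exp K)"
  have "C > 0" by (simp add: C_def add_pos_pos)
  moreover have "(\<Sum>n=1..N. exp (sadd a n)) \<le> C * real N * exp (pmean a N)"
    if N: "N \<ge> 2" and aK: "\<forall>p\<in>primes_le N. \<bar>a p\<bar> \<le> K" and a1: "(\<Sum>p\<in>primes_le N. (a p)\<^sup>2 / real p) \<le> 1" for N a
  proof -
    define h where "h = (\<lambda>n. exp (sadd a n))"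
    define D where "D = (\<Sum>m=1..N. h m / real m)"
    have lN: "ln (real N) > 0" using N by simp
    have h0: "h n \<ge> 0" for n by (simp add: h_def)
    have "(\<Sum>n=1..N. h n * ln (real n)) = (\<Sum>n=1..N. \<Sum>d | d dvd n. mangoldt d * h (d * (n div d)))"
    proof (intro sum.cong refl)
      fix n assume n: "n \<in> {1..N}"
      have "h n * ln (real n) = (\<Sum>d | d dvd n. mangoldt d) * h n" using n by (subst mangoldt_sum) auto
      also have "\<dots> = (\<Sum>d | d dvd n. mangoldt d * h n)" by (rule sum_distrib_right)
      also have "\<dots> = (\<Sum>d | d dvd n. mangoldt d * h (d * (n div d)))"
        by (intro sum.cong refl) auto
      finally show "h n * ln (real n) = \<dots>" .
    qed
    also have "\<dots> = (\<Sum>d=1..N. \<Sum>m=1..N div d. mangoldt d * h (d * m))"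
      by (rule sum_divisors_swap)
    \<comment> \<open>Multiplying m by a prime power changes \<open>sadd a\<close> by 0 or by
      \<open>a p \<le> K\<close>. After this the summand involves h only at m, and exchanging the
      two variables turns the sum of \<open>mangoldt\<close> into
      \<open>psi (N div d)\<close>.\<close>
    also have "\<dots> \<le> (\<Sum>d=1..N. \<Sum>m=1..N div d. mangoldt d * (exp K * h m))"
    proof (intro sum_mono)
      fix d m assume d: "d \<in> {1..N}" and m: "m \<in> {1..N div d}"
      show "mangoldt d * h (d * m) \<le> mangoldt d * (exp K * h m)"
      proof (cases "primepow d")
        case True
        then obtain p k where pk: "prime p" "k > 0" "d = p ^ k" by (auto simp: primepow_def)
        have "p \<le> p ^ k" using pk prime_gt_0_nat by (intro self_le_power) (auto simp: Suc_le_eq)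
        hence "p \<in> primes_le N" using pk d by auto
        from bspec[OF aK this] have "a p \<le> K" by linarith
        moreover have "m > 0" using m by auto
        ultimately have "sadd a (d * m) \<le> K + sadd a m"
          using K sadd_primepow_mult[of p m k a] pk(1,2) unfolding pk(3) by (cases "p dvd m") simp_all
        hence "h (d * m) \<le> exp K * h m" unfolding h_def by (simp flip: exp_add)
        thus ?thesis by (intro mult_left_mono mangoldt_nonneg)
      qed (simp add: mangoldt_def)
    qed
    also have "\<dots> = (\<Sum>n=1..N. \<Sum>d | d dvd n. mangoldt d * (exp K * h (n div d)))"
      by (rule sum_divisors_swap[symmetric])
    also have "\<dots> = (\<Sum>n=1..N. \<Sum>d | d dvd n. mangoldt (n div d) * (exp K * h d))"
    proof (rule sum.cong[OF refl])
      fix n assume n: "n \<in> {1..N}"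
      show "(\<Sum>d | d dvd n. mangoldt d * (exp K * h (n div d))) = (\<Sum>d | d dvd n. mangoldt (n div d) * (exp K * h d))"
        using n by (intro sum.reindex_bij_witness[of _ "\<lambda>d. n div d" "\<lambda>d. n div d"]) auto
    qed
    also have "\<dots> = (\<Sum>d=1..N. \<Sum>m=1..N div d. mangoldt m * (exp K * h d))"
      by (rule sum_divisors_swap)
    also have "\<dots> = (\<Sum>d=1..N. psi (N div d) * (exp K * h d))"
      by (simp add: psi_def sum_distrib_right)
    also have "\<dots> \<le> (\<Sum>d=1..N. 4 * (real N / real d) * (exp K * h d))"
    proof (intro sum_mono mult_right_mono)
      fix d
      have "psi (N div d) \<le> 4 * real (N div d)" by (rule psi_le)
      also have "\<dots> \<le> 4 * (real N / real d)" by (intro mult_left_mono of_nat_div_le_of_nat) auto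
      finally show "psi (N div d) \<le> 4 * (real N / real d)" .
    qed (auto simp: h0)
    also have "\<dots> = 4 * exp K * real N * D" by (simp add: D_def sum_distrib_left mult_ac)
    finally have 1: "(\<Sum>n=1..N. h n * ln (real n)) \<le> 4 * exp K * real N * D" .
    \<comment> \<open>Writing ln N = ln n + ln (N / n), this is the part that needs no information
      on primes. The later division by ln N cancels the factor ln N that the Euler product
      contributes through the sum of 1 / p.\<close>
    have 2: "(\<Sum>n=1..N. h n * (ln (real N) - ln (real n))) \<le> real N * D"
    proof -
      have "(\<Sum>n=1..N. h n * (ln (real N) - ln (real n))) \<le> (\<Sum>n=1..N. h n * (real N / real n))"
      proof (intro sum_mono mult_left_mono h0)
        fix n assume n: "n \<in> {1..N}"
        have "ln (real N / real n) \<le> real N / real n - 1" using n by (intro ln_le_minus_one) auto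
        thus "ln (real N) - ln (real n) \<le> real N / real n" using n by (simp add: ln_div)
      qed
      thus ?thesis by (simp add: D_def sum_distrib_left mult_ac)
    qed
    have "(\<Sum>n=1..N. h n) * ln (real N) = (\<Sum>n=1..N. h n * ln (real n)) + (\<Sum>n=1..N. h n * (ln (real N) - ln (real n)))"
      unfolding sum_distrib_right sum.distrib[symmetric]
      by (intro sum.cong) (auto simp: algebra_simps)
    also have "\<dots> \<le> (1 + 4 * exp K) * real N * D" using 1 2 by (simp add: algebra_simps)
    finally have S: "(\<Sum>n=1..N. h n) * ln (real N) \<le> (1 + 4 * exp K) * real N * D" .
    have "D \<le> (\<Sum>m | m \<in> {1..N} \<and> prime_factors m \<subseteq> primes_le N. exp (sadd a m) / real m)"
      unfolding D_def h_def by (intro eq_refl sum.cong) (auto simp: prime_factors_dvd intro: order_trans[OF dvd_imp_le])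
    also have "\<dots> \<le> (\<Prod>p\<in>primes_le N. 1 + exp (a p) / (real p - 1))"
      by (rule euler_product_bound) auto
    also have "\<dots> \<le> (\<Prod>p\<in>primes_le N. exp (exp (a p) / (real p - 1)))"
      by (intro prod_mono) (auto intro!: add_nonneg_nonneg divide_nonneg_nonneg simp: Suc_le_eq prime_gt_0_nat)
    also have "\<dots> = exp (\<Sum>p\<in>primes_le N. exp (a p) / (real p - 1))"
      by (rule exp_sum[symmetric]) auto
    also have "(\<Sum>p\<in>primes_le N. exp (a p) / (real p - 1)) \<le>
       (\<Sum>p\<in>primes_le N. 1 / real p + a p / real p + exp K * ((a p)\<^sup>2 / real p) + exp K * (1 / (real p * (real p - 1))))"
    proof (rule sum_mono)
      fix p assume p: "p \<in> primes_le N"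
      have p2: "real p \<ge> 2" using p prime_ge_2_nat by (metis (mono_tags) mem_Collect_eq of_nat_le_iff of_nat_numeral)
      have e: "exp (a p) / (real p - 1) = exp (a p) / real p + exp (a p) * (1 / (real p * (real p - 1)))"
        using p2 by (simp add: field_simps)
      have "exp (a p) / real p \<le> (1 + a p + exp K * (a p)\<^sup>2) / real p"
        using aK p p2 by (intro divide_right_mono exp_le_quadratic) auto
      also have "\<dots> = 1 / real p + a p / real p + exp K * ((a p)\<^sup>2 / real p)" by (simp add: add_divide_distrib)
      finally have 3: "exp (a p) / real p \<le> \<dots>" .
      have "exp (a p) \<le> exp K" using bspec[OF aK p] by auto
      hence "exp (a p) * (1 / (real p * (real p - 1))) \<le> exp K * (1 / (real p * (real p - 1)))"
        using p2 by (intro mult_right_mono) auto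
      thus "exp (a p) / (real p - 1) \<le> 1 / real p + a p / real p + exp K * ((a p)\<^sup>2 / real p) + exp K * (1 / (real p * (real p - 1)))"
        using e 3 by linarith
    qed
    also have "\<dots> = (\<Sum>p\<in>primes_le N. 1 / real p) + pmean a N + exp K * (\<Sum>p\<in>primes_le N. (a p)\<^sup>2 / real p)
        + exp K * (\<Sum>p\<in>primes_le N. 1 / (real p * (real p - 1)))"
      by (simp add: sum.distrib sum_distrib_left pmean_def)
    also have "\<dots> \<le> (ln (ln (real N)) + C0) + pmean a N + exp K * 1 + exp K * 1"
      using C0(2)[OF N] a1 sum_recip_consecutive[of N]
      by (intro add_mono mult_left_mono) auto
    finally have "D \<le> exp (ln (ln (real N)) + C0 + pmean a N + 2 * exp K)" by (simp add: algebra_simps)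
    also have "\<dots> = ln (real N) * exp (C0 + 2 * exp K) * exp (pmean a N)"
      using lN by (simp add: exp_add)
    finally have "(1 + 4 * exp K) * real N * D \<le> (1 + 4 * exp K) * real N * (ln (real N) * exp (C0 + 2 * exp K) * exp (pmean a N))"
      by (intro mult_left_mono) (auto intro: add_nonneg_nonneg)
    also have "\<dots> = C * real N * exp (pmean a N) * ln (real N)" by (simp add: C_def mult_ac)
    finally show ?thesis using S lN unfolding h_def by (metis (no_types, lifting) mult_le_cancel_right_pos order_trans)
  qed
  ultimately show ?thesis by blast
qed

text \<open>The constant of \<open>exp_moment\<close> is uniform in a, so it applies to a / \<beta>
  and to -a / \<beta> alike; then x^4 \<le> 256 (exp x + exp (-x)) with x the normalised deviation,
  and 512 is twice 256.\<close>

lemma fourth_moment: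
  fixes K :: real
  assumes K: "K \<ge> 0"
  shows "\<exists>C>0. \<forall>N\<ge>2. \<forall>a \<beta>. \<beta> > 0 \<longrightarrow> (\<forall>p\<in>primes_le N. \<bar>a p\<bar> \<le> K * \<beta>) \<longrightarrow>
     (\<Sum>p\<in>primes_le N. (a p)\<^sup>2 / real p) \<le> \<beta>\<^sup>2 \<longrightarrow>
     (\<Sum>n=1..N. (sadd a n - pmean a N) ^ 4) \<le> C * real N * \<beta> ^ 4"
proof -
  obtain C where C: "C > 0" "\<And>N a. N \<ge> 2 \<Longrightarrow> (\<forall>p\<in>primes_le N. \<bar>a p\<bar> \<le> K) \<Longrightarrow> (\<Sum>p\<in>primes_le N. (a p)\<^sup>2 / real p) \<le> 1 \<Longrightarrow>
     (\<Sum>n=1..N. exp (sadd a n)) \<le> C * real N * exp (pmean a N)"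
    using exp_moment[OF K] by blast
  have "(\<Sum>n=1..N. (sadd a n - pmean a N) ^ 4) \<le> (512 * C) * real N * \<beta> ^ 4"
    if N: "N \<ge> 2" and \<beta>: "\<beta> > 0" and aK: "\<forall>p\<in>primes_le N. \<bar>a p\<bar> \<le> K * \<beta>"
      and a1: "(\<Sum>p\<in>primes_le N. (a p)\<^sup>2 / real p) \<le> \<beta>\<^sup>2" for N a \<beta>
  proof -
    have pw: "x ^ 4 \<le> 256 * (exp x + exp (- x))" for x :: real
    proof -
      have "(1 + \<bar>x\<bar> / 4) ^ 4 \<le> exp \<bar>x\<bar>"
        using exp_ge_one_plus_x_over_n_power_n[of 4 "\<bar>x\<bar>"] by simp
      moreover have "(\<bar>x\<bar> / 4) ^ 4 \<le> (1 + \<bar>x\<bar> / 4) ^ 4" by (intro power_mono) auto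
      moreover have "(\<bar>x\<bar> / 4) ^ 4 = x ^ 4 / 256" by (simp add: power_divide)
      moreover have "exp \<bar>x\<bar> \<le> exp x + exp (-x)" by (auto simp: abs_if)
      ultimately show ?thesis by argo
    qed
    have E: "(\<Sum>n=1..N. exp (s * ((sadd a n - pmean a N) / \<beta>))) \<le> C * real N" if s: "\<bar>s\<bar> = 1" for s
    proof -
      define b where "b = (\<lambda>p. s / \<beta> * a p)"
      have sb: "sadd b n = s / \<beta> * sadd a n" "pmean b N = s / \<beta> * pmean a N" for n
        by (simp_all add: sadd_def pmean_def b_def sum_distrib_left sum_divide_distrib)
      have "(\<Sum>p\<in>primes_le N. (b p)\<^sup>2 / real p) = (\<Sum>p\<in>primes_le N. (a p)\<^sup>2 / real p) / \<beta>\<^sup>2"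
      proof -
        have "s\<^sup>2 = 1" using s by (metis abs_1 power2_abs power_one)
        thus ?thesis unfolding sum_divide_distrib b_def by (intro sum.cong) (auto simp: power_mult_distrib power_divide)
      qed
      also have "\<dots> \<le> 1" using a1 \<beta> by simp
      finally have "(\<Sum>n=1..N. exp (sadd b n)) \<le> C * real N * exp (pmean b N)"
        using N aK s \<beta> by (intro C(2)) (auto simp: b_def abs_mult field_simps)
      hence "(\<Sum>n=1..N. exp (sadd b n)) / exp (pmean b N) \<le> C * real N" by (simp add: field_simps)
      thus ?thesis by (simp add: sb sum_divide_distrib exp_diff algebra_simps diff_divide_distrib)
    qed
    have "(\<Sum>n=1..N. (sadd a n - pmean a N) ^ 4) = \<beta>^4 * (\<Sum>n=1..N. ((sadd a n - pmean a N) / \<beta>) ^ 4)"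
      using \<beta> by (simp add: power_divide sum_divide_distrib[symmetric])
    also have "\<dots> \<le> \<beta>^4 * (\<Sum>n=1..N. 256 * (exp ((sadd a n - pmean a N) / \<beta>) + exp (- ((sadd a n - pmean a N) / \<beta>))))"
      by (intro mult_left_mono sum_mono pw) auto
    also have "\<dots> \<le> \<beta>^4 * (256 * (C * real N + C * real N))"
    proof -
      have "(\<Sum>n=1..N. exp ((sadd a n - pmean a N) / \<beta>)) \<le> C * real N"
        "(\<Sum>n=1..N. exp (- ((sadd a n - pmean a N) / \<beta>))) \<le> C * real N"
        using E[of 1, unfolded mult_1] E[of "-1", unfolded mult_minus1] by auto
      thus ?thesis
        unfolding sum_distrib_left[symmetric] sum.distrib by (intro mult_left_mono add_mono) auto
    qed
    finally show ?thesis by (simp add: algebra_simps)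
  qed
  thus ?thesis using C(1) by (intro exI[of _ "512 * C"]) auto
qed

section \<open>Second moments over sparse sets of prime powers\<close>

lemma square_diff_le: "(x - y)\<^sup>2 \<le> 2 * (x - c)\<^sup>2 + 2 * (y - c)\<^sup>2" for x y c :: real
  using sum_squares_bound[of "x - c" "c - y"] by (simp add: power2_eq_square algebra_simps)

lemma square_minus_le: "(x - y)\<^sup>2 \<le> 2 * x\<^sup>2 + 2 * y\<^sup>2" for x y :: real
  using square_diff_le[of x y 0] by simp

lemma square_plus_le: "(x + y)\<^sup>2 \<le> 2 * x\<^sup>2 + 2 * y\<^sup>2" for x y :: real
  using square_minus_le[of x "- y"] by simp

text \<open>Young's inequality with a free parameter. A small s makes the quadratic term cheap at
  the price of a large constant, which is affordable on a sparse set or where the constant can be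
  traded against another small quantity.\<close>

lemma le_scaled_square:
  fixes x s b :: real
  assumes "x \<ge> 0" "s > 0" "b > 0"
  shows "x \<le> (s / b) * x\<^sup>2 + b / s"
proof -
  have "0 \<le> (s * x - b)\<^sup>2 + s * x * b" using assms by (intro add_nonneg_nonneg) auto
  hence "x * (s * b) \<le> s\<^sup>2 * x\<^sup>2 + b\<^sup>2" by (simp add: power2_eq_square algebra_simps)
  hence "x \<le> (s\<^sup>2 * x\<^sup>2 + b\<^sup>2) / (s * b)" using assms by (simp add: pos_le_divide_eq)
  also have "\<dots> = (s / b) * x\<^sup>2 + b / s" using assms by (simp add: power2_eq_square field_simps)
  finally show ?thesis .
qed

lemma Cauchy_Schwarz_weighted:
  fixes u w :: "'a \<Rightarrow> real"
  assumes "\<And>i. i \<in> A \<Longrightarrow> w i \<ge> 0"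
  shows "(\<Sum>i\<in>A. u i * w i)\<^sup>2 \<le> (\<Sum>i\<in>A. (u i)\<^sup>2 * w i) * (\<Sum>i\<in>A. w i)"
proof -
  have "(\<Sum>i\<in>A. u i * w i) = (\<Sum>i\<in>A. (u i * sqrt (w i)) * sqrt (w i))"
    using assms by (intro sum.cong) (auto simp: mult.assoc)
  hence "(\<Sum>i\<in>A. u i * w i)\<^sup>2 \<le> (\<Sum>i\<in>A. (u i * sqrt (w i))\<^sup>2) * (\<Sum>i\<in>A. (sqrt (w i))\<^sup>2)"
    by (metis Cauchy_Schwarz_ineq_sum)
  also have "\<dots> = (\<Sum>i\<in>A. (u i)\<^sup>2 * w i) * (\<Sum>i\<in>A. w i)"
    using assms by (intro arg_cong2[of _ _ _ _ "(*)"] sum.cong) (auto simp: power_mult_distrib)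
  finally show ?thesis .
qed

lemma Cauchy_Schwarz_recip:
  fixes u :: "nat \<Rightarrow> real"
  shows "(\<Sum>p\<in>A. u p / real p)\<^sup>2 \<le> (\<Sum>p\<in>A. (u p)\<^sup>2 / real p) * (\<Sum>p\<in>A. 1 / real p)"
  using Cauchy_Schwarz_weighted[of A "\<lambda>p. 1 / real p" u] by simp

lemma Cauchy_Schwarz_abs:
  fixes u :: "nat \<Rightarrow> real"
  assumes "\<And>p. p \<in> A \<Longrightarrow> p > 0"
  shows "(\<Sum>p\<in>A. \<bar>u p\<bar>)\<^sup>2 \<le> (\<Sum>p\<in>A. (u p)\<^sup>2 / real p) * (\<Sum>p\<in>A. real p)"
proof -
  have "(\<Sum>p\<in>A. \<bar>u p\<bar>) = (\<Sum>p\<in>A. \<bar>u p\<bar> / real p * real p)"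
    "(\<Sum>p\<in>A. (u p)\<^sup>2 / real p) = (\<Sum>p\<in>A. (\<bar>u p\<bar> / real p)\<^sup>2 * real p)"
    using assms by (auto intro!: sum.cong simp: power_divide power2_eq_square)
  thus ?thesis using Cauchy_Schwarz_weighted[of A "\<lambda>p. real p" "\<lambda>p. \<bar>u p\<bar> / real p"] by simp
qed

text \<open>A second moment without centring, for events of density at most \<rho> that are pairwise
  independent up to an inequality: the diagonal of the expanded square gives one term,
  Cauchy--Schwarz off the diagonal the other. The loss of the sum of \<rho> is harmless because only
  index sets with bounded total density occur.\<close>

lemma sum_square_indicator_le:
  fixes u \<rho> :: "'i \<Rightarrow> real" and D :: "'i \<Rightarrow> nat set"
  assumes fin: "finite I" and \<rho>: "\<And>i. i \<in> I \<Longrightarrow> \<rho> i \<ge> 0"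
    and single: "\<And>i. i \<in> I \<Longrightarrow> real (card {n\<in>{1..N}. n \<in> D i}) \<le> real N * \<rho> i"
    and pair: "\<And>i j. i \<in> I \<Longrightarrow> j \<in> I \<Longrightarrow> i \<noteq> j \<Longrightarrow>
        real (card {n\<in>{1..N}. n \<in> D i \<and> n \<in> D j}) \<le> real N * (\<rho> i * \<rho> j)"
  shows "(\<Sum>n=1..N. (\<Sum>i\<in>I. if n \<in> D i then u i else 0)\<^sup>2)
           \<le> real N * (1 + (\<Sum>i\<in>I. \<rho> i)) * (\<Sum>i\<in>I. (u i)\<^sup>2 * \<rho> i)"
proof -
  define c where "c = (\<lambda>i j. real (card {n\<in>{1..N}. n \<in> D i \<and> n \<in> D j}))"
  have "(\<Sum>n=1..N. (\<Sum>i\<in>I. if n \<in> D i then u i else 0)\<^sup>2) =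
        (\<Sum>n=1..N. \<Sum>i\<in>I. \<Sum>j\<in>I. if n \<in> D i \<and> n \<in> D j then u i * u j else 0)"
    by (simp add: power2_eq_square sum_product) (intro sum.cong, auto)
  also have "\<dots> = (\<Sum>i\<in>I. \<Sum>j\<in>I. \<Sum>n=1..N. if n \<in> D i \<and> n \<in> D j then u i * u j else 0)"
    by (subst sum.swap, rule sum.cong[OF refl], subst sum.swap, rule refl)
  also have "\<dots> = (\<Sum>i\<in>I. \<Sum>j\<in>I. u i * u j * c i j)"
  proof (intro sum.cong refl)
    fix i j
    have "(\<Sum>n=1..N. if n \<in> D i \<and> n \<in> D j then u i * u j else 0) = (\<Sum>n\<in>{n\<in>{1..N}. n \<in> D i \<and> n \<in> D j}. u i * u j)"
      by (rule sum.inter_filter[symmetric]) auto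
    thus "(\<Sum>n=1..N. if n \<in> D i \<and> n \<in> D j then u i * u j else 0) = u i * u j * c i j"
      by (simp add: c_def)
  qed
  also have "\<dots> \<le> (\<Sum>i\<in>I. \<Sum>j\<in>I. real N * ((if i = j then (u i)\<^sup>2 * \<rho> i else 0) + (\<bar>u i\<bar> * \<rho> i) * (\<bar>u j\<bar> * \<rho> j)))"
  proof (intro sum_mono)
    fix i j assume ij: "i \<in> I" "j \<in> I"
    show "u i * u j * c i j \<le> real N * ((if i = j then (u i)\<^sup>2 * \<rho> i else 0) + (\<bar>u i\<bar> * \<rho> i) * (\<bar>u j\<bar> * \<rho> j))"
    proof (cases "i = j")
      case True
      have "u i * u j * c i j \<le> (u i)\<^sup>2 * (real N * \<rho> i)"
        using single[OF ij(1)] True by (auto simp: c_def power2_eq_square intro!: mult_left_mono)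
      moreover have "real N * ((\<bar>u i\<bar> * \<rho> i) * (\<bar>u j\<bar> * \<rho> j)) \<ge> 0" using \<rho> ij by simp
      ultimately show ?thesis using True by (simp add: algebra_simps)
    next
      case False
      have "u i * u j * c i j \<le> \<bar>u i * u j\<bar> * c i j" by (intro mult_right_mono) (auto simp: c_def)
      also have "\<dots> \<le> \<bar>u i * u j\<bar> * (real N * (\<rho> i * \<rho> j))"
        using pair[OF ij False] by (intro mult_left_mono) (auto simp: c_def)
      finally show ?thesis using False by (simp add: abs_mult mult_ac)
    qed
  qed
  also have "\<dots> = real N * ((\<Sum>i\<in>I. (u i)\<^sup>2 * \<rho> i) + (\<Sum>i\<in>I. \<bar>u i\<bar> * \<rho> i)\<^sup>2)"
    using fin by (simp add: sum_distrib_left[symmetric] sum.distrib power2_eq_square sum_product)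
  also have "(\<Sum>i\<in>I. \<bar>u i\<bar> * \<rho> i)\<^sup>2 \<le> (\<Sum>i\<in>I. (u i)\<^sup>2 * \<rho> i) * (\<Sum>i\<in>I. \<rho> i)"
    using Cauchy_Schwarz_weighted[of I \<rho> "\<lambda>i. \<bar>u i\<bar>"] \<rho> by simp
  finally show ?thesis by (simp add: algebra_simps mult_left_mono mult_right_mono)
qed

lemma card_multiples_le: "d > 0 \<Longrightarrow> real (card {n\<in>{1..N}. d dvd n}) \<le> real N / real d"
  by (subst card_multiples) (auto intro: of_nat_div_le_of_nat)

text \<open>To be used with S the primes at which g is exceptionally large; their reciprocal sum is
  bounded, so that no subtraction of the mean is required.\<close>

lemma sum_square_sadd_le:
  assumes S: "\<And>p. p \<in> primes_le N \<Longrightarrow> b p \<noteq> 0 \<Longrightarrow> p \<in> S"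
  shows "(\<Sum>n=1..N. (sadd b n)\<^sup>2) \<le>
    real N * (1 + (\<Sum>p\<in>{p\<in>primes_le N. p \<in> S}. 1 / real p)) * (\<Sum>p\<in>primes_le N. (b p)\<^sup>2 / real p)"
proof -
  define I where "I = {p\<in>primes_le N. p \<in> S}"
  have I: "finite I" "I \<subseteq> primes_le N" by (auto simp: I_def)
  have "(\<Sum>n=1..N. (sadd b n)\<^sup>2) = (\<Sum>n=1..N. (\<Sum>p\<in>I. if n \<in> {n. p dvd n} then b p else 0)\<^sup>2)"
  proof (intro sum.cong refl arg_cong[of _ _ "\<lambda>x. x\<^sup>2"])
    fix n assume "n \<in> {1..N}"
    thus "sadd b n = (\<Sum>p\<in>I. if n \<in> {n. p dvd n} then b p else 0)"
      unfolding sadd_altdef[OF \<open>n \<in> {1..N}\<close>] using S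
      by (intro sum.mono_neutral_cong_right) (auto simp: I_def)
  qed
  also have "\<dots> \<le> real N * (1 + (\<Sum>p\<in>I. 1 / real p)) * (\<Sum>p\<in>I. (b p)\<^sup>2 * (1 / real p))"
  proof (rule sum_square_indicator_le)
    fix p assume "p \<in> I"
    thus "real (card {n\<in>{1..N}. n \<in> {n. p dvd n}}) \<le> real N * (1 / real p)"
      using card_multiples_le[of p N] I by (auto simp: prime_gt_0_nat)
  next
    fix p q assume pq: "p \<in> I" "q \<in> I" "p \<noteq> q"
    hence "coprime p q" using I by (intro primes_coprime) auto
    hence "{n\<in>{1..N}. n \<in> {n. p dvd n} \<and> n \<in> {n. q dvd n}} = {n\<in>{1..N}. (p * q) dvd n}"
      by (auto intro: divides_mult elim: dvd_mult_left dvd_mult_right)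
    thus "real (card {n\<in>{1..N}. n \<in> {n. p dvd n} \<and> n \<in> {n. q dvd n}}) \<le> real N * (1 / real p * (1 / real q))"
      using card_multiples_le[of "p * q" N] pq by (auto simp: prime_gt_0_nat I_def)
  qed (use I in auto)
  also have "(\<Sum>p\<in>I. (b p)\<^sup>2 * (1 / real p)) = (\<Sum>p\<in>primes_le N. (b p)\<^sup>2 / real p)"
    using I S by (intro sum.mono_neutral_cong_left) (auto simp: I_def)
  finally show ?thesis by (simp add: I_def)
qed

section \<open>Additive functions and exactly dividing prime powers\<close>

lemma additive_function_1: "additive_function g \<Longrightarrow> g (Suc 0) = 0"
  unfolding additive_function_def by (metis coprime_1_left One_nat_def add_cancel_right_left mult_1 zero_less_one)

lemma additive_function_prod:
  assumes "additive_function g" "finite P" "\<And>p. p \<in> P \<Longrightarrow> prime p"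
  shows "g (\<Prod>p\<in>P. p ^ k p) = (\<Sum>p\<in>P. g (p ^ k p))"
  using assms(2,3)
proof (induction P rule: finite_induct)
  case empty
  thus ?case using additive_function_1[OF assms(1)] by simp
next
  case (insert p P)
  have "coprime (p ^ k p) (\<Prod>q\<in>P. q ^ k q)"
  proof (rule prod_coprime_right)
    fix q assume "q \<in> P"
    hence "coprime p q" using insert by (intro primes_coprime) auto
    thus "coprime (p ^ k p) (q ^ k q)" by simp
  qed
  moreover have "p ^ k p > 0" "(\<Prod>q\<in>P. q ^ k q) > 0"
    using insert by (auto intro!: prod_pos simp: prime_gt_0_nat)
  ultimately have "g (p ^ k p * (\<Prod>q\<in>P. q ^ k q)) = g (p ^ k p) + g (\<Prod>q\<in>P. q ^ k q)"
    using assms(1) by (auto simp: additive_function_def)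
  thus ?case using insert by simp
qed

lemma additive_function_factorize:
  assumes "additive_function g" "n > 0"
  shows "g n = (\<Sum>p\<in>prime_factors n. g (p ^ multiplicity p n))"
proof -
  have "n = (\<Prod>p\<in>prime_factors n. p ^ multiplicity p n)"
    using assms prod_prime_factors[of n] by simp
  moreover have "g (\<Prod>p\<in>prime_factors n. p ^ multiplicity p n) = (\<Sum>p\<in>prime_factors n. g (p ^ multiplicity p n))"
    by (rule additive_function_prod[OF assms(1)]) auto
  ultimately show ?thesis by simp
qed

text \<open>Proper prime powers as pairs, because the events used below are of the form "p divides n
  exactly k times" and need both entries; \<open>sum_hpairs\<close> translates back to
  values.\<close>

definition hpairs :: "nat \<Rightarrow> (nat \<times> nat) set" where
  "hpairs N = {(p,k). prime p \<and> k \<ge> 2 \<and> p ^ k \<le> N}"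

lemma hpairs_subset: "hpairs N \<subseteq> primes_le N \<times> {2..N}"
proof
  fix x assume "x \<in> hpairs N"
  then obtain p k where x: "x = (p,k)" "prime p" "k \<ge> 2" "p ^ k \<le> N" by (auto simp: hpairs_def)
  have p: "p \<ge> 2" using x prime_ge_2_nat by simp
  have "k < p ^ k" using p by (simp add: power_gt_expt)
  moreover have "p \<le> p ^ k" using p x by (simp add: self_le_power)
  ultimately show "x \<in> primes_le N \<times> {2..N}" using x by auto
qed

lemma finite_hpairs [simp]: "finite (hpairs N)"
  by (rule finite_subset[OF hpairs_subset]) auto

lemma sum_hpairs:
  fixes F :: "nat \<Rightarrow> real"
  shows "(\<Sum>(p,k)\<in>hpairs N. F (p ^ k)) = (\<Sum>q\<in>higher_prime_powers_upto (real N). F q)"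
proof -
  have "inj_on (\<lambda>(p,k). p ^ k) (hpairs N)"
  proof (rule inj_onI, clarify)
    fix p k p' k' assume a: "(p,k) \<in> hpairs N" "(p',k') \<in> hpairs N" "p ^ k = p' ^ k'"
    have "aprimedivisor (p ^ k) = p" "aprimedivisor (p' ^ k') = p'"
      using a(1,2) by (auto simp: hpairs_def aprimedivisor_prime_power)
    hence p: "p = p'" using a(3) by metis
    moreover have "p > 1" using a(1) by (auto simp: hpairs_def intro: prime_gt_Suc_0_nat)
    ultimately show "p = p' \<and> k = k'" using a by (simp add: power_inject_exp)
  qed
  moreover have "(\<lambda>(p,k). p ^ k) ` hpairs N = higher_prime_powers_upto (real N)"
    by (auto simp: hpairs_def higher_prime_powers_upto_def)
  ultimately show ?thesis by (simp add: sum.reindex[symmetric] case_prod_beta o_def sum.reindex_cong)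
qed

text \<open>A proper prime power is at least 4 > e, so its logarithm is at least 1 and the bounded
  sum of (ln q)^2 / q dominates.\<close>

lemma sum_hpairs_recip_le: "\<exists>C>0. \<forall>N. (\<Sum>(p,k)\<in>hpairs N. 1 / real (p ^ k)) \<le> C"
proof -
  obtain C where C: "C > 0" "\<And>X. (\<Sum>q\<in>higher_prime_powers_upto X. (ln (real q))\<^sup>2 / real q) \<le> C"
    using sum_higher_prime_powers_le by blast
  have "(\<Sum>(p,k)\<in>hpairs N. 1 / real (p ^ k)) \<le> C" for N
  proof -
    have "(\<Sum>(p,k)\<in>hpairs N. 1 / real (p ^ k)) = (\<Sum>q\<in>higher_prime_powers_upto (real N). 1 / real q)"
      by (rule sum_hpairs[of "\<lambda>q. 1 / real q"])
    also have "\<dots> \<le> (\<Sum>q\<in>higher_prime_powers_upto (real N). (ln (real q))\<^sup>2 / real q)"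
    proof (intro sum_mono divide_right_mono)
      fix q assume "q \<in> higher_prime_powers_upto (real N)"
      then obtain p k where pk: "prime p" "k \<ge> 2" "q = p ^ k" by (auto simp: higher_prime_powers_upto_def)
      have "2 ^ 2 \<le> p ^ 2" using prime_ge_2_nat[OF pk(1)] by (intro power_mono) auto
      also have "\<dots> \<le> p ^ k" using pk prime_gt_0_nat[of p] by (intro power_increasing) auto
      finally have "real q \<ge> 4" unfolding pk(3) by (metis of_nat_le_iff of_nat_numeral four_x_squared mult_2 numeral_Bit0 power2_eq_square)
      hence "ln 4 \<le> ln (real q)" by simp
      moreover have "exp 1 \<le> (4::real)" using exp_le by linarith
      hence "1 \<le> ln (4::real)" by (simp add: ln_ge_iff)
      ultimately have "1 \<le> ln (real q)" by linarith
      thus "1 \<le> (ln (real q))\<^sup>2" by (simp add: one_le_power)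
    qed auto
    also have "\<dots> \<le> C" by (rule C)
    finally show ?thesis .
  qed
  thus ?thesis using C by blast
qed

text \<open>The difference is a sum of g (p^k) - g p over the p^k with k \<ge> 2 that divide n
  exactly. Exactness makes different exponents of one prime incompatible, different primes are
  independent up to rounding, and the total density is bounded, so the uncentred second moment
  applies.\<close>

lemma sum_square_higher_le:
  "\<exists>C>0. \<forall>g N. additive_function g \<longrightarrow> (\<Sum>n=1..N. (g n - sadd g n)\<^sup>2) \<le>
     C * real N * ((\<Sum>q\<in>higher_prime_powers_upto (real N). (g q)\<^sup>2 / real q) + (\<Sum>p\<in>primes_le N. (g p)\<^sup>2 / (real p)\<^sup>2))"
proof -
  obtain C where C: "C > 0" "\<And>N. (\<Sum>(p,k)\<in>hpairs N. 1 / real (p ^ k)) \<le> C"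
    using sum_hpairs_recip_le by blast
  have "(\<Sum>n=1..N. (g n - sadd g n)\<^sup>2) \<le>
     (4 * (1 + C)) * real N * ((\<Sum>q\<in>higher_prime_powers_upto (real N). (g q)\<^sup>2 / real q) + (\<Sum>p\<in>primes_le N. (g p)\<^sup>2 / (real p)\<^sup>2))"
    if g: "additive_function g" for g N
  proof -
    define D where "D = (\<lambda>(p,k). {n::nat. n > 0 \<and> multiplicity p n = k})"
    define u where "u = (\<lambda>(p,k). g (p ^ k) - g p)"
    define \<rho> where "\<rho> = (\<lambda>(p,k). 1 / real (p ^ k :: nat))"
    have rep: "g n - sadd g n = (\<Sum>i\<in>hpairs N. if n \<in> D i then u i else 0)" if n: "n \<in> {1..N}" for n
    proof -
      define H where "H = (\<lambda>p. (p, multiplicity p n)) ` {p\<in>prime_factors n. multiplicity p n \<ge> 2}"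
      have "g n - sadd g n = (\<Sum>p\<in>prime_factors n. g (p ^ multiplicity p n) - g p)"
        using additive_function_factorize[OF g, of n] n by (simp add: sadd_def sum_subtractf)
      also have "\<dots> = (\<Sum>p\<in>{p\<in>prime_factors n. multiplicity p n \<ge> 2}. g (p ^ multiplicity p n) - g p)"
      proof (rule sum.mono_neutral_right)
        show "\<forall>p\<in>prime_factors n - {p\<in>prime_factors n. multiplicity p n \<ge> 2}. g (p ^ multiplicity p n) - g p = 0"
        proof
          fix p assume p: "p \<in> prime_factors n - {p\<in>prime_factors n. multiplicity p n \<ge> 2}"
          hence "multiplicity p n > 0" by (auto simp: prime_factors_multiplicity)
          hence "multiplicity p n = 1" using p by auto
          thus "g (p ^ multiplicity p n) - g p = 0" by simp
        qed
      qed auto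
      also have "\<dots> = (\<Sum>i\<in>H. u i)"
        unfolding H_def by (subst sum.reindex) (auto simp: inj_on_def u_def)
      also have "H = {i\<in>hpairs N. n \<in> D i}"
      proof (intro equalityI subsetI)
        fix i assume "i \<in> H"
        then obtain p where p: "p \<in> prime_factors n" "multiplicity p n \<ge> 2" "i = (p, multiplicity p n)"
          by (auto simp: H_def)
        have "p ^ multiplicity p n dvd n" by (rule multiplicity_dvd)
        hence "p ^ multiplicity p n \<le> N" using n dvd_imp_le[of _ n] by fastforce
        thus "i \<in> {i\<in>hpairs N. n \<in> D i}" using p n by (auto simp: hpairs_def D_def)
      next
        fix i assume i: "i \<in> {i\<in>hpairs N. n \<in> D i}"
        then obtain p where p: "prime p" "multiplicity p n \<ge> 2" "i = (p, multiplicity p n)"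
          by (auto simp: hpairs_def D_def)
        hence "p \<in> prime_factors n" by (auto simp: prime_factors_multiplicity)
        thus "i \<in> H" using p by (auto simp: H_def)
      qed
      also have "(\<Sum>i\<in>{i\<in>hpairs N. n \<in> D i}. u i) = (\<Sum>i\<in>hpairs N. if n \<in> D i then u i else 0)"
        by (rule sum.inter_filter) auto
      finally show ?thesis .
    qed
    have card1: "real (card {n\<in>{1..N}. n \<in> D i}) \<le> real N * \<rho> i" if i: "i \<in> hpairs N" for i
    proof -
      obtain p k where pk: "i = (p,k)" "prime p" using i by (auto simp: hpairs_def)
      have "card {n\<in>{1..N}. n \<in> D i} \<le> card {n\<in>{1..N}. p ^ k dvd n}"
        by (intro card_mono) (auto simp: D_def pk(1) multiplicity_dvd)
      also have "real \<dots> \<le> real N / real (p ^ k)" using pk by (intro card_multiples_le) (auto simp: prime_gt_0_nat)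
      finally show ?thesis by (simp add: \<rho>_def pk)
    qed
    have card2: "real (card {n\<in>{1..N}. n \<in> D i \<and> n \<in> D j}) \<le> real N * (\<rho> i * \<rho> j)"
      if ij: "i \<in> hpairs N" "j \<in> hpairs N" "i \<noteq> j" for i j
    proof -
      obtain p k q l where pk: "i = (p,k)" "prime p" "j = (q,l)" "prime q" using ij by (auto simp: hpairs_def)
      show ?thesis
      proof (cases "p = q")
        case True
        hence "{n\<in>{1..N}. n \<in> D i \<and> n \<in> D j} = {}" using ij pk by (auto simp: D_def)
        hence "card {n\<in>{1..N}. n \<in> D i \<and> n \<in> D j} = 0" by (simp only: card.empty)
        thus ?thesis unfolding \<rho>_def pk(1,3) case_prod_conv by (simp only: of_nat_0) simp
      next
        case False
        hence cop: "coprime (p ^ k) (q ^ l)" using pk primes_coprime[of p q] by simp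
        have "card {n\<in>{1..N}. n \<in> D i \<and> n \<in> D j} \<le> card {n\<in>{1..N}. p ^ k * q ^ l dvd n}"
        proof (rule card_mono, simp, intro subsetI)
          fix n assume n: "n \<in> {n\<in>{1..N}. n \<in> D i \<and> n \<in> D j}"
          hence "p ^ k dvd n" "q ^ l dvd n" by (auto simp: D_def pk(1,3) multiplicity_dvd)
          hence "p ^ k * q ^ l dvd n" using cop by (rule divides_mult)
          thus "n \<in> {n\<in>{1..N}. p ^ k * q ^ l dvd n}" using n by simp
        qed
        also have "real \<dots> \<le> real N / real (p ^ k * q ^ l)"
          using pk by (intro card_multiples_le) (auto simp: prime_gt_0_nat)
        finally show ?thesis by (simp add: \<rho>_def pk)
      qed
    qed
    have "(\<Sum>n=1..N. (g n - sadd g n)\<^sup>2) = (\<Sum>n=1..N. (\<Sum>i\<in>hpairs N. if n \<in> D i then u i else 0)\<^sup>2)"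
      by (intro sum.cong refl) (simp add: rep)
    also have "\<dots> \<le> real N * (1 + (\<Sum>i\<in>hpairs N. \<rho> i)) * (\<Sum>i\<in>hpairs N. (u i)\<^sup>2 * \<rho> i)"
      by (rule sum_square_indicator_le) (use card1 card2 in \<open>auto simp: \<rho>_def\<close>)
    also have "\<dots> \<le> real N * (1 + C) * (\<Sum>i\<in>hpairs N. (u i)\<^sup>2 * \<rho> i)"
      using C(2)[of N] by (intro mult_right_mono mult_left_mono add_left_mono sum_nonneg) (auto simp: \<rho>_def case_prod_beta)
    also have "(\<Sum>i\<in>hpairs N. (u i)\<^sup>2 * \<rho> i) \<le> (\<Sum>i\<in>hpairs N. 2 * (case i of (p,k) \<Rightarrow> (g (p^k))\<^sup>2 / real (p^k)) + 2 * (case i of (p,k) \<Rightarrow> (g p)\<^sup>2 / real (p^k)))"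
    proof (intro sum_mono, clarify)
      fix p k assume "(p,k) \<in> hpairs N"
      have "(g (p^k) - g p)\<^sup>2 \<le> 2 * (g (p^k))\<^sup>2 + 2 * (g p)\<^sup>2"
        by (rule square_minus_le)
      hence "(g (p^k) - g p)\<^sup>2 * (1 / real (p^k)) \<le> (2 * (g (p^k))\<^sup>2 + 2 * (g p)\<^sup>2) * (1 / real (p^k))"
        by (intro mult_right_mono) auto
      thus "(u (p,k))\<^sup>2 * \<rho> (p,k) \<le> 2 * ((g (p^k))\<^sup>2 / real (p^k)) + 2 * ((g p)\<^sup>2 / real (p^k))"
        by (simp add: u_def \<rho>_def field_simps add_divide_distrib)
    qed
    also have "\<dots> = 2 * (\<Sum>(p,k)\<in>hpairs N. (g (p^k))\<^sup>2 / real (p^k)) + 2 * (\<Sum>(p,k)\<in>hpairs N. (g p)\<^sup>2 / real (p^k))"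
      by (simp add: sum.distrib sum_distrib_left)
    also have "(\<Sum>(p,k)\<in>hpairs N. (g (p^k))\<^sup>2 / real (p^k)) = (\<Sum>q\<in>higher_prime_powers_upto (real N). (g q)\<^sup>2 / real q)"
      by (rule sum_hpairs[of "\<lambda>q. (g q)\<^sup>2 / real q"])
    also have "(\<Sum>(p,k)\<in>hpairs N. (g p)\<^sup>2 / real (p^k)) \<le> (\<Sum>(p,k)\<in>primes_le N \<times> {2..N}. (g p)\<^sup>2 / real (p^k))"
      by (intro sum_mono2 hpairs_subset) auto
    also have "\<dots> = (\<Sum>p\<in>primes_le N. \<Sum>k=2..N. (g p)\<^sup>2 / real (p^k))"
      by (simp add: sum.cartesian_product)
    also have "\<dots> \<le> (\<Sum>p\<in>primes_le N. 2 * ((g p)\<^sup>2 / (real p)\<^sup>2))"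
    proof (rule sum_mono)
      fix p assume "p \<in> primes_le N"
      hence p: "real p \<ge> 2" using prime_ge_2_nat by (metis (mono_tags) mem_Collect_eq of_nat_le_iff of_nat_numeral)
      \<comment> \<open>The subtracted tail is what lets the induction close; its step needs no more
        than p \<ge> 2.\<close>
      have st: "(\<Sum>k=2..n. 1 / real p ^ k) \<le> 2 / (real p)\<^sup>2 - 2 / real p ^ (n+1)" if "n \<ge> 1" for n
        using that
      proof (induction n rule: dec_induct)
        case (step n)
        have "2 * (1 / real p ^ (Suc n + 1)) \<le> real p * (1 / real p ^ (Suc n + 1))"
          using p by (intro mult_right_mono) auto
        hence "2 / real p ^ (Suc n + 1) \<le> 1 / real p ^ (n + 1)" using p by simp
        moreover have "(\<Sum>k=2..Suc n. 1 / real p ^ k) = (\<Sum>k=2..n. 1 / real p ^ k) + 1 / real p ^ (n+1)"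
          using step by simp
        moreover have "2 / real p ^ (n + 1) = 2 * (1 / real p ^ (n + 1))" by simp
        ultimately show ?case using step.IH by linarith
      qed (simp add: power2_eq_square)
      have "(\<Sum>k=2..N. 1 / real p ^ k) \<le> 2 / (real p)\<^sup>2"
      proof (cases "N \<ge> 1")
        case True
        have "2 / real p ^ (N+1) \<ge> 0" by simp
        thus ?thesis using st[OF True] by linarith
      qed auto
      hence "(g p)\<^sup>2 * (\<Sum>k=2..N. 1 / real p ^ k) \<le> (g p)\<^sup>2 * (2 / (real p)\<^sup>2)" by (intro mult_left_mono) auto
      thus "(\<Sum>k=2..N. (g p)\<^sup>2 / real (p^k)) \<le> 2 * ((g p)\<^sup>2 / (real p)\<^sup>2)"
        by (simp add: sum_distrib_left mult.commute)
    qed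
    also have "\<dots> = 2 * (\<Sum>p\<in>primes_le N. (g p)\<^sup>2 / (real p)\<^sup>2)" by (simp add: sum_distrib_left)
    finally have "(\<Sum>n=1..N. (g n - sadd g n)\<^sup>2) \<le> real N * (1 + C) * (2 * (\<Sum>q\<in>higher_prime_powers_upto (real N). (g q)\<^sup>2 / real q) +
        2 * (2 * (\<Sum>p\<in>primes_le N. (g p)\<^sup>2 / (real p)\<^sup>2)))" using C(1) by (simp add: mult_left_mono)
    also have "\<dots> \<le> real N * (1 + C) * (4 * (\<Sum>q\<in>higher_prime_powers_upto (real N). (g q)\<^sup>2 / real q) +
        4 * (\<Sum>p\<in>primes_le N. (g p)\<^sup>2 / (real p)\<^sup>2))"
      using C(1) by (intro mult_left_mono add_mono mult_right_mono sum_nonneg) (auto intro!: sum_nonneg)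
    finally show ?thesis by (simp add: algebra_simps)
  qed
  thus ?thesis using C(1) by (intro exI[of _ "4 * (1 + C)"]) auto
qed

section \<open>Consecutive differences in mean square\<close>

lemma finite_decrease_set_upto [simp]: "finite (decrease_set_upto g X)"
  by (rule finite_subset[of _ "{..nat \<lfloor>X\<rfloor>}"]) (auto simp: decrease_set_upto_def le_nat_floor)

lemma B_add_nonneg: "B_add g X \<ge> 0"
  by (simp add: B_add_def sum_nonneg)

lemma B_add_sq: "(B_add g X)\<^sup>2 = (\<Sum>q\<in>prime_powers_upto X. (g q)\<^sup>2 / real q)"
  unfolding B_add_def by (simp add: sum_nonneg)

lemma B_add_mono: "X \<le> Y \<Longrightarrow> B_add g X \<le> B_add g Y"
  unfolding B_add_def
  by (intro real_sqrt_le_mono sum_mono2 finite_prime_powers_upto) (auto simp: prime_powers_upto_def)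

lemma primes_le_subset_prime_powers: "primes_le N \<subseteq> prime_powers_upto (real N)"
  by (auto simp: prime_powers_upto_def)

lemma sum_primes_le_B_add: "(\<Sum>p\<in>primes_le N. (g p)\<^sup>2 / real p) \<le> (B_add g (real N))\<^sup>2"
  unfolding B_add_sq by (intro sum_mono2 primes_le_subset_prime_powers) auto

lemma eventually_nat_floor:
  assumes "\<forall>\<^sub>F N in sequentially. P N"
  shows "\<forall>\<^sub>F X::real in at_top. P (nat \<lfloor>X\<rfloor>)"
proof -
  have "filterlim (\<lambda>X::real. nat \<lfloor>X\<rfloor>) sequentially at_top"
    by (rule filterlim_compose[OF filterlim_nat_sequentially filterlim_floor_sequentially])
  thus ?thesis using assms by (auto simp: filterlim_iff)
qed

text \<open>Truncated subtraction sends every n \<le> i to 0, where h vanishes, so that the shifted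
  sum runs over a subset of the original one.\<close>

lemma sum_shift_le:
  fixes h :: "nat \<Rightarrow> real"
  assumes "\<And>n. h n \<ge> 0" "h 0 = 0"
  shows "(\<Sum>n=1..N. h (n - i)) \<le> (\<Sum>n=1..N. h n)"
proof -
  have "(\<Sum>n=1..N. h (n - i)) = (\<Sum>n=i+1..N. h (n - i))"
    by (intro sum.mono_neutral_right) (auto simp: assms(2) not_le)
  also have "\<dots> = (\<Sum>n\<in>(\<lambda>n. n - i) ` {i+1..N}. h n)"
    by (subst sum.reindex) (auto simp: inj_on_def)
  also have "\<dots> \<le> (\<Sum>n=1..N. h n)"
    by (intro sum_mono2) (auto simp: assms)
  finally show ?thesis .
qed

lemma sum_shift_add_le:
  fixes h :: "nat \<Rightarrow> real"
  assumes "\<And>n. h n \<ge> 0"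
  shows "(\<Sum>n=1..N. h n + (if n = 1 then 0 else h (n - 1))) \<le> 2 * (\<Sum>n=1..N. h n)"
proof -
  define h' where "h' = (\<lambda>n. if n = 0 then 0 else h n)"
  have "(\<Sum>n=1..N. h n + (if n = 1 then 0 else h (n - 1))) = (\<Sum>n=1..N. h' n) + (\<Sum>n=1..N. h' (n - 1))"
    unfolding sum.distrib[symmetric] by (intro sum.cong) (auto simp: h'_def)
  also have "(\<Sum>n=1..N. h' (n - 1)) \<le> (\<Sum>n=1..N. h' n)"
    by (rule sum_shift_le) (auto simp: h'_def assms)
  also have "(\<Sum>n=1..N. h' n) = (\<Sum>n=1..N. h n)" by (intro sum.cong) (auto simp: h'_def)
  finally show ?thesis by simp
qed

lemma fourth_diff_le: "(x - y) ^ 4 \<le> 8 * x ^ 4 + 8 * y ^ 4" for x y :: real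
proof -
  have "((x - y)\<^sup>2)\<^sup>2 \<le> (2 * x\<^sup>2 + 2 * y\<^sup>2)\<^sup>2" by (intro power_mono square_minus_le) auto
  also have "\<dots> \<le> 8 * (x\<^sup>2)\<^sup>2 + 8 * (y\<^sup>2)\<^sup>2"
    using square_plus_le[of "2 * x\<^sup>2" "2 * y\<^sup>2"] by (simp add: power_mult_distrib)
  finally show ?thesis by simp
qed

text \<open>The hypothesis removes the term n = 1, the only one that would involve the uncontrolled
  deviation of \<open>v 0\<close> from c. It holds for g with \<open>g 0 = 0\<close> because an
  additive function vanishes at 1.\<close>

lemma sum_square_consecutive_le:
  fixes v :: "nat \<Rightarrow> real"
  assumes "v 0 = v (Suc 0)"
  shows "(\<Sum>n=1..N. (v n - v (n - 1))\<^sup>2) \<le> 4 * (\<Sum>n=1..N. (v n - c)\<^sup>2)"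
proof -
  have "(\<Sum>n=1..N. (v n - v (n - 1))\<^sup>2) \<le>
      (\<Sum>n=1..N. 2 * ((v n - c)\<^sup>2 + (if n = 1 then 0 else (v (n - 1) - c)\<^sup>2)))"
  proof (rule sum_mono)
    fix n assume "n \<in> {1..N}"
    show "(v n - v (n - 1))\<^sup>2 \<le> 2 * ((v n - c)\<^sup>2 + (if n = 1 then 0 else (v (n - 1) - c)\<^sup>2))"
      using square_diff_le[of "v n" "v (n - 1)" c] assms by auto
  qed
  also have "\<dots> = 2 * (\<Sum>n=1..N. (v n - c)\<^sup>2 + (if n = 1 then 0 else (v (n - 1) - c)\<^sup>2))"
    by (rule sum_distrib_left[symmetric])
  also have "\<dots> \<le> 2 * (2 * (\<Sum>n=1..N. (v n - c)\<^sup>2))"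
    by (intro mult_left_mono sum_shift_add_le[of "\<lambda>n. (v n - c)\<^sup>2"]) auto
  finally show ?thesis by simp
qed

section \<open>Moments and increments of g under the hypotheses\<close>

text \<open>The hypotheses of the theorem in epsilon form: eventual inequalities replace the limits
  superior and the little-o. K stands for the inverse of the parameter of \<open>F_add\<close>; one
  admissible value for each \<epsilon> is enough.\<close>

locale almost_increasing =
  fixes g :: "nat \<Rightarrow> real"
  assumes additive: "additive_function g"
    and g_0: "g 0 = 0"
    and B_at_top: "filterlim (B_add g) at_top at_top"
    and higher_small: "\<And>\<epsilon>. \<epsilon> > 0 \<Longrightarrow> \<forall>\<^sub>F X::real in at_top.
          (\<Sum>q\<in>higher_prime_powers_upto X. (g q)\<^sup>2 / real q) \<le> \<epsilon> * (B_add g X)\<^sup>2"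
    and large_small: "\<And>\<epsilon>. \<epsilon> > 0 \<Longrightarrow> \<exists>K\<ge>1. \<forall>\<^sub>F X::real in at_top.
          (\<Sum>p | prime p \<and> real p \<le> X \<and> \<bar>g p\<bar> > K * B_add g X. (g p)\<^sup>2 / real p) \<le> \<epsilon> * (B_add g X)\<^sup>2"
    and decrease_small: "\<And>\<epsilon>. \<epsilon> > 0 \<Longrightarrow> \<forall>\<^sub>F X::real in at_top.
          real (card (decrease_set_upto g X)) \<le> \<epsilon> * X"

lemma almost_increasingI:
  assumes "additive_function g" "g 0 = 0" "g \<in> class_A_s"
    and o: "(\<lambda>X::real. real (card (decrease_set_upto g X))) \<in> o[at_top](\<lambda>X. X)"
  shows "almost_increasing g"
proof
  have A: "g \<in> class_A" and F: "(F_add g \<longlongrightarrow> 0) (at_right 0)" using assms(3) by (auto simp: class_A_s_def)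
  show B: "filterlim (B_add g) at_top at_top" using A by (simp add: class_A_def)
  have Bpos: "\<forall>\<^sub>F X in at_top. B_add g X > 0"
    using B by (simp add: filterlim_at_top_dense)
  show "\<forall>\<^sub>F X::real in at_top. (\<Sum>q\<in>higher_prime_powers_upto X. (g q)\<^sup>2 / real q) \<le> \<epsilon> * (B_add g X)\<^sup>2"
    if "\<epsilon> > 0" for \<epsilon>
  proof -
    have "Limsup at_top (\<lambda>X::real. ereal (1 / (B_add g X)\<^sup>2 * (\<Sum>q\<in>higher_prime_powers_upto X. \<bar>g q\<bar>\<^sup>2 / real q))) < ereal \<epsilon>"
      using A that by (simp add: class_A_def)
    from Limsup_lessD[OF this] Bpos show ?thesis
    proof eventually_elim
      case (elim X)
      thus ?case by (simp add: field_simps)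
    qed
  qed
  show "\<exists>K\<ge>1. \<forall>\<^sub>F X::real in at_top.
          (\<Sum>p | prime p \<and> real p \<le> X \<and> \<bar>g p\<bar> > K * B_add g X. (g p)\<^sup>2 / real p) \<le> \<epsilon> * (B_add g X)\<^sup>2"
    if "\<epsilon> > 0" for \<epsilon>
  proof -
    have "\<forall>\<^sub>F e in at_right 0. F_add g e < ereal \<epsilon>"
      using order_tendstoD(2)[OF F, of "ereal \<epsilon>"] that by simp
    moreover have "\<forall>\<^sub>F e::real in at_right 0. e \<in> {0<..<1}"
      by (rule eventually_at_right_real) simp
    ultimately have "\<forall>\<^sub>F e in at_right 0. F_add g e < ereal \<epsilon> \<and> e \<in> {0<..<1}"
      by (rule eventually_conj)
    then obtain e where e: "F_add g e < ereal \<epsilon>" "0 < e" "e < 1"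
      using eventually_happens'[of "at_right (0::real)"] by fastforce
    from Limsup_lessD[OF e(1)[unfolded F_add_def]] Bpos
    have "\<forall>\<^sub>F X::real in at_top.
          (\<Sum>p | prime p \<and> real p \<le> X \<and> \<bar>g p\<bar> > inverse e * B_add g X. (g p)\<^sup>2 / real p) \<le> \<epsilon> * (B_add g X)\<^sup>2"
    proof eventually_elim
      case (elim X)
      thus ?case by (simp add: field_simps)
    qed
    moreover have "inverse e \<ge> 1" using e by (simp add: field_simps)
    ultimately show ?thesis by blast
  qed
  show "\<forall>\<^sub>F X::real in at_top. real (card (decrease_set_upto g X)) \<le> \<epsilon> * X" if "\<epsilon> > 0" for \<epsilon>
    using landau_o.smallD[OF o that] eventually_ge_at_top[of 0]
    by eventually_elim auto
qed (use assms in auto)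

context almost_increasing
begin

abbreviation \<beta> :: "nat \<Rightarrow> real" where "\<beta> N \<equiv> B_add g (real N)"

lemma eventually_real:
  assumes "\<forall>\<^sub>F X::real in at_top. P X"
  shows "\<forall>\<^sub>F N in sequentially. P (real N)"
  using assms filterlim_real_sequentially by (auto simp: filterlim_iff)

lemma beta_ge: "\<forall>\<^sub>F N in sequentially. \<beta> N \<ge> c"
  using eventually_real[of "\<lambda>X. B_add g X \<ge> c"] B_at_top by (simp add: filterlim_at_top)

lemma sum_beta_le: "(\<Sum>p\<in>primes_le N. (g p)\<^sup>2 / real p) \<le> (\<beta> N)\<^sup>2"
  by (rule sum_primes_le_B_add)

text \<open>Primes above a fixed T gain a factor 1 / T over the energy of g, and the finitely many
  primes below T contribute a constant, which is beaten because \<beta> tends to infinity.\<close>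

lemma small_prime_square_sum:
  assumes "\<epsilon> > 0"
  shows "\<forall>\<^sub>F N in sequentially. (\<Sum>p\<in>primes_le N. (g p)\<^sup>2 / (real p)\<^sup>2) \<le> \<epsilon> * (\<beta> N)\<^sup>2"
proof -
  define T where "T = nat \<lceil>2 / \<epsilon>\<rceil>"
  have T: "real T \<ge> 2 / \<epsilon>" unfolding T_def using assms by simp
  have T0: "real T > 0" using T assms by (intro less_le_trans[OF _ T]) auto
  define c where "c = (\<Sum>p\<in>primes_le T. (g p)\<^sup>2 / (real p)\<^sup>2)"
  define c' where "c' = 2 * c / \<epsilon> + 1"
  have c: "c \<ge> 0" by (auto simp: c_def sum_nonneg)
  show ?thesis
    using beta_ge[of c'] eventually_ge_at_top[of T]
  proof eventually_elim
    case (elim N)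
    have "(\<Sum>p\<in>primes_le N. (g p)\<^sup>2 / (real p)\<^sup>2) \<le> (\<Sum>p\<in>primes_le N. (if p \<in> primes_le T then (g p)\<^sup>2 / (real p)\<^sup>2 else 0) + (g p)\<^sup>2 / real p / real T)"
    proof (rule sum_mono)
      fix p assume p: "p \<in> primes_le N"
      hence p0: "p > 0" by (auto simp: prime_gt_0_nat)
      show "(g p)\<^sup>2 / (real p)\<^sup>2 \<le> (if p \<in> primes_le T then (g p)\<^sup>2 / (real p)\<^sup>2 else 0) + (g p)\<^sup>2 / real p / real T"
      proof (cases "p \<in> primes_le T")
        case False
        hence "real p \<ge> real T" using p by auto
        hence "(g p)\<^sup>2 / real p / real p \<le> (g p)\<^sup>2 / real p / real T"
          using T0 p0 by (intro divide_left_mono) auto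
        thus ?thesis using False by (simp add: power2_eq_square)
      qed auto
    qed
    also have "\<dots> = (\<Sum>p\<in>primes_le N. if p \<in> primes_le T then (g p)\<^sup>2 / (real p)\<^sup>2 else 0) + (\<Sum>p\<in>primes_le N. (g p)\<^sup>2 / real p) / real T"
      by (simp add: sum.distrib sum_divide_distrib)
    also have "(\<Sum>p\<in>primes_le N. if p \<in> primes_le T then (g p)\<^sup>2 / (real p)\<^sup>2 else 0) = c"
      unfolding c_def using elim by (intro sum.mono_neutral_cong_right) auto
    also have "(\<Sum>p\<in>primes_le N. (g p)\<^sup>2 / real p) / real T \<le> (\<beta> N)\<^sup>2 / real T"
      using T0 by (intro divide_right_mono sum_beta_le) auto
    also have "\<dots> \<le> (\<beta> N)\<^sup>2 * (\<epsilon> / 2)"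
    proof -
      have "1 / real T \<le> \<epsilon> / 2" using T T0 assms by (simp add: field_simps)
      hence "(\<beta> N)\<^sup>2 * (1 / real T) \<le> (\<beta> N)\<^sup>2 * (\<epsilon> / 2)" by (intro mult_left_mono) auto
      thus ?thesis by simp
    qed
    also have "c \<le> \<epsilon> / 2 * (\<beta> N)\<^sup>2"
    proof -
      have "1 \<le> c'" using c assms by (simp add: c'_def)
      hence "1 * c' \<le> \<beta> N * \<beta> N" using elim by (intro mult_mono) auto
      hence "\<epsilon> / 2 * c' \<le> \<epsilon> / 2 * (\<beta> N)\<^sup>2" using assms by (intro mult_left_mono) (auto simp: power2_eq_square)
      moreover have "\<epsilon> / 2 * c' = c + \<epsilon> / 2" using assms by (simp add: c'_def field_simps)
      ultimately show ?thesis using assms by linarith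
    qed
    finally show ?case by (simp add: field_simps)
  qed
qed

lemma sum_square_diff_sadd:
  assumes "\<epsilon> > 0"
  shows "\<forall>\<^sub>F N in sequentially. (\<Sum>n=1..N. (g n - sadd g n)\<^sup>2) \<le> \<epsilon> * real N * (\<beta> N)\<^sup>2"
proof -
  obtain C where C: "C > 0" "\<And>N. (\<Sum>n=1..N. (g n - sadd g n)\<^sup>2) \<le>
     C * real N * ((\<Sum>q\<in>higher_prime_powers_upto (real N). (g q)\<^sup>2 / real q) + (\<Sum>p\<in>primes_le N. (g p)\<^sup>2 / (real p)\<^sup>2))"
    using sum_square_higher_le additive by blast
  define e where "e = \<epsilon> / (2 * C)"
  have e: "e > 0" using C assms by (simp add: e_def)
  show ?thesis
    using small_prime_square_sum[OF e] eventually_real[OF higher_small[OF e]]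
  proof eventually_elim
    case (elim N)
    note C(2)[of N]
    also have "C * real N * ((\<Sum>q\<in>higher_prime_powers_upto (real N). (g q)\<^sup>2 / real q) + (\<Sum>p\<in>primes_le N. (g p)\<^sup>2 / (real p)\<^sup>2))
      \<le> C * real N * (e * (\<beta> N)\<^sup>2 + e * (\<beta> N)\<^sup>2)"
      using elim C(1) by (intro mult_left_mono add_mono) auto
    also have "\<dots> = \<epsilon> * real N * (\<beta> N)\<^sup>2" using C(1) by (simp add: e_def)
    finally show ?case .
  qed
qed

text \<open>Truncation of g at K \<beta>. The bounded part has a fourth moment. A prime in the other
  part contributes at least \<beta>^2 / p to an energy of at most \<beta>^2, so these primes have
  reciprocal sum at most 1, and the uncentred second moment bounds their part by their small energy
  V.\<close>

lemma decomposition: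
  assumes "\<epsilon> > 0"
  shows "\<exists>C>0. \<forall>\<^sub>F N in sequentially. \<exists>f1. (\<Sum>n=1..N. (f1 n) ^ 4) \<le> C * real N * (\<beta> N) ^ 4 \<and>
      (\<Sum>n=1..N. (sadd g n - pmean g N - f1 n)\<^sup>2) \<le> \<epsilon> * real N * (\<beta> N)\<^sup>2"
proof -
  \<comment> \<open>The 6 is 4 + 2: twice the uncentred moment 2 N V of the large part, plus twice
    its squared mean, which is at most V for each n.\<close>
  obtain K where K: "K \<ge> 1" "\<forall>\<^sub>F X::real in at_top.
     (\<Sum>p | prime p \<and> real p \<le> X \<and> \<bar>g p\<bar> > K * B_add g X. (g p)\<^sup>2 / real p) \<le> (\<epsilon> / 6) * (B_add g X)\<^sup>2"
    using large_small[of "\<epsilon> / 6"] assms by auto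
  obtain C where C: "C > 0" "\<And>N a \<beta>. N \<ge> 2 \<Longrightarrow> \<beta> > 0 \<Longrightarrow> (\<forall>p\<in>primes_le N. \<bar>a p\<bar> \<le> K * \<beta>) \<Longrightarrow>
     (\<Sum>p\<in>primes_le N. (a p)\<^sup>2 / real p) \<le> \<beta>\<^sup>2 \<Longrightarrow>
     (\<Sum>n=1..N. (sadd a n - pmean a N) ^ 4) \<le> C * real N * \<beta> ^ 4"
    using fourth_moment[of K] K(1) by fastforce
  have "\<forall>\<^sub>F N in sequentially. \<exists>f1. (\<Sum>n=1..N. (f1 n) ^ 4) \<le> C * real N * (\<beta> N) ^ 4 \<and>
      (\<Sum>n=1..N. (sadd g n - pmean g N - f1 n)\<^sup>2) \<le> \<epsilon> * real N * (\<beta> N)\<^sup>2"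
    using eventually_real[OF K(2)] beta_ge[of 1] eventually_ge_at_top[of 2]
  proof eventually_elim
    case (elim N)
    define S where "S = {p. \<bar>g p\<bar> > K * \<beta> N}"
    define a where "a = (\<lambda>p. if p \<in> S then 0 else g p)"
    define b where "b = (\<lambda>p. if p \<in> S then g p else 0)"
    define I where "I = {p\<in>primes_le N. p \<in> S}"
    define V where "V = (\<Sum>p\<in>I. (g p)\<^sup>2 / real p)"
    define R where "R = (\<Sum>p\<in>I. 1 / real p)"
    have b1: "\<beta> N \<ge> 1" using elim by simp
    have fin: "finite I" "I \<subseteq> primes_le N" by (auto simp: I_def)
    have "I = {p. prime p \<and> real p \<le> real N \<and> \<bar>g p\<bar> > K * \<beta> N}" by (auto simp: I_def S_def)
    hence V: "V \<le> \<epsilon> / 6 * (\<beta> N)\<^sup>2" using elim by (simp add: V_def)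
    have V0: "V \<ge> 0" "R \<ge> 0" by (auto simp: V_def R_def sum_nonneg)
    have Vb: "(\<Sum>p\<in>primes_le N. (b p)\<^sup>2 / real p) = V"
      unfolding V_def I_def by (intro sum.mono_neutral_cong_right) (auto simp: b_def)
    have R1: "R \<le> 1"
    proof -
      have "(\<beta> N)\<^sup>2 * R = (\<Sum>p\<in>I. (\<beta> N)\<^sup>2 / real p)" by (simp add: R_def sum_distrib_left)
      also have "\<dots> \<le> (\<Sum>p\<in>I. (g p)\<^sup>2 / real p)"
      proof (intro sum_mono divide_right_mono)
        fix p assume "p \<in> I"
        hence "K * \<beta> N \<le> \<bar>g p\<bar>" by (auto simp: I_def S_def)
        moreover have "1 * \<beta> N \<le> K * \<beta> N" using K(1) b1 by (intro mult_right_mono) auto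
        ultimately have "\<bar>\<beta> N\<bar> \<le> \<bar>g p\<bar>" using b1 by linarith
        thus "(\<beta> N)\<^sup>2 \<le> (g p)\<^sup>2" by (simp add: abs_le_square_iff)
      qed auto
      also have "\<dots> \<le> (\<Sum>p\<in>primes_le N. (g p)\<^sup>2 / real p)" by (intro sum_mono2 fin) auto
      also have "\<dots> \<le> (\<beta> N)\<^sup>2" by (rule sum_beta_le)
      finally show ?thesis using b1 by (simp add: mult_le_cancel_left1)
    qed
    define f1 where "f1 = (\<lambda>n. sadd a n - pmean a N)"
    have "(\<Sum>n=1..N. (f1 n) ^ 4) \<le> C * real N * (\<beta> N) ^ 4" unfolding f1_def
    proof (rule C(2))
      show "\<forall>p\<in>primes_le N. \<bar>a p\<bar> \<le> K * \<beta> N" using K(1) b1 by (auto simp: a_def S_def)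
      have "(\<Sum>p\<in>primes_le N. (a p)\<^sup>2 / real p) \<le> (\<Sum>p\<in>primes_le N. (g p)\<^sup>2 / real p)"
        by (intro sum_mono divide_right_mono) (auto simp: a_def)
      thus "(\<Sum>p\<in>primes_le N. (a p)\<^sup>2 / real p) \<le> (\<beta> N)\<^sup>2" using sum_beta_le[of N] by linarith
    qed (use elim b1 in auto)
    moreover have "(\<Sum>n=1..N. (sadd g n - pmean g N - f1 n)\<^sup>2) \<le> \<epsilon> * real N * (\<beta> N)\<^sup>2"
    proof -
      have ab: "g p = a p + b p" for p by (auto simp: a_def b_def)
      have "sadd g n = sadd a n + sadd b n" for n
        by (simp add: sadd_def ab[abs_def] sum.distrib)
      moreover have "pmean g N = pmean a N + pmean b N"
        by (simp add: pmean_def ab[abs_def] sum.distrib add_divide_distrib)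
      ultimately have "sadd g n - pmean g N - f1 n = sadd b n - pmean b N" for n by (simp add: f1_def)
      hence "(\<Sum>n=1..N. (sadd g n - pmean g N - f1 n)\<^sup>2) = (\<Sum>n=1..N. (sadd b n - pmean b N)\<^sup>2)" by simp
      also have "\<dots> \<le> (\<Sum>n=1..N. 2 * (sadd b n)\<^sup>2 + 2 * (pmean b N)\<^sup>2)"
      proof (rule sum_mono)
        fix n
        show "(sadd b n - pmean b N)\<^sup>2 \<le> 2 * (sadd b n)\<^sup>2 + 2 * (pmean b N)\<^sup>2"
          by (rule square_minus_le)
      qed
      also have "\<dots> = 2 * (\<Sum>n=1..N. (sadd b n)\<^sup>2) + 2 * real N * (pmean b N)\<^sup>2"
        by (simp add: sum.distrib sum_distrib_left)
      also have "(\<Sum>n=1..N. (sadd b n)\<^sup>2) \<le> real N * (1 + R) * V"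
        unfolding R_def I_def Vb[symmetric] by (rule sum_square_sadd_le) (auto simp: b_def split: if_splits)
      also have "real N * (1 + R) * V \<le> real N * 2 * V" using R1 V0 by (intro mult_right_mono mult_left_mono) auto
      also have "(pmean b N)\<^sup>2 \<le> V"
      proof -
        have "pmean b N = (\<Sum>p\<in>I. g p / real p)"
          unfolding pmean_def I_def by (intro sum.mono_neutral_cong_right) (auto simp: b_def)
        hence "(pmean b N)\<^sup>2 \<le> V * R" using Cauchy_Schwarz_recip[of g I] by (simp add: V_def R_def)
        also have "\<dots> \<le> V * 1" using R1 V0 by (intro mult_left_mono) auto
        finally show ?thesis by simp
      qed
      finally have "(\<Sum>n=1..N. (sadd g n - pmean g N - f1 n)\<^sup>2) \<le> 6 * (real N * V)"
        by (simp add: algebra_simps mult_left_mono mult_right_mono)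
      also have "\<dots> \<le> 6 * (real N * (\<epsilon> / 6 * (\<beta> N)\<^sup>2))" using V by (intro mult_left_mono) auto
      finally show ?thesis by (simp add: mult_ac)
    qed
    ultimately show ?case by blast
  qed
  thus ?thesis using C(1) by blast
qed

text \<open>An inequality of Turan--Kubilius type, read off from the decomposition with \<epsilon> =
  1; the fourth moment gives the second through x^2 \<le> x^4 / B + B.\<close>

lemma variance_sadd:
  "\<exists>C>0. \<forall>\<^sub>F N in sequentially. (\<Sum>n=1..N. (sadd g n - pmean g N)\<^sup>2) \<le> C * real N * (\<beta> N)\<^sup>2"
proof -
  obtain C where C: "C > 0" "\<forall>\<^sub>F N in sequentially. \<exists>f1. (\<Sum>n=1..N. (f1 n) ^ 4) \<le> C * real N * (\<beta> N) ^ 4 \<and>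
      (\<Sum>n=1..N. (sadd g n - pmean g N - f1 n)\<^sup>2) \<le> 1 * real N * (\<beta> N)\<^sup>2"
    using decomposition[of 1] by auto
  have "\<forall>\<^sub>F N in sequentially. (\<Sum>n=1..N. (sadd g n - pmean g N)\<^sup>2) \<le> (4 + 2 * C) * real N * (\<beta> N)\<^sup>2"
    using C(2) beta_ge[of 1]
  proof eventually_elim
    case (elim N)
    then obtain f1 where f1: "(\<Sum>n=1..N. (f1 n) ^ 4) \<le> C * real N * (\<beta> N) ^ 4"
      "(\<Sum>n=1..N. (sadd g n - pmean g N - f1 n)\<^sup>2) \<le> 1 * real N * (\<beta> N)\<^sup>2" by blast
    define B where "B = (\<beta> N)\<^sup>2"
    have B: "B > 0" using elim by (auto simp: B_def)
    have "(\<Sum>n=1..N. (sadd g n - pmean g N)\<^sup>2) \<le> (\<Sum>n=1..N. 2 * (sadd g n - pmean g N - f1 n)\<^sup>2 + 2 * ((f1 n)^4 / B + B))"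
    proof (rule sum_mono)
      fix n
      have 1: "(sadd g n - pmean g N)\<^sup>2 \<le> 2 * (sadd g n - pmean g N - f1 n)\<^sup>2 + 2 * (f1 n)\<^sup>2"
        using square_plus_le[of "sadd g n - pmean g N - f1 n" "f1 n"] by simp
      have "(f1 n)\<^sup>2 \<le> (f1 n)^4 / B + B" using le_scaled_square[of "(f1 n)\<^sup>2" 1 B] B by simp
      thus "(sadd g n - pmean g N)\<^sup>2 \<le> 2 * (sadd g n - pmean g N - f1 n)\<^sup>2 + 2 * ((f1 n)^4 / B + B)"
        by (intro order_trans[OF 1] add_left_mono mult_left_mono) auto
    qed
    also have "\<dots> = 2 * (\<Sum>n=1..N. (sadd g n - pmean g N - f1 n)\<^sup>2) + 2 * ((\<Sum>n=1..N. (f1 n)^4) / B + real N * B)"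
      by (simp add: sum.distrib sum_distrib_left sum_divide_distrib algebra_simps)
    also have "\<dots> \<le> 2 * (1 * real N * (\<beta> N)\<^sup>2) + 2 * (C * real N * (\<beta> N)^4 / B + real N * B)"
      using f1 B by (intro add_mono mult_left_mono divide_right_mono) auto
    also have "(\<beta> N)^4 = B * B" by (simp add: B_def power2_eq_square power4_eq_xxxx)
    also have "2 * (1 * real N * (\<beta> N)\<^sup>2) + 2 * (C * real N * (B * B) / B + real N * B) = (4 + 2 * C) * real N * (\<beta> N)\<^sup>2"
      using B by (simp add: B_def[symmetric] algebra_simps)
    finally show ?case .
  qed
  thus ?thesis using C(1) by (intro exI[of _ "4 + 2 * C"]) auto
qed

lemma variance_g:
  "\<exists>C>0. \<forall>\<^sub>F N in sequentially. (\<Sum>n=1..N. (g n - pmean g N)\<^sup>2) \<le> C * real N * (\<beta> N)\<^sup>2"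
proof -
  obtain C where C: "C > 0" "\<forall>\<^sub>F N in sequentially. (\<Sum>n=1..N. (sadd g n - pmean g N)\<^sup>2) \<le> C * real N * (\<beta> N)\<^sup>2"
    using variance_sadd by blast
  have "\<forall>\<^sub>F N in sequentially. (\<Sum>n=1..N. (g n - pmean g N)\<^sup>2) \<le> (2 * C + 2) * real N * (\<beta> N)\<^sup>2"
    using C(2) sum_square_diff_sadd[of 1, simplified]
  proof eventually_elim
    case (elim N)
    have "(\<Sum>n=1..N. (g n - pmean g N)\<^sup>2) \<le> (\<Sum>n=1..N. 2 * (sadd g n - pmean g N)\<^sup>2 + 2 * (g n - sadd g n)\<^sup>2)"
    proof (rule sum_mono)
      fix n
      show "(g n - pmean g N)\<^sup>2 \<le> 2 * (sadd g n - pmean g N)\<^sup>2 + 2 * (g n - sadd g n)\<^sup>2"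
        using square_plus_le[of "sadd g n - pmean g N" "g n - sadd g n"] by simp
    qed
    also have "\<dots> = 2 * (\<Sum>n=1..N. (sadd g n - pmean g N)\<^sup>2) + 2 * (\<Sum>n=1..N. (g n - sadd g n)\<^sup>2)"
      by (simp add: sum.distrib sum_distrib_left)
    also have "\<dots> \<le> 2 * (C * real N * (\<beta> N)\<^sup>2) + 2 * (real N * (\<beta> N)\<^sup>2)"
      using elim by (intro add_mono mult_left_mono) auto
    finally show ?case by (simp add: algebra_simps)
  qed
  thus ?thesis using C(1) by (intro exI[of _ "2 * C + 2"]) auto
qed

text \<open>The wasteful factor N does no harm: the bound is only set against quantities of order
  N^2 \<beta>^2.\<close>

lemma pmean_square_le: "(pmean g N)\<^sup>2 \<le> real N * (\<beta> N)\<^sup>2"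
proof -
  have "(pmean g N)\<^sup>2 \<le> (\<Sum>p\<in>primes_le N. (g p)\<^sup>2 / real p) * (\<Sum>p\<in>primes_le N. 1 / real p)"
    unfolding pmean_def by (rule Cauchy_Schwarz_recip)
  also have "\<dots> \<le> (\<beta> N)\<^sup>2 * real N"
  proof (intro mult_mono sum_beta_le)
    have "(\<Sum>p\<in>primes_le N. 1 / real p) \<le> (\<Sum>p\<in>primes_le N. 1)"
      by (intro sum_mono) (auto simp: Suc_le_eq prime_gt_0_nat)
    also have "\<dots> = real (card (primes_le N))" by simp
    also have "card (primes_le N) \<le> card {1..N}"
      by (intro card_mono) (auto simp: Suc_le_eq prime_gt_0_nat)
    finally show "(\<Sum>p\<in>primes_le N. 1 / real p) \<le> real N" by simp
  qed (auto intro!: sum_nonneg)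
  finally show ?thesis by (simp add: mult.commute)
qed

text \<open>At a descent |d| = d + 2 |d|, elsewhere |d| = d. The sum of d telescopes to
  \<open>g N\<close>, which is O(sqrt N) times \<beta>, already by the single term n = N of the
  variance.\<close>

lemma sum_abs_diff_g:
  assumes "\<tau> > 0"
  shows "\<forall>\<^sub>F N in sequentially. (\<Sum>n=1..N. \<bar>g n - g (n - 1)\<bar>) \<le> \<tau> * real N * \<beta> N"
proof -
  obtain C where C: "C > 0" "\<forall>\<^sub>F N in sequentially. (\<Sum>n=1..N. (g n - pmean g N)\<^sup>2) \<le> C * real N * (\<beta> N)\<^sup>2"
    using variance_g by blast
  \<comment> \<open>Three contributions get \<tau> / 3 each: the squares on the descents, 8 C s; the
    number of descents, 2 \<eta> / s; and \<open>g N\<close>, for which M makes N large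
    enough.\<close>
  define s where "s = \<tau> / (24 * C)"
  define \<eta> where "\<eta> = \<tau> * s / 6"
  have s: "s > 0" "\<eta> > 0" using assms C by (auto simp: s_def \<eta>_def)
  define M where "M = nat \<lceil>18 * (C + 1) / \<tau>\<^sup>2\<rceil>"
  show ?thesis
    using C(2) eventually_real[OF decrease_small[OF s(2)]] beta_ge[of 1] eventually_ge_at_top[of 1] eventually_ge_at_top[of M]
  proof eventually_elim
    case (elim N)
    define D where "D = decrease_set_upto g (real N)"
    define d where "d = (\<lambda>n. g n - g (n - 1))"
    define b where "b = \<beta> N"
    have b: "b \<ge> 1" using elim by (simp add: b_def)
    have fin: "finite D" "D \<subseteq> {1..N}" unfolding D_def by (auto simp: decrease_set_upto_def decrease_set_def)
    have tel: "(\<Sum>n=1..m. d n) = g m" for m by (induction m) (auto simp: d_def g_0)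
    have d2: "(\<Sum>n=1..N. (d n)\<^sup>2) \<le> 4 * C * real N * b\<^sup>2"
      using sum_square_consecutive_le[of g N "pmean g N"] elim g_0 additive_function_1[OF additive]
      by (simp add: d_def b_def)
    have "(\<Sum>n=1..N. \<bar>d n\<bar>) \<le> (\<Sum>n=1..N. d n + (if n \<in> D then 2 * \<bar>d n\<bar> else 0))"
      by (rule sum_mono) (auto simp: D_def d_def decrease_set_upto_def decrease_set_def)
    also have "\<dots> = g N + (\<Sum>n\<in>D. 2 * \<bar>d n\<bar>)"
    proof -
      have "(\<Sum>n=1..N. (if n \<in> D then 2 * \<bar>d n\<bar> else 0)) = (\<Sum>n\<in>D. 2 * \<bar>d n\<bar>)"
        using fin by (intro sum.mono_neutral_cong_right) auto
      thus ?thesis using tel[of N] by (simp add: sum.distrib)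
    qed
    also have "(\<Sum>n\<in>D. 2 * \<bar>d n\<bar>) \<le> (\<Sum>n\<in>D. 2 * (s / b) * (d n)\<^sup>2 + 2 * b / s)"
    proof (rule sum_mono)
      fix n
      show "2 * \<bar>d n\<bar> \<le> 2 * (s / b) * (d n)\<^sup>2 + 2 * b / s"
        using le_scaled_square[of "\<bar>d n\<bar>" s b] s b by simp
    qed
    also have "\<dots> = 2 * (s / b) * (\<Sum>n\<in>D. (d n)\<^sup>2) + real (card D) * (2 * b / s)"
      by (simp add: sum.distrib sum_distrib_left)
    also have "(\<Sum>n\<in>D. (d n)\<^sup>2) \<le> (\<Sum>n=1..N. (d n)\<^sup>2)" using fin by (intro sum_mono2) auto
    also note d2
    also have "real (card D) \<le> \<eta> * real N" using elim by (simp add: D_def)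
    also have "2 * (s / b) * (4 * C * real N * b\<^sup>2) = \<tau> / 3 * real N * b"
      using b C(1) by (simp add: s_def power2_eq_square field_simps)
    also have "\<eta> * real N * (2 * b / s) = \<tau> / 3 * real N * b"
      using s by (simp add: \<eta>_def field_simps)
    also have "g N \<le> \<tau> / 3 * real N * b"
    proof -
      have "(g N - pmean g N)\<^sup>2 \<le> (\<Sum>n=1..N. (g n - pmean g N)\<^sup>2)"
        using elim by (intro member_le_sum) auto
      hence 1: "(g N - pmean g N)\<^sup>2 \<le> C * real N * b\<^sup>2" using elim by (simp add: b_def)
      have 2: "(pmean g N)\<^sup>2 \<le> real N * b\<^sup>2" using pmean_square_le by (simp add: b_def)
      have "(g N)\<^sup>2 \<le> 2 * (g N - pmean g N)\<^sup>2 + 2 * (pmean g N)\<^sup>2"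
        using square_diff_le[of "g N" 0 "pmean g N"] by simp
      also have "\<dots> \<le> 2 * (C + 1) * real N * b\<^sup>2" using 1 2 by (simp add: algebra_simps)
      also have "\<dots> \<le> (\<tau> / 3)\<^sup>2 * real N * real N * b\<^sup>2"
      proof -
        have "18 * (C + 1) / \<tau>\<^sup>2 \<le> real M" unfolding M_def by (rule real_nat_ceiling_ge)
        also have "\<dots> \<le> real N" using elim by simp
        finally have "2 * (C + 1) \<le> (\<tau> / 3)\<^sup>2 * real N" using assms by (simp add: power_divide field_simps)
        thus ?thesis by (intro mult_right_mono) auto
      qed
      also have "\<dots> = (\<tau> / 3 * real N * b)\<^sup>2" by (simp add: power_mult_distrib power2_eq_square)
      finally have "\<bar>g N\<bar> \<le> \<bar>\<tau> / 3 * real N * b\<bar>" by (simp only: abs_le_square_iff)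
      thus ?thesis using assms b by simp
    qed
    finally show ?case using s b
      by (simp add: d_def b_def algebra_simps divide_right_mono mult_right_mono B_add_nonneg)
  qed
qed

text \<open>The function g - \<open>sadd g\<close> is small in mean square, hence in mean, and
  vanishes at 0, so that its shift is no larger. The choice \<tau> / 8 leaves \<tau> / 2 for g
  itself.\<close>

lemma sum_abs_diff_sadd:
  assumes "\<tau> > 0"
  shows "\<forall>\<^sub>F N in sequentially. (\<Sum>n=1..N. \<bar>sadd g n - sadd g (n - 1)\<bar>) \<le> \<tau> * real N * \<beta> N"
proof -
  define e where "e = \<tau> / 8"
  have e: "e > 0" "e\<^sup>2 > 0" using assms by (auto simp: e_def)
  have t: "\<tau> / 2 > 0" using assms by simp
  show ?thesis
    using sum_abs_diff_g[OF t] sum_square_diff_sadd[OF e(2)] beta_ge[of 1]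
  proof eventually_elim
    case (elim N)
    define b where "b = \<beta> N"
    have b: "b \<ge> 1" using elim by (simp add: b_def)
    define w where "w = (\<lambda>n. g n - sadd g n)"
    have w: "w 0 = 0" by (simp add: w_def g_0)
    have "(\<Sum>n=1..N. \<bar>w n\<bar>) \<le> (\<Sum>n=1..N. (1 / (e * b)) * (w n)\<^sup>2 + e * b)"
    proof (rule sum_mono)
      fix n
      show "\<bar>w n\<bar> \<le> (1 / (e * b)) * (w n)\<^sup>2 + e * b"
        using le_scaled_square[of "\<bar>w n\<bar>" 1 "e * b"] e b by simp
    qed
    also have "\<dots> = (1 / (e * b)) * (\<Sum>n=1..N. (w n)\<^sup>2) + real N * (e * b)"
      by (simp add: sum.distrib sum_distrib_left)
    also have "\<dots> \<le> (1 / (e * b)) * (e\<^sup>2 * real N * b\<^sup>2) + real N * (e * b)"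
      using elim e b by (intro add_right_mono mult_left_mono) (auto simp: w_def b_def)
    also have "\<dots> = 2 * e * real N * b" using e b by (simp add: power2_eq_square field_simps)
    finally have w1: "(\<Sum>n=1..N. \<bar>w n\<bar>) \<le> 2 * e * real N * b" .
    have w2: "(\<Sum>n=1..N. \<bar>w (n - 1)\<bar>) \<le> (\<Sum>n=1..N. \<bar>w n\<bar>)"
      by (rule sum_shift_le) (auto simp: w)
    have "(\<Sum>n=1..N. \<bar>sadd g n - sadd g (n - 1)\<bar>) \<le> (\<Sum>n=1..N. \<bar>g n - g (n - 1)\<bar> + \<bar>w n\<bar> + \<bar>w (n - 1)\<bar>)"
      by (rule sum_mono) (auto simp: w_def)
    also have "\<dots> \<le> \<tau> / 2 * real N * b + 2 * e * real N * b + 2 * e * real N * b"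
      unfolding sum.distrib using elim w1 w2 by (intro add_mono) (auto simp: b_def)
    also have "\<dots> = \<tau> * real N * b" by (simp add: e_def field_simps)
    finally show ?case by (simp add: b_def)
  qed
qed

text \<open>Smallness in mean becomes smallness in mean square by the uniform integrability that the
  decomposition provides.\<close>
lemma sum_square_diff_consecutive:
  assumes "\<epsilon> > 0"
  shows "\<forall>\<^sub>F N in sequentially. (\<Sum>n=1..N. (sadd g n - sadd g (n - 1))\<^sup>2) \<le> \<epsilon> * real N * (\<beta> N)\<^sup>2"
proof -
  have e: "\<epsilon> / 32 > 0" using assms by simp
  obtain C where C: "C > 0" "\<forall>\<^sub>F N in sequentially. \<exists>f1. (\<Sum>n=1..N. (f1 n) ^ 4) \<le> C * real N * (\<beta> N) ^ 4 \<and>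
      (\<Sum>n=1..N. (sadd g n - pmean g N - f1 n)\<^sup>2) \<le> \<epsilon> / 32 * real N * (\<beta> N)\<^sup>2"
    using decomposition[OF e] by auto
  \<comment> \<open>The bound \<epsilon> consists of four quarters: small increments give \<eta>^2,
    the remainder r gives 8 (\<epsilon> / 32), the fourth moment gives 32 s C, and the first moment
    of the increments gives 2 \<tau> / (s \<eta>).\<close>
  define \<eta> where "\<eta> = sqrt (\<epsilon> / 4)"
  define s where "s = \<epsilon> / (128 * C)"
  have \<eta>: "\<eta> > 0" "\<eta>\<^sup>2 = \<epsilon> / 4" and s: "s > 0" using assms C(1) by (auto simp: \<eta>_def s_def)
  define \<tau> where "\<tau> = s * \<eta> * \<epsilon> / 8"
  have \<tau>: "\<tau> > 0" using assms \<eta> s by (simp add: \<tau>_def)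
  show ?thesis
    using C(2) sum_abs_diff_sadd[OF \<tau>] beta_ge[of 1]
  proof eventually_elim
    case (elim N)
    then obtain f1 where f1: "(\<Sum>n=1..N. (f1 n) ^ 4) \<le> C * real N * (\<beta> N) ^ 4"
      "(\<Sum>n=1..N. (sadd g n - pmean g N - f1 n)\<^sup>2) \<le> \<epsilon> / 32 * real N * (\<beta> N)\<^sup>2" by blast
    define b where "b = \<beta> N"
    have b: "b \<ge> 1" using elim by (simp add: b_def)
    define r where "r = (\<lambda>n. sadd g n - pmean g N - f1 n)"
    define d where "d = (\<lambda>n. sadd g n - sadd g (n - 1))"
    define h where "h = (\<lambda>n. 4 * (r n)\<^sup>2 + (16 * s / b\<^sup>2) * (f1 n) ^ 4)"
    have h0: "h n \<ge> 0" for n using s by (simp add: h_def)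
    have "(\<Sum>n=1..N. (d n)\<^sup>2) \<le> (\<Sum>n=1..N. \<eta>\<^sup>2 * b\<^sup>2 + (h n + (if n = 1 then 0 else h (n - 1))) + (2 * b / (s * \<eta>)) * \<bar>d n\<bar>)"
    proof (rule sum_mono)
      fix n assume n: "n \<in> {1..N}"
      have nn: "(2 * b / (s * \<eta>)) * \<bar>d n\<bar> \<ge> 0" using b s \<eta> by simp
      show "(d n)\<^sup>2 \<le> \<eta>\<^sup>2 * b\<^sup>2 + (h n + (if n = 1 then 0 else h (n - 1))) + (2 * b / (s * \<eta>)) * \<bar>d n\<bar>"
      \<comment> \<open>Increments below \<eta> b are harmless. The case n = 1 is added because
        \<open>f1 0\<close> and \<open>r 0\<close> are not controlled, whereas \<open>sadd g\<close>
        vanishes at both 0 and 1.\<close>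
      proof (cases "n = 1 \<or> \<bar>d n\<bar> \<le> \<eta> * b")
        case True
        have "(d n)\<^sup>2 \<le> \<eta>\<^sup>2 * b\<^sup>2"
        proof (cases "n = 1")
          case False
          hence "\<bar>d n\<bar> \<le> \<bar>\<eta> * b\<bar>" using True by linarith
          hence "(d n)\<^sup>2 \<le> (\<eta> * b)\<^sup>2" by (simp only: abs_le_square_iff)
          thus ?thesis by (simp add: power_mult_distrib)
        qed (simp add: d_def)
        moreover have "h n + (if n = 1 then 0 else h (n - 1)) \<ge> 0" using h0[of n] h0[of "n - 1"] by simp
        ultimately show ?thesis using nn by linarith
      next
        case False
        define F1 where "F1 = f1 n - f1 (n - 1)"
        define F2 where "F2 = r n - r (n - 1)"
        have "d n = F1 + F2" by (simp add: d_def F1_def F2_def r_def)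
        hence 1: "(d n)\<^sup>2 \<le> 2 * F1\<^sup>2 + 2 * F2\<^sup>2"
          using square_plus_le[of F1 F2] by simp
        have 2: "F2\<^sup>2 \<le> 2 * (r n)\<^sup>2 + 2 * (r (n - 1))\<^sup>2" unfolding F2_def by (rule square_minus_le)
        have 3: "F1 ^ 4 \<le> 8 * (f1 n)^4 + 8 * (f1 (n - 1))^4" unfolding F1_def by (rule fourth_diff_le)
        have 4: "F1\<^sup>2 \<le> (s / b\<^sup>2) * F1 ^ 4 + b\<^sup>2 / s"
        proof -
          have "b\<^sup>2 > 0" using b by simp
          from le_scaled_square[OF _ s this, of "F1\<^sup>2"] show ?thesis by simp
        qed
        \<comment> \<open>Here the increment is large, |d n| > \<eta> b, so the constant left over
          by Young's inequality can be charged to |d n|, whose sum is already known to be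
          small.\<close>
        have 5: "b\<^sup>2 / s \<le> b / (s * \<eta>) * \<bar>d n\<bar>"
        proof -
          have "(b / (s * \<eta>)) * (\<eta> * b) \<le> (b / (s * \<eta>)) * \<bar>d n\<bar>"
            using False b s \<eta> by (intro mult_left_mono) auto
          thus ?thesis using \<eta> s by (simp add: power2_eq_square)
        qed
        have 6: "(s / b\<^sup>2) * F1 ^ 4 \<le> (s / b\<^sup>2) * (8 * (f1 n)^4 + 8 * (f1 (n - 1))^4)"
          using 3 s by (intro mult_left_mono) auto
        have "(d n)\<^sup>2 \<le> 2 * ((s / b\<^sup>2) * (8 * (f1 n)^4 + 8 * (f1 (n - 1))^4) + b / (s * \<eta>) * \<bar>d n\<bar>) + 2 * (2 * (r n)\<^sup>2 + 2 * (r (n - 1))\<^sup>2)"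
          using 1 2 4 5 6 by argo
        also have "\<dots> = h n + h (n - 1) + (2 * b / (s * \<eta>)) * \<bar>d n\<bar>"
          by (simp add: h_def add_divide_distrib algebra_simps)
        finally have "(d n)\<^sup>2 \<le> h n + h (n - 1) + (2 * b / (s * \<eta>)) * \<bar>d n\<bar>" .
        moreover have "\<eta>\<^sup>2 * b\<^sup>2 \<ge> 0" by simp
        moreover have "(if n = 1 then 0 else h (n - 1)) = h (n - 1)" using False by simp
        ultimately show ?thesis by linarith
      qed
    qed
    also have "\<dots> = real N * (\<eta>\<^sup>2 * b\<^sup>2) + (\<Sum>n=1..N. h n + (if n = 1 then 0 else h (n - 1))) + (2 * b / (s * \<eta>)) * (\<Sum>n=1..N. \<bar>d n\<bar>)"
      by (simp add: sum.distrib sum_distrib_left)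
    also have "\<dots> \<le> real N * (\<eta>\<^sup>2 * b\<^sup>2) + 2 * (\<Sum>n=1..N. h n) + (2 * b / (s * \<eta>)) * (\<tau> * real N * b)"
      using elim s \<eta> b h0 by (intro add_mono mult_left_mono sum_shift_add_le) (auto simp: d_def b_def)
    also have "(\<Sum>n=1..N. h n) = 4 * (\<Sum>n=1..N. (r n)\<^sup>2) + (16 * s / b\<^sup>2) * (\<Sum>n=1..N. (f1 n)^4)"
      by (simp add: h_def sum.distrib sum_distrib_left)
    also have "\<dots> \<le> 4 * (\<epsilon> / 32 * real N * b\<^sup>2) + (16 * s / b\<^sup>2) * (C * real N * b ^ 4)"
      using f1 s b by (intro add_mono mult_left_mono) (auto simp: r_def b_def)
    also have "b ^ 4 = b\<^sup>2 * b\<^sup>2" by (simp add: power2_eq_square power4_eq_xxxx)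
    also have "(16 * s / b\<^sup>2) * (C * real N * (b\<^sup>2 * b\<^sup>2)) = \<epsilon> / 8 * real N * b\<^sup>2"
      using b C(1) by (simp add: s_def field_simps)
    also have "(2 * b / (s * \<eta>)) * (\<tau> * real N * b) = \<epsilon> / 4 * real N * b\<^sup>2"
      using s \<eta> by (simp add: \<tau>_def power2_eq_square field_simps)
    finally have "(\<Sum>n=1..N. (d n)\<^sup>2) \<le> real N * (\<epsilon> / 4 * b\<^sup>2) + 2 * (4 * (\<epsilon> / 32 * real N * b\<^sup>2) + \<epsilon> / 8 * real N * b\<^sup>2) + \<epsilon> / 4 * real N * b\<^sup>2"
      using \<eta>(2) by simp
    also have "\<dots> = \<epsilon> * real N * b\<^sup>2" by (simp add: field_simps)
    finally show ?case by (simp add: d_def b_def)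
  qed
qed

end

section \<open>Multiples of primes and an almost orthogonal system\<close>

text \<open>Translation by a identifies the set with the multiples of d in (a, a + M], and a
  difference of two floors deviates from the difference of the arguments by at most 1.\<close>

lemma card_residue_class:
  assumes "d > 0"
  shows "\<bar>real (card {n\<in>{1..M}. d dvd n + a}) - real M / real d\<bar> \<le> 1"
proof -
  have "bij_betw (\<lambda>n. n + a) {n\<in>{1..M}. d dvd n + a} ({n\<in>{1..M+a}. d dvd n} - {n\<in>{1..a}. d dvd n})"
    by (rule bij_betwI[of _ _ _ "\<lambda>n. n - a"]) auto
  hence "card {n\<in>{1..M}. d dvd n + a} = card ({n\<in>{1..M+a}. d dvd n} - {n\<in>{1..a}. d dvd n})"
    by (rule bij_betw_same_card)
  also have "\<dots> = (M + a) div d - a div d"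
    using card_multiples[OF assms, of "M + a"] card_multiples[OF assms, of a]
    by (subst card_Diff_subset) auto
  finally have "real (card {n\<in>{1..M}. d dvd n + a}) = real ((M + a) div d) - real (a div d)"
    by (simp add: div_le_mono)
  moreover have "real (n div d) \<le> real n / real d" "real n / real d < real (n div d) + 1" for n
    using floor_divide_of_nat_eq[of n d, where ?'a = real] by linarith+
  from this[of "M + a"] this[of a] have "\<bar>real ((M + a) div d) - real (a div d) - real M / real d\<bar> \<le> 1"
    unfolding of_nat_add add_divide_distrib by linarith
  ultimately show ?thesis by simp
qed

lemma card_two_residue_classes:
  assumes "coprime p q" "p > 0" "q > 0"
  shows "\<bar>real (card {n\<in>{1..M}. p dvd n + h \<and> q dvd n + k}) - real M / real (p * q)\<bar> \<le> 1"
proof -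
  obtain a where a: "[a = h] (mod p)" "[a = k] (mod q)"
    using binary_chinese_remainder_nat[OF assms(1)] by blast
  have "p dvd n + h \<longleftrightarrow> p dvd n + a" "q dvd n + k \<longleftrightarrow> q dvd n + a" for n
    using a by (auto intro!: cong_dvd_iff cong_add simp: cong_sym)
  hence "{n\<in>{1..M}. p dvd n + h \<and> q dvd n + k} = {n\<in>{1..M}. p * q dvd n + a}"
    using assms(1) by (auto intro: divides_mult elim: dvd_mult_left dvd_mult_right)
  thus ?thesis using card_residue_class[of "p * q" M a] assms by simp
qed

section \<open>Almost orthogonal test functions attached to primes\<close>

text \<open>The indicator of the residue classes -h mod p with h in R, scaled to mean about 1 and
  then centred. The restriction n + h \<le> N makes the translates by h land on the multiples of p
  up to N. Two choices of R are used: {0}, for the multiples themselves, and {1..H}.\<close>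

definition shift_weight :: "nat set \<Rightarrow> nat \<Rightarrow> nat \<Rightarrow> nat \<Rightarrow> real" where
  "shift_weight R N p n = real p / real (card R) * real (card {h\<in>R. p dvd n + h \<and> n + h \<le> N}) - 1"

lemma shift_weight_altdef:
  assumes "finite R"
  shows "shift_weight R N p n =
    real p / real (card R) * (\<Sum>h\<in>R. if p dvd n + h \<and> n + h \<le> N then 1 else 0) - 1"
  unfolding shift_weight_def using assms by (simp add: sum.inter_filter[symmetric])

lemma sum_mult_shift_weight:
  assumes "finite R"
  shows "(\<Sum>n=1..N. G n * shift_weight R N p n) =
    real p / real (card R) * (\<Sum>h\<in>R. \<Sum>n=1..N. if p dvd n + h \<and> n + h \<le> N then G n else 0) - (\<Sum>n=1..N. G n)"
proof -
  have "(\<Sum>n=1..N. G n * shift_weight R N p n) =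
     (\<Sum>n=1..N. real p / real (card R) * (\<Sum>h\<in>R. if p dvd n + h \<and> n + h \<le> N then G n else 0) - G n)"
    unfolding shift_weight_altdef[OF assms]
    by (intro sum.cong refl) (simp add: algebra_simps sum_distrib_left, intro disjI2 sum.cong, auto)
  also have "\<dots> = real p / real (card R) * (\<Sum>n=1..N. \<Sum>h\<in>R. if p dvd n + h \<and> n + h \<le> N then G n else 0) - (\<Sum>n=1..N. G n)"
    by (simp only: sum_subtractf sum_distrib_left[symmetric])
  also have "(\<Sum>n=1..N. \<Sum>h\<in>R. if p dvd n + h \<and> n + h \<le> N then G n else 0) = (\<Sum>h\<in>R. \<Sum>n=1..N. if p dvd n + h \<and> n + h \<le> N then G n else 0)"
    by (rule sum.swap)
  finally show ?thesis .
qed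

lemma card_shift_class:
  assumes "p > 0" "h < p" "h \<le> N"
  shows "\<bar>(\<Sum>n=1..N. if p dvd n + h \<and> n + h \<le> N then 1 else 0) - real N / real p\<bar> \<le> 2"
proof -
  have "(\<Sum>n=1..N. if p dvd n + h \<and> n + h \<le> N then 1 else 0) = real (card {n\<in>{1..N}. p dvd n + h \<and> n + h \<le> N})"
    by (subst sum.inter_filter[symmetric]) auto
  also have "{n\<in>{1..N}. p dvd n + h \<and> n + h \<le> N} = {n\<in>{1..N-h}. p dvd n + h}" by auto
  finally have "\<bar>(\<Sum>n=1..N. if p dvd n + h \<and> n + h \<le> N then 1 else 0) - real (N - h) / real p\<bar> \<le> 1"
    using card_residue_class[OF assms(1), of "N - h" h] by simp
  moreover have "real (N - h) / real p = real N / real p - real h / real p"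
    using assms by (simp add: of_nat_diff diff_divide_distrib)
  moreover have "0 \<le> real h / real p" "real h / real p \<le> 1" using assms by auto
  ultimately show ?thesis by linarith
qed

lemma card_two_shift_classes:
  assumes "coprime p q" "p > 0" "q > 0" "h < p" "k < q" "h \<le> N" "k \<le> N"
  shows "\<bar>(\<Sum>n=1..N. if (p dvd n + h \<and> n + h \<le> N) \<and> (q dvd n + k \<and> n + k \<le> N) then 1 else 0) - real N / real (p * q)\<bar> \<le> 2"
proof -
  define m where "m = max h k"
  have "m \<le> h + k" by (simp add: m_def)
  have "(\<Sum>n=1..N. if (p dvd n + h \<and> n + h \<le> N) \<and> (q dvd n + k \<and> n + k \<le> N) then 1 else 0) =
     real (card {n\<in>{1..N}. (p dvd n + h \<and> n + h \<le> N) \<and> (q dvd n + k \<and> n + k \<le> N)})"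
    by (subst sum.inter_filter[symmetric]) auto
  also have "{n\<in>{1..N}. (p dvd n + h \<and> n + h \<le> N) \<and> (q dvd n + k \<and> n + k \<le> N)} = {n\<in>{1..N-m}. p dvd n + h \<and> q dvd n + k}"
    by (auto simp: m_def)
  finally have "\<bar>(\<Sum>n=1..N. if (p dvd n + h \<and> n + h \<le> N) \<and> (q dvd n + k \<and> n + k \<le> N) then 1 else 0) - real (N - m) / real (p * q)\<bar> \<le> 1"
    using card_two_residue_classes[OF assms(1-3), of "N - m" h k] by simp
  moreover have "real (N - m) / real (p * q) = real N / real (p * q) - real m / real (p * q)"
    using assms by (simp add: of_nat_diff diff_divide_distrib m_def)
  moreover have "m \<le> p * q"
  proof -
    have "h \<le> p * q" "k \<le> p * q" using assms
      by (metis dvd_imp_le dvd_triv_left less_imp_le_nat mult_pos_pos order_trans)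
         (metis assms(2,3,5) dvd_imp_le dvd_triv_right less_imp_le_nat mult_pos_pos order_trans)
    thus ?thesis by (simp add: m_def)
  qed
  hence "0 \<le> real m / real (p * q)" "real m / real (p * q) \<le> 1" using assms
    by (auto simp: divide_le_eq_1 simp flip: of_nat_mult)
  ultimately show ?thesis by linarith
qed

lemma sum_abs_diff_const_le:
  fixes f :: "'a \<Rightarrow> real"
  assumes "finite A" "\<And>x. x \<in> A \<Longrightarrow> \<bar>f x - c\<bar> \<le> b"
  shows "\<bar>(\<Sum>x\<in>A. f x) - real (card A) * c\<bar> \<le> real (card A) * b"
proof -
  have "(\<Sum>x\<in>A. f x) - real (card A) * c = (\<Sum>x\<in>A. f x - c)" by (simp add: sum_subtractf)
  also have "\<bar>\<dots>\<bar> \<le> (\<Sum>x\<in>A. \<bar>f x - c\<bar>)" by (rule sum_abs)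
  also have "\<dots> \<le> (\<Sum>x\<in>A. b)" by (intro sum_mono assms)
  finally show ?thesis by simp
qed

lemma shift_weight_sum:
  assumes R: "finite R" "R \<noteq> {}" and p: "prime p" "p \<le> N" "\<And>h. h \<in> R \<Longrightarrow> h < p"
  shows "\<bar>real p / real (card R) * (\<Sum>h\<in>R. \<Sum>n=1..N. if p dvd n + h \<and> n + h \<le> N then 1 else 0) - real N\<bar> \<le> 2 * real p"
proof -
  have p0: "p > 0" and r: "card R > 0" using p R by (auto simp: prime_gt_0_nat card_gt_0_iff)
  define s where "s = (\<Sum>h\<in>R. \<Sum>n=1..N. if p dvd n + h \<and> n + h \<le> N then 1 else (0::real))"
  have 1: "\<bar>s - real (card R) * (real N / real p)\<bar> \<le> real (card R) * 2"
    unfolding s_def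
  proof (rule sum_abs_diff_const_le[OF R(1)])
    fix h assume h: "h \<in> R"
    thus "\<bar>(\<Sum>n=1..N. if p dvd n + h \<and> n + h \<le> N then 1 else 0) - real N / real p\<bar> \<le> 2"
      by (intro card_shift_class p0) (use p(2) p(3)[OF h] in linarith)+
  qed
  have "real p / real (card R) * s - real N = real p / real (card R) * (s - real (card R) * (real N / real p))"
    using p0 r by (simp add: field_simps)
  also have "\<bar>\<dots>\<bar> = real p / real (card R) * \<bar>s - real (card R) * (real N / real p)\<bar>" by (simp add: abs_mult)
  also have "\<dots> \<le> real p / real (card R) * (real (card R) * 2)" using 1 by (intro mult_left_mono) auto
  also have "\<dots> = 2 * real p" using r by simp
  finally show ?thesis by (simp add: s_def)
qed

text \<open>After expansion the joint count, the two single counts and the constant are each about N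
  and cancel. By the Chinese remainder theorem the joint count has error 2 p q after scaling; the
  single counts add 2 p + 2 q \<le> 2 p q.\<close>

lemma shift_weight_corr:
  assumes R: "finite R" "R \<noteq> {}" and p: "prime p" "p \<le> N" "\<And>h. h \<in> R \<Longrightarrow> h < p"
    and q: "prime q" "q \<le> N" "\<And>h. h \<in> R \<Longrightarrow> h < q" and "p \<noteq> q"
  shows "\<bar>\<Sum>n=1..N. shift_weight R N p n * shift_weight R N q n\<bar> \<le> 4 * real p * real q"
proof -
  have p0: "p > 0" and q0: "q > 0" and r: "card R > 0" using p q R by (auto simp: prime_gt_0_nat card_gt_0_iff)
  have cop: "coprime p q" using p q \<open>p \<noteq> q\<close> by (intro primes_coprime) auto
  define \<iota> where "\<iota> = (\<lambda>p h n. if p dvd n + h \<and> n + h \<le> N then 1 else (0::real))"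
  define r' where "r' = real (card R)"
  define sp where "sp = (\<Sum>h\<in>R. \<Sum>n=1..N. \<iota> p h n)"
  define sq where "sq = (\<Sum>h\<in>R. \<Sum>n=1..N. \<iota> q h n)"
  define spq where "spq = (\<Sum>h\<in>R. \<Sum>k\<in>R. \<Sum>n=1..N. if (p dvd n + h \<and> n + h \<le> N) \<and> (q dvd n + k \<and> n + k \<le> N) then 1 else (0::real))"
  have w: "shift_weight R N s n = real s / r' * (\<Sum>h\<in>R. \<iota> s h n) - 1" for s n
    unfolding shift_weight_altdef[OF R(1)] \<iota>_def r'_def by simp
  have "(\<Sum>n=1..N. shift_weight R N p n * shift_weight R N q n) =
    (\<Sum>n=1..N. real p * real q / (r' * r') * ((\<Sum>h\<in>R. \<iota> p h n) * (\<Sum>k\<in>R. \<iota> q k n))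
       - real p / r' * (\<Sum>h\<in>R. \<iota> p h n) - real q / r' * (\<Sum>h\<in>R. \<iota> q h n) + 1)"
    unfolding w by (simp add: algebra_simps)
  also have "\<dots> = real p * real q / (r' * r') * (\<Sum>n=1..N. (\<Sum>h\<in>R. \<iota> p h n) * (\<Sum>k\<in>R. \<iota> q k n))
       - real p / r' * (\<Sum>n=1..N. \<Sum>h\<in>R. \<iota> p h n) - real q / r' * (\<Sum>n=1..N. \<Sum>h\<in>R. \<iota> q h n) + real N"
    by (simp only: sum.distrib sum_subtractf sum_distrib_left[symmetric]) simp
  also have "(\<Sum>n=1..N. \<Sum>h\<in>R. \<iota> p h n) = sp" unfolding sp_def by (rule sum.swap)
  also have "(\<Sum>n=1..N. \<Sum>h\<in>R. \<iota> q h n) = sq" unfolding sq_def by (rule sum.swap)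
  also have "(\<Sum>n=1..N. (\<Sum>h\<in>R. \<iota> p h n) * (\<Sum>k\<in>R. \<iota> q k n)) = spq"
  proof -
    have "(\<Sum>n=1..N. (\<Sum>h\<in>R. \<iota> p h n) * (\<Sum>k\<in>R. \<iota> q k n)) = (\<Sum>n=1..N. \<Sum>h\<in>R. \<Sum>k\<in>R. \<iota> p h n * \<iota> q k n)"
      by (simp only: sum_product)
    also have "\<dots> = (\<Sum>h\<in>R. \<Sum>k\<in>R. \<Sum>n=1..N. \<iota> p h n * \<iota> q k n)"
      by (subst sum.swap, rule sum.cong[OF refl], rule sum.swap)
    also have "\<dots> = spq" unfolding spq_def \<iota>_def by (intro sum.cong refl) auto
    finally show ?thesis .
  qed
  finally have eq: "(\<Sum>n=1..N. shift_weight R N p n * shift_weight R N q n) =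
     real p * real q / (r' * r') * spq - real p / r' * sp - real q / r' * sq + real N" .
  have 1: "\<bar>real p / r' * sp - real N\<bar> \<le> 2 * real p"
    unfolding r'_def sp_def \<iota>_def by (rule shift_weight_sum[OF R p])
  have 2: "\<bar>real q / r' * sq - real N\<bar> \<le> 2 * real q"
    unfolding r'_def sq_def \<iota>_def by (rule shift_weight_sum[OF R q])
  have 3: "\<bar>spq - r' * (r' * (real N / real (p * q)))\<bar> \<le> r' * (r' * 2)"
    unfolding spq_def r'_def
  proof (intro sum_abs_diff_const_le[OF R(1)])
    fix h k assume "h \<in> R" "k \<in> R"
    with p(3)[of h] q(3)[of k] show "\<bar>(\<Sum>n=1..N. if (p dvd n + h \<and> n + h \<le> N) \<and> (q dvd n + k \<and> n + k \<le> N) then 1 else 0) - real N / real (p * q)\<bar> \<le> 2"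
      using p(2) q(2) p0 q0 cop by (intro card_two_shift_classes) auto
  qed
  have "real p * real q / (r' * r') * spq - real N = real p * real q / (r' * r') * (spq - r' * (r' * (real N / real (p * q))))"
    using p0 q0 r by (simp add: field_simps r'_def)
  also have "\<bar>\<dots>\<bar> = real p * real q / (r' * r') * \<bar>spq - r' * (r' * (real N / real (p * q)))\<bar>"
    by (simp add: abs_mult r'_def)
  also have "\<dots> \<le> real p * real q / (r' * r') * (r' * (r' * 2))" using 3 by (intro mult_left_mono) (auto simp: r'_def)
  also have "\<dots> = 2 * (real p * real q)" using r by (simp add: r'_def)
  finally have 4: "\<bar>real p * real q / (r' * r') * spq - real N\<bar> \<le> 2 * (real p * real q)" .
  have "real p \<ge> 2" "real q \<ge> 2" using p(1) q(1) prime_ge_2_nat[of p] prime_ge_2_nat[of q] by auto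
  hence "2 * real q \<le> real p * real q" "real p * 2 \<le> real p * real q"
    by (intro mult_right_mono mult_left_mono; simp)+
  hence "2 * real p + 2 * real q \<le> 2 * (real p * real q)" by linarith
  moreover have "4 * real p * real q = 4 * (real p * real q)" by simp
  moreover have "\<bar>x - y - z + n\<bar> \<le> 4 * c"
    if "\<bar>x - n\<bar> \<le> 2 * c" "\<bar>y - n\<bar> \<le> 2 * a" "\<bar>z - n\<bar> \<le> 2 * b" "2 * a + 2 * b \<le> 2 * c"
    for x y z n a b c :: real
    using that by linarith
  note this[OF 4 1 2]
  ultimately show ?thesis unfolding eq by simp
qed

text \<open>The elements of R are below p, hence distinct modulo p, so that at most one of them
  contributes for each n and the unscaled count is 0 or 1. The main term is therefore p N / |R|:
  this is where more residue classes lead to a gain.\<close>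

lemma shift_weight_square:
  assumes R: "finite R" "R \<noteq> {}" and p: "prime p" "p \<le> N" "\<And>h. h \<in> R \<Longrightarrow> h < p"
  shows "(\<Sum>n=1..N. (shift_weight R N p n)\<^sup>2) \<le> real p * real N / real (card R) + 4 * real p * real p"
proof -
  have p0: "p > 0" and r: "card R > 0" using p R by (auto simp: prime_gt_0_nat card_gt_0_iff)
  define \<iota> where "\<iota> = (\<lambda>h n. if p dvd n + h \<and> n + h \<le> N then 1 else (0::real))"
  define r' where "r' = real (card R)"
  define t where "t = real p / r' * (\<Sum>h\<in>R. \<Sum>n=1..N. \<iota> h n)"
  have r': "r' \<ge> 1" using r by (simp add: r'_def)
  have sq: "(\<Sum>h\<in>R. \<iota> h n)\<^sup>2 = (\<Sum>h\<in>R. \<iota> h n)" if "n \<ge> 1" for n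
  proof -
    have "(\<Sum>h\<in>R. \<iota> h n)\<^sup>2 = (\<Sum>h\<in>R. \<Sum>k\<in>R. \<iota> h n * \<iota> k n)" by (simp add: power2_eq_square sum_product)
    also have "\<dots> = (\<Sum>h\<in>R. \<Sum>k\<in>R. if k = h then \<iota> h n else 0)"
    proof (intro sum.cong refl)
      fix h k assume hk: "h \<in> R" "k \<in> R"
      have "h = k" if "p dvd n + h" "p dvd n + k"
      proof -
        have "[n + h = n + k] (mod p)" using that by (simp add: cong_def mod_eq_0_iff_dvd)
        hence "[h = k] (mod p)" by (simp add: cong_add_lcancel_nat)
        thus "h = k" using p(3) hk by (simp add: cong_def)
      qed
      thus "\<iota> h n * \<iota> k n = (if k = h then \<iota> h n else 0)" by (auto simp: \<iota>_def)
    qed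
    also have "\<dots> = (\<Sum>h\<in>R. \<iota> h n)" using R(1) by simp
    finally show ?thesis .
  qed
  have "(\<Sum>n=1..N. (shift_weight R N p n)\<^sup>2) = (\<Sum>n=1..N. (real p / r' * real p / r' - 2 * (real p / r')) * (\<Sum>h\<in>R. \<iota> h n) + 1)"
  proof (rule sum.cong[OF refl])
    fix n assume n: "n \<in> {1..N}"
    have "shift_weight R N p n = real p / r' * (\<Sum>h\<in>R. \<iota> h n) - 1"
      unfolding shift_weight_altdef[OF R(1)] \<iota>_def r'_def by simp
    hence "(shift_weight R N p n)\<^sup>2 = (real p / r')\<^sup>2 * (\<Sum>h\<in>R. \<iota> h n)\<^sup>2 - 2 * (real p / r') * (\<Sum>h\<in>R. \<iota> h n) + 1"
      by (simp only: power2_diff power_mult_distrib) simp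
    thus "(shift_weight R N p n)\<^sup>2 = (real p / r' * real p / r' - 2 * (real p / r')) * (\<Sum>h\<in>R. \<iota> h n) + 1"
      using n by (simp add: sq) (simp add: power2_eq_square algebra_simps)
  qed
  also have "\<dots> = (real p / r' * real p / r' - 2 * (real p / r')) * (\<Sum>n=1..N. \<Sum>h\<in>R. \<iota> h n) + real N"
    by (simp add: sum.distrib sum_distrib_left)
  also have "(\<Sum>n=1..N. \<Sum>h\<in>R. \<iota> h n) = (\<Sum>h\<in>R. \<Sum>n=1..N. \<iota> h n)" by (rule sum.swap)
  also have "(real p / r' * real p / r' - 2 * (real p / r')) * (\<Sum>h\<in>R. \<Sum>n=1..N. \<iota> h n) + real N = real p / r' * t - 2 * t + real N"
    by (simp add: t_def algebra_simps)
  finally have eq: "(\<Sum>n=1..N. (shift_weight R N p n)\<^sup>2) = real p / r' * t - 2 * t + real N" .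
  have "\<bar>t - real N\<bar> \<le> 2 * real p"
    unfolding t_def r'_def \<iota>_def by (rule shift_weight_sum[OF R p])
  hence t: "t \<le> real N + 2 * real p" "t \<ge> real N - 2 * real p" by linarith+
  have "real p / r' * t \<le> real p / r' * (real N + 2 * real p)" using t r' by (intro mult_left_mono) auto
  also have "\<dots> = real p * real N / r' + 2 * real p * real p / r'" by (simp add: algebra_simps add_divide_distrib)
  also have "2 * real p * real p / r' \<le> 2 * real p * real p / 1" using r' by (intro divide_left_mono) auto
  finally have "real p / r' * t \<le> real p * real N / r' + 2 * real p * real p" by simp
  moreover have "real p \<ge> 2" using p(1) prime_ge_2_nat[of p] by auto
  hence "2 * real p \<le> real p * real p" by (intro mult_right_mono) auto
  moreover have "real N \<ge> 0" by simp
  ultimately show ?thesis unfolding eq using t by (simp add: r'_def mult.assoc)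
qed

text \<open>Duality: the test functions are almost orthogonal, so a Bessel inequality holds.\<close>
lemma shift_weight_bessel:
  fixes F :: "nat \<Rightarrow> real"
  assumes R: "finite R" "R \<noteq> {}" and P: "finite P" "\<And>p. p \<in> P \<Longrightarrow> prime p \<and> p \<le> z"
    "\<And>p h. p \<in> P \<Longrightarrow> h \<in> R \<Longrightarrow> h < p" and z: "z \<le> N"
  shows "(\<Sum>p\<in>P. 1 / real p * (\<Sum>n=1..N. F n * shift_weight R N p n)\<^sup>2)
     \<le> (real N / real (card R) + 4 * (real z)\<^sup>2) * (\<Sum>n=1..N. (F n)\<^sup>2)"
proof -
  define c where "c = (\<lambda>p. \<Sum>n=1..N. F n * shift_weight R N p n)"
  define T where "T = (\<Sum>p\<in>P. 1 / real p * (c p)\<^sup>2)"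
  define G where "G = (\<lambda>n. \<Sum>p\<in>P. c p / real p * shift_weight R N p n)"
  have p0: "p > 0" if "p \<in> P" for p using P(2)[OF that] by (auto simp: prime_gt_0_nat)
  have T0: "T \<ge> 0" by (auto simp: T_def sum_nonneg)
  have "T = (\<Sum>p\<in>P. \<Sum>n=1..N. F n * (c p / real p * shift_weight R N p n))"
    unfolding T_def
  proof (rule sum.cong[OF refl])
    fix p
    have "(\<Sum>n=1..N. F n * shift_weight R N p n) = c p" by (simp add: c_def)
    hence "1 / real p * (c p)\<^sup>2 = c p / real p * (\<Sum>n=1..N. F n * shift_weight R N p n)"
      by (simp only: power2_eq_square) simp
    thus "1 / real p * (c p)\<^sup>2 = (\<Sum>n=1..N. F n * (c p / real p * shift_weight R N p n))"
      by (simp add: sum_distrib_left mult_ac)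
  qed
  also have "\<dots> = (\<Sum>n=1..N. F n * G n)"
    by (subst sum.swap) (simp add: G_def sum_distrib_left)
  finally have TG: "T\<^sup>2 \<le> (\<Sum>n=1..N. (F n)\<^sup>2) * (\<Sum>n=1..N. (G n)\<^sup>2)"
    by (metis Cauchy_Schwarz_ineq_sum)
  have "(\<Sum>n=1..N. (G n)\<^sup>2) = (\<Sum>n=1..N. \<Sum>p\<in>P. \<Sum>q\<in>P. (c p / real p) * (c q / real q) * (shift_weight R N p n * shift_weight R N q n))"
    by (simp add: G_def power2_eq_square sum_product mult_ac)
  also have "\<dots> = (\<Sum>p\<in>P. \<Sum>q\<in>P. \<Sum>n=1..N. (c p / real p) * (c q / real q) * (shift_weight R N p n * shift_weight R N q n))"
    by (subst sum.swap, rule sum.cong[OF refl], rule sum.swap)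
  also have "\<dots> = (\<Sum>p\<in>P. \<Sum>q\<in>P. (c p / real p) * (c q / real q) * (\<Sum>n=1..N. shift_weight R N p n * shift_weight R N q n))"
    by (simp only: sum_distrib_left)
  \<comment> \<open>The correlation error 4 p q cancels the weights 1 / p and 1 / q exactly. What
    remains off the diagonal is the rank one form 4 |c p| |c q|, whose sum Cauchy--Schwarz bounds by
    4 T z^2.\<close>
  also have "\<dots> \<le> (\<Sum>p\<in>P. \<Sum>q\<in>P. (if q = p then real N / real (card R) * (1 / real p * (c p)\<^sup>2) else 0) + 4 * (\<bar>c p\<bar> * \<bar>c q\<bar>))"
  proof (intro sum_mono)
    fix p q assume pq: "p \<in> P" "q \<in> P"
    note p0' = p0[OF pq(1)] p0[OF pq(2)]
    show "(c p / real p) * (c q / real q) * (\<Sum>n=1..N. shift_weight R N p n * shift_weight R N q n) \<le>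
        (if q = p then real N / real (card R) * (1 / real p * (c p)\<^sup>2) else 0) + 4 * (\<bar>c p\<bar> * \<bar>c q\<bar>)"
    proof (cases "q = p")
      case True
      have "(\<Sum>n=1..N. (shift_weight R N p n)\<^sup>2) \<le> real p * real N / real (card R) + 4 * real p * real p"
        using P(2,3) pq z by (intro shift_weight_square R) (auto intro: order_trans)
      hence "(c p / real p)\<^sup>2 * (\<Sum>n=1..N. (shift_weight R N p n)\<^sup>2) \<le> (c p / real p)\<^sup>2 * (real p * real N / real (card R) + 4 * real p * real p)"
        by (intro mult_left_mono) auto
      also have "\<dots> = real N / real (card R) * (1 / real p * (c p)\<^sup>2) + 4 * (c p)\<^sup>2"
      proof -
        have "(x / y)\<^sup>2 * (y * a / b) = a / b * (1 / y * x\<^sup>2)" "(x / y)\<^sup>2 * (4 * y * y) = 4 * x\<^sup>2"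
          if "y > 0" for x y a b :: real
          using that by (simp_all add: power2_eq_square divide_simps)
        thus ?thesis using p0' by (simp only: distrib_left of_nat_0_less_iff)
      qed
      finally show ?thesis using True by (simp add: power2_eq_square)
    next
      case False
      have "(c p / real p) * (c q / real q) * (\<Sum>n=1..N. shift_weight R N p n * shift_weight R N q n)
         \<le> \<bar>(c p / real p) * (c q / real q)\<bar> * \<bar>\<Sum>n=1..N. shift_weight R N p n * shift_weight R N q n\<bar>"
        by (metis abs_ge_self abs_mult)
      also have "\<dots> \<le> \<bar>(c p / real p) * (c q / real q)\<bar> * (4 * real p * real q)"
        using P(2,3) pq z False by (intro mult_left_mono shift_weight_corr R) (auto intro: order_trans)
      also have "\<dots> = 4 * (\<bar>c p\<bar> * \<bar>c q\<bar>)" using p0' by (simp add: abs_mult)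
      finally show ?thesis using False by simp
    qed
  qed
  also have "\<dots> = real N / real (card R) * T + 4 * (\<Sum>p\<in>P. \<bar>c p\<bar>)\<^sup>2"
  proof -
    have "(\<Sum>p\<in>P. \<Sum>q\<in>P. if q = p then real N / real (card R) * (1 / real p * (c p)\<^sup>2) else 0) =
        (\<Sum>p\<in>P. real N / real (card R) * (1 / real p * (c p)\<^sup>2))"
      using P(1) by (intro sum.cong refl) (simp add: sum.delta)
    also have "\<dots> = real N / real (card R) * T" by (simp only: T_def sum_distrib_left)
    finally have "(\<Sum>p\<in>P. \<Sum>q\<in>P. if q = p then real N / real (card R) * (1 / real p * (c p)\<^sup>2) else 0) =
        real N / real (card R) * T" .
    moreover have "(\<Sum>p\<in>P. \<Sum>q\<in>P. 4 * (\<bar>c p\<bar> * \<bar>c q\<bar>)) = 4 * (\<Sum>p\<in>P. \<bar>c p\<bar>)\<^sup>2"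
      unfolding power2_eq_square sum_product by (simp only: sum_distrib_left)
    ultimately show ?thesis by (simp only: sum.distrib)
  qed
  also have "(\<Sum>p\<in>P. \<bar>c p\<bar>)\<^sup>2 \<le> T * (real z)\<^sup>2"
  proof -
    have "(\<Sum>p\<in>P. \<bar>c p\<bar>)\<^sup>2 \<le> T * (\<Sum>p\<in>P. real p)"
      using Cauchy_Schwarz_abs[of P c] p0 by (simp add: T_def)
    also have "(\<Sum>p\<in>P. real p) \<le> (\<Sum>p\<in>P. real z)" using P(2) by (intro sum_mono) auto
    also have "\<dots> = real (card P) * real z" by simp
    also have "\<dots> \<le> real z * real z"
    proof -
      have "card P \<le> card {1..z}" using P(2) p0 by (intro card_mono) (auto simp: Suc_le_eq)
      thus ?thesis by (intro mult_right_mono) auto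
    qed
    finally show ?thesis using T0 by (simp add: power2_eq_square mult_left_mono)
  qed
  finally have G2: "(\<Sum>n=1..N. (G n)\<^sup>2) \<le> T * (real N / real (card R) + 4 * (real z)\<^sup>2)"
    by (simp add: algebra_simps)
  have "T * T \<le> T * ((real N / real (card R) + 4 * (real z)\<^sup>2) * (\<Sum>n=1..N. (F n)\<^sup>2))"
    using order_trans[OF TG mult_left_mono[OF G2]] by (simp add: power2_eq_square sum_nonneg mult_ac)
  hence "T \<le> (real N / real (card R) + 4 * (real z)\<^sup>2) * (\<Sum>n=1..N. (F n)\<^sup>2)"
  proof (cases "T = 0")
    case True
    thus ?thesis by (auto intro!: mult_nonneg_nonneg sum_nonneg add_nonneg_nonneg)
  next
    case False
    hence "T > 0" using T0 by simp
    thus ?thesis using \<open>T * T \<le> _\<close> by (metis mult_le_cancel_left_pos)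
  qed
  thus ?thesis by (simp add: T_def c_def)
qed

lemma sum_multiples:
  fixes G :: "nat \<Rightarrow> real"
  assumes "d > 0"
  shows "(\<Sum>n=1..N. if d dvd n then G n else 0) = (\<Sum>m=1..N div d. G (d * m))"
proof -
  have "(\<Sum>n=1..N. if d dvd n then G n else 0) = (\<Sum>n\<in>{n\<in>{1..N}. d dvd n}. G n)"
    by (rule sum.inter_filter[symmetric]) auto
  also have "\<dots> = (\<Sum>m=1..N div d. G (d * m))"
  proof (rule sum.reindex_bij_witness[of _ "\<lambda>m. d * m" "\<lambda>n. n div d"])
    fix n assume "n \<in> {n\<in>{1..N}. d dvd n}"
    then obtain m where m: "n = d * m" "1 \<le> n" "n \<le> N" by (auto elim: dvdE)
    thus "d * (n div d) = n" "G (d * (n div d)) = G n" using assms by auto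
    have "m \<ge> 1" using m by (cases m) auto
    moreover have "m \<le> N div d" using m assms by (simp add: less_eq_div_iff_mult_less_eq mult.commute)
    ultimately show "n div d \<in> {1..N div d}" using m assms by simp
  next
    fix m assume "m \<in> {1..N div d}"
    thus "d * m div d = m" "d * m \<in> {n\<in>{1..N}. d dvd n}"
      using assms by (auto simp: less_eq_div_iff_mult_less_eq mult.commute Suc_le_eq)
  qed
  finally show ?thesis .
qed

lemma sum_shifted_multiples:
  fixes G :: "nat \<Rightarrow> real"
  assumes "h < p"
  shows "(\<Sum>n=1..N. if p dvd n + h \<and> n + h \<le> N then G n else 0) = (\<Sum>n=1..N. if p dvd n then G (n - h) else 0)"
proof -
  have "(\<Sum>n=1..N. if p dvd n + h \<and> n + h \<le> N then G n else 0) = (\<Sum>n\<in>{n\<in>{1..N}. p dvd n + h \<and> n + h \<le> N}. G n)"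
    by (rule sum.inter_filter[symmetric]) auto
  also have "\<dots> = (\<Sum>n\<in>{n\<in>{1..N}. p dvd n}. G (n - h))"
  proof (rule sum.reindex_bij_witness[of _ "\<lambda>n. n - h" "\<lambda>n. n + h"])
    fix n assume n: "n \<in> {n\<in>{1..N}. p dvd n}"
    hence "p \<le> n" by (auto intro: dvd_imp_le)
    hence "h < n" using assms by simp
    thus "n - h + h = n" "n - h \<in> {n\<in>{1..N}. p dvd n + h \<and> n + h \<le> N}" using n by auto
  qed auto
  also have "\<dots> = (\<Sum>n=1..N. if p dvd n then G (n - h) else 0)"
    by (rule sum.inter_filter) auto
  finally show ?thesis .
qed

lemma square_sum4_le: "(a + b + c + d)\<^sup>2 \<le> 4 * (a\<^sup>2 + b\<^sup>2 + c\<^sup>2 + d\<^sup>2)" for a b c d :: real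
proof -
  have 1: "(a + b + (c + d))\<^sup>2 \<le> 2 * (a + b)\<^sup>2 + 2 * (c + d)\<^sup>2"
    and 2: "(a + b)\<^sup>2 \<le> 2 * a\<^sup>2 + 2 * b\<^sup>2" and 3: "(c + d)\<^sup>2 \<le> 2 * c\<^sup>2 + 2 * d\<^sup>2"
    by (rule square_plus_le)+
  have "(a + b + (c + d))\<^sup>2 \<le> 2 * (2 * a\<^sup>2 + 2 * b\<^sup>2) + 2 * (2 * c\<^sup>2 + 2 * d\<^sup>2)"
    by (rule order_trans[OF 1 add_mono[OF mult_left_mono[OF 2] mult_left_mono[OF 3]]]) auto
  thus ?thesis by (simp add: add.assoc)
qed

text \<open>The deviation of G from its mean over the H preceding arguments. By truncated
  subtraction, arguments below 1 are read as \<open>G 0\<close>.\<close>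

definition backward_defect :: "nat \<Rightarrow> (nat \<Rightarrow> real) \<Rightarrow> nat \<Rightarrow> real" where
  "backward_defect H G n = G n - (\<Sum>h=1..H. G (n - h)) / real H"

text \<open>Averages over multiples of p are compared with averages over the union of H residue
  classes modulo p; the Bessel inequality for the latter gains a factor H.\<close>
lemma sum_multiples_bessel:
  fixes G :: "nat \<Rightarrow> real"
  assumes H: "H \<ge> 1" and z: "z \<le> N"
  defines "F \<equiv> backward_defect H G"
  defines "P \<equiv> {p. prime p \<and> H < p \<and> p \<le> z}"
  shows "(\<Sum>p\<in>P. 1 / real p * (real p * (\<Sum>n=1..N. if p dvd n then G n else 0))\<^sup>2) \<le>
    4 * ((real N + 4 * (real z)\<^sup>2) * (\<Sum>n=1..N. (F n)\<^sup>2) + (real N / real H + 4 * (real z)\<^sup>2) * (\<Sum>n=1..N. (G n)\<^sup>2)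
       + (\<Sum>p\<in>primes_le N. 1 / real p) * ((\<Sum>n=1..N. F n)\<^sup>2 + (\<Sum>n=1..N. G n)\<^sup>2))"
proof -
  have fin: "finite P" by (rule finite_subset[of _ "{..z}"]) (auto simp: P_def)
  define X where "X = (\<lambda>p. \<Sum>n=1..N. F n * shift_weight {0} N p n)"
  define Y where "Y = (\<lambda>p. \<Sum>n=1..N. G n * shift_weight {1..H} N p n)"
  define SF where "SF = (\<Sum>n=1..N. F n)"
  define SG where "SG = (\<Sum>n=1..N. G n)"
  \<comment> \<open>On multiples of p, G is its backward defect F plus an average of shifts of G.
    Each of the two sums equals its expected value, SF or SG, plus a sum against a shift weight: X
    with R = {0} for F, and Y with R = {1..H} for G. The condition p > H keeps the shifts below
    p.\<close>
  have eq: "real p * (\<Sum>n=1..N. if p dvd n then G n else 0) = X p + Y p + SF + SG" if p: "p \<in> P" for p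
  proof -
    have X: "X p + SF = real p * (\<Sum>n=1..N. if p dvd n then F n else 0)"
      unfolding X_def SF_def by (subst sum_mult_shift_weight) (auto intro!: disjI2 sum.cong)
    have Y: "Y p + SG = real p / real H * (\<Sum>h=1..H. \<Sum>n=1..N. if p dvd n then G (n - h) else 0)"
    proof -
      have "Y p + SG = real p / real H * (\<Sum>h\<in>{1..H}. \<Sum>n=1..N. if p dvd n + h \<and> n + h \<le> N then G n else 0)"
        unfolding Y_def SG_def by (subst sum_mult_shift_weight) auto
      also have "(\<Sum>h\<in>{1..H}. \<Sum>n=1..N. if p dvd n + h \<and> n + h \<le> N then G n else 0) = (\<Sum>h=1..H. \<Sum>n=1..N. if p dvd n then G (n - h) else 0)"
        using p by (intro sum.cong refl sum_shifted_multiples) (auto simp: P_def)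
      finally show ?thesis .
    qed
    have "(\<Sum>n=1..N. if p dvd n then F n else 0) = (\<Sum>n=1..N. (if p dvd n then G n else 0) - (\<Sum>h=1..H. if p dvd n then G (n - h) else 0) / real H)"
      by (intro sum.cong) (auto simp: F_def backward_defect_def)
    also have "\<dots> = (\<Sum>n=1..N. if p dvd n then G n else 0) - (\<Sum>n=1..N. \<Sum>h=1..H. if p dvd n then G (n - h) else 0) / real H"
      by (simp only: sum_subtractf sum_divide_distrib)
    also have "(\<Sum>n=1..N. \<Sum>h=1..H. if p dvd n then G (n - h) else 0) = (\<Sum>h=1..H. \<Sum>n=1..N. if p dvd n then G (n - h) else 0)"
      by (rule sum.swap)
    finally have "real p * (\<Sum>n=1..N. if p dvd n then F n else 0) = real p * (\<Sum>n=1..N. if p dvd n then G n else 0) - (Y p + SG)"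
      unfolding Y by (simp only: right_diff_distrib) simp
    thus ?thesis using X by linarith
  qed
  have "(\<Sum>p\<in>P. 1 / real p * (real p * (\<Sum>n=1..N. if p dvd n then G n else 0))\<^sup>2) \<le>
     (\<Sum>p\<in>P. 4 * (1 / real p * (X p)\<^sup>2 + 1 / real p * (Y p)\<^sup>2 + 1 / real p * (SF\<^sup>2 + SG\<^sup>2)))"
  proof (rule sum_mono)
    fix p assume p: "p \<in> P"
    have "1 / real p * (X p + Y p + SF + SG)\<^sup>2 \<le> 1 / real p * (4 * ((X p)\<^sup>2 + (Y p)\<^sup>2 + SF\<^sup>2 + SG\<^sup>2))"
      by (intro mult_left_mono square_sum4_le) auto
    also have "\<dots> = 4 * (1 / real p * (X p)\<^sup>2 + 1 / real p * (Y p)\<^sup>2 + 1 / real p * (SF\<^sup>2 + SG\<^sup>2))"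
      by (simp add: algebra_simps add_divide_distrib)
    finally show "1 / real p * (real p * (\<Sum>n=1..N. if p dvd n then G n else 0))\<^sup>2 \<le> \<dots>"
      by (simp only: eq[OF p])
  qed
  also have "\<dots> = 4 * ((\<Sum>p\<in>P. 1 / real p * (X p)\<^sup>2) + (\<Sum>p\<in>P. 1 / real p * (Y p)\<^sup>2) + (\<Sum>p\<in>P. 1 / real p) * (SF\<^sup>2 + SG\<^sup>2))"
    by (simp only: sum_distrib_left[symmetric] sum.distrib sum_distrib_right[symmetric])
  also have "\<dots> \<le> 4 * ((real N + 4 * (real z)\<^sup>2) * (\<Sum>n=1..N. (F n)\<^sup>2) + (real N / real H + 4 * (real z)\<^sup>2) * (\<Sum>n=1..N. (G n)\<^sup>2)
       + (\<Sum>p\<in>primes_le N. 1 / real p) * (SF\<^sup>2 + SG\<^sup>2))"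
  proof (intro mult_left_mono add_mono)
    show "(\<Sum>p\<in>P. 1 / real p * (X p)\<^sup>2) \<le> (real N + 4 * (real z)\<^sup>2) * (\<Sum>n=1..N. (F n)\<^sup>2)"
    proof -
      have "(\<Sum>p\<in>P. 1 / real p * (X p)\<^sup>2) \<le> (real N / real (card {0::nat}) + 4 * (real z)\<^sup>2) * (\<Sum>n=1..N. (F n)\<^sup>2)"
        unfolding X_def by (rule shift_weight_bessel) (use fin z in \<open>auto simp: P_def prime_gt_0_nat\<close>)
      thus ?thesis by simp
    qed
    have "(\<Sum>p\<in>P. 1 / real p * (Y p)\<^sup>2) \<le> (real N / real (card {1..H}) + 4 * (real z)\<^sup>2) * (\<Sum>n=1..N. (G n)\<^sup>2)"
      unfolding Y_def by (rule shift_weight_bessel) (use fin z H in \<open>auto simp: P_def\<close>)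
    thus "(\<Sum>p\<in>P. 1 / real p * (Y p)\<^sup>2) \<le> (real N / real H + 4 * (real z)\<^sup>2) * (\<Sum>n=1..N. (G n)\<^sup>2)" by simp
    show "(\<Sum>p\<in>P. 1 / real p) * (SF\<^sup>2 + SG\<^sup>2) \<le> (\<Sum>p\<in>primes_le N. 1 / real p) * (SF\<^sup>2 + SG\<^sup>2)"
      using z by (intro mult_right_mono sum_mono2) (auto simp: P_def)
  qed auto
  finally show ?thesis by (simp only: SF_def SG_def)
qed

section \<open>The deviation from a short average, in mean square and in total\<close>

lemma backward_defect_altdef:
  assumes "H \<ge> 1"
  shows "backward_defect H G n = (\<Sum>h=1..H. G n - G (n - h)) / real H"
  using assms by (simp add: backward_defect_def sum_subtractf diff_divide_distrib)

lemma diff_telescope: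
  fixes v :: "nat \<Rightarrow> real"
  shows "v n - v (n - h) = (\<Sum>i<h. v (n - i) - v (n - i - 1))"
  by (induction h) auto

text \<open>Telescoping and two applications of Cauchy--Schwarz, each costing a factor H that the
  normalisation partly returns. The increment at index 0 is zero because 0 - 1 = 0, so shifted sums
  do not exceed unshifted ones.\<close>

lemma sum_square_backward_defect:
  assumes H: "H \<ge> 1"
  shows "(\<Sum>n=1..N. (backward_defect H v n)\<^sup>2) \<le> (real H)\<^sup>2 * (\<Sum>n=1..N. (v n - v (n - 1))\<^sup>2)"
proof -
  define d where "d = (\<lambda>n. (v n - v (n - 1))\<^sup>2)"
  have "(\<Sum>n=1..N. (backward_defect H v n)\<^sup>2) \<le> (\<Sum>n=1..N. (1 / real H) * (\<Sum>h=1..H. real H * (\<Sum>i<H. d (n - i))))"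
  proof (rule sum_mono)
    fix n
    have "(\<Sum>h=1..H. v n - v (n - h))\<^sup>2 \<le> (\<Sum>h=1..H. (v n - v (n - h))\<^sup>2) * real (card {1..H})"
      by (rule sum_squared_le_sum_of_squares)
    also have "(\<Sum>h=1..H. (v n - v (n - h))\<^sup>2) \<le> (\<Sum>h=1..H. real H * (\<Sum>i<H. d (n - i)))"
    proof (rule sum_mono)
      fix h assume h: "h \<in> {1..H}"
      have "(v n - v (n - h))\<^sup>2 \<le> (\<Sum>i<h. d (n - i)) * real (card {..<h})"
        unfolding diff_telescope[of v n h] d_def by (rule sum_squared_le_sum_of_squares)
      also have "\<dots> \<le> (\<Sum>i<H. d (n - i)) * real H"
        using h by (intro mult_mono sum_mono2 sum_nonneg) (auto simp: d_def)
      finally show "(v n - v (n - h))\<^sup>2 \<le> real H * (\<Sum>i<H. d (n - i))" by (simp add: mult.commute)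
    qed
    finally have "(\<Sum>h=1..H. v n - v (n - h))\<^sup>2 \<le> (\<Sum>h=1..H. real H * (\<Sum>i<H. d (n - i))) * real H"
      by (simp add: mult_right_mono)
    thus "(backward_defect H v n)\<^sup>2 \<le> (1 / real H) * (\<Sum>h=1..H. real H * (\<Sum>i<H. d (n - i)))"
      using H by (simp add: backward_defect_altdef[OF H] power_divide power2_eq_square field_simps)
  qed
  also have "\<dots> = real H * (\<Sum>n=1..N. \<Sum>i<H. d (n - i))"
    using H by (simp add: sum_distrib_left)
  also have "(\<Sum>n=1..N. \<Sum>i<H. d (n - i)) = (\<Sum>i<H. \<Sum>n=1..N. d (n - i))" by (rule sum.swap)
  also have "\<dots> \<le> (\<Sum>i<H. \<Sum>n=1..N. d n)"
    by (intro sum_mono sum_shift_le) (auto simp: d_def)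
  finally show ?thesis by (simp add: d_def power2_eq_square mult_left_mono mult.assoc)
qed

text \<open>For each shift h the total of v n - v (n - h) collapses to the last h values of v, so
  only a boundary block of at most H terms matters. Cauchy--Schwarz on that block, centred at c,
  gives a bound without a factor N.\<close>

lemma sum_backward_defect_square:
  fixes v :: "nat \<Rightarrow> real"
  assumes H: "H \<ge> 1" "H \<le> N" and v0: "v 0 = 0"
  shows "(\<Sum>n=1..N. backward_defect H v n)\<^sup>2 \<le> 2 * real H * (\<Sum>n=1..N. (v n - c)\<^sup>2) + 2 * (real H)\<^sup>2 * c\<^sup>2"
proof -
  define b where "b = 2 * real H * (\<Sum>n=1..N. (v n - c)\<^sup>2) + 2 * (real H)\<^sup>2 * c\<^sup>2"
  define t where "t = (\<lambda>h. \<Sum>n=1..N. v n - v (n - h))"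
  have t: "(t h)\<^sup>2 \<le> b" if h: "h \<in> {1..H}" for h
  proof -
    have hN: "h \<le> N" using h H by auto
    have "(\<Sum>n=1..N. v (n - h)) = (\<Sum>n=h+1..N. v (n - h))"
      by (intro sum.mono_neutral_right) (auto simp: v0 not_le)
    also have "\<dots> = (\<Sum>n=1..N-h. v n)"
      by (rule sum.reindex_bij_witness[of _ "\<lambda>n. n + h" "\<lambda>n. n - h"]) auto
    finally have "t h = (\<Sum>n=1..N. v n) - (\<Sum>n=1..N-h. v n)" by (simp add: t_def sum_subtractf)
    also have "{1..N} = {1..N-h} \<union> {N-h+1..N}" using hN by auto
    hence "(\<Sum>n=1..N. v n) = (\<Sum>n=1..N-h. v n) + (\<Sum>n=N-h+1..N. v n)"
      by (simp only:) (subst sum.union_disjoint, auto)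
    finally have "t h = (\<Sum>n=N-h+1..N. (v n - c) + c)" by simp
    hence "(t h)\<^sup>2 \<le> (\<Sum>n=N-h+1..N. ((v n - c) + c)\<^sup>2) * real (card {N-h+1..N})"
      using sum_squared_le_sum_of_squares[of "\<lambda>n. (v n - c) + c" "{N-h+1..N}"] by simp
    also have "real (card {N-h+1..N}) = real h" using hN by simp
    also have "(\<Sum>n=N-h+1..N. ((v n - c) + c)\<^sup>2) \<le> (\<Sum>n=N-h+1..N. 2 * (v n - c)\<^sup>2 + 2 * c\<^sup>2)"
    proof (rule sum_mono)
      fix n show "((v n - c) + c)\<^sup>2 \<le> 2 * (v n - c)\<^sup>2 + 2 * c\<^sup>2" by (rule square_plus_le)
    qed
    also have "\<dots> = 2 * (\<Sum>n=N-h+1..N. (v n - c)\<^sup>2) + 2 * real h * c\<^sup>2"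
      using hN by (simp add: sum.distrib sum_distrib_left)
    also have "(\<Sum>n=N-h+1..N. (v n - c)\<^sup>2) \<le> (\<Sum>n=1..N. (v n - c)\<^sup>2)" by (intro sum_mono2) auto
    finally have "(t h)\<^sup>2 \<le> (2 * (\<Sum>n=1..N. (v n - c)\<^sup>2) + 2 * real h * c\<^sup>2) * real h"
      by (simp add: mult_right_mono)
    also have "\<dots> \<le> (2 * (\<Sum>n=1..N. (v n - c)\<^sup>2) + 2 * real H * c\<^sup>2) * real H"
      using h by (intro mult_mono add_mono mult_left_mono add_nonneg_nonneg mult_nonneg_nonneg sum_nonneg) auto
    also have "\<dots> = b" by (simp add: b_def algebra_simps power2_eq_square)
    finally show ?thesis .
  qed
  have "(\<Sum>n=1..N. backward_defect H v n) = (\<Sum>h=1..H. t h) / real H"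
    unfolding t_def by (subst sum.swap) (simp add: backward_defect_altdef[OF H(1)] sum_divide_distrib)
  hence "(\<Sum>n=1..N. backward_defect H v n)\<^sup>2 = (\<Sum>h=1..H. t h)\<^sup>2 / (real H)\<^sup>2" by (simp add: power_divide)
  also have "\<dots> \<le> ((\<Sum>h=1..H. (t h)\<^sup>2) * real (card {1..H})) / (real H)\<^sup>2"
    by (intro divide_right_mono sum_squared_le_sum_of_squares) auto
  also have "\<dots> \<le> ((\<Sum>h=1..H. b) * real (card {1..H})) / (real H)\<^sup>2"
    by (intro divide_right_mono mult_right_mono sum_mono t) auto
  also have "\<dots> = b" using H by (simp add: power2_eq_square)
  finally show ?thesis by (simp add: b_def)
qed

lemma backward_defect_shift: "H \<ge> 1 \<Longrightarrow> backward_defect H (\<lambda>n. v n - c) = backward_defect H v"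
  by (rule ext) (simp add: backward_defect_altdef)

section \<open>Variation of the prime mean and averages over multiples of a prime\<close>

text \<open>Cauchy--Schwarz over the primes between M and N. Up to the additive 5, it expresses
  continuity of order 1/2 of the prime mean in the logarithmic variable, and later comparisons of
  its values at nearby arguments rest on it.\<close>

lemma pmean_diff_square:
  assumes "2 \<le> M" "M \<le> N"
  shows "(pmean g N - pmean g M)\<^sup>2 \<le> (B_add g (real N))\<^sup>2 * ((ln (real N) - ln (real M) + 5) / ln (real M))"
proof -
  define I where "I = {p. prime p \<and> M < p \<and> p \<le> N}"
  have I: "finite I" "I \<subseteq> primes_le N" by (auto simp: I_def intro: finite_subset[of _ "{..N}"])
  have "primes_le N = primes_le M \<union> I" using assms by (auto simp: I_def)
  moreover have "primes_le M \<inter> I = {}" by (auto simp: I_def)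
  ultimately have "pmean g N - pmean g M = (\<Sum>p\<in>I. g p / real p)"
    unfolding pmean_def using I by (simp add: sum.union_disjoint)
  hence "(pmean g N - pmean g M)\<^sup>2 \<le> (\<Sum>p\<in>I. (g p)\<^sup>2 / real p) * (\<Sum>p\<in>I. 1 / real p)"
    by (simp only: Cauchy_Schwarz_recip)
  also have "\<dots> \<le> (B_add g (real N))\<^sup>2 * ((ln (real N) - ln (real M) + 5) / ln (real M))"
  proof (intro mult_mono)
    have "(\<Sum>p\<in>I. (g p)\<^sup>2 / real p) \<le> (\<Sum>p\<in>primes_le N. (g p)\<^sup>2 / real p)" using I by (intro sum_mono2) auto
    thus "(\<Sum>p\<in>I. (g p)\<^sup>2 / real p) \<le> (B_add g (real N))\<^sup>2" using sum_primes_le_B_add[of g N] by linarith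
    show "(\<Sum>p\<in>I. 1 / real p) \<le> (ln (real N) - ln (real M) + 5) / ln (real M)"
      unfolding I_def by (rule sum_prime_recip_interval_le[OF assms])
  qed (auto intro!: sum_nonneg)
  finally show ?thesis .
qed

text \<open>The logarithm saved by Chebyshev's bound matters: the result is later summed over primes
  with weight 1 / p, which costs ln ln N.\<close>

lemma sum_abs_primes_square:
  assumes "M \<ge> 2"
  shows "(\<Sum>p\<in>primes_le M. \<bar>g p\<bar>)\<^sup>2 \<le> (B_add g (real M))\<^sup>2 * (10 * (real M)\<^sup>2 / ln (real M))"
proof -
  have "(\<Sum>p\<in>primes_le M. \<bar>g p\<bar>)\<^sup>2 \<le> (\<Sum>p\<in>primes_le M. (g p)\<^sup>2 / real p) * (\<Sum>p\<in>primes_le M. real p)"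
    by (rule Cauchy_Schwarz_abs) (auto simp: prime_gt_0_nat)
  also have "\<dots> \<le> (B_add g (real M))\<^sup>2 * (10 * (real M)\<^sup>2 / ln (real M))"
  proof (intro mult_mono sum_primes_le_B_add)
    have "(\<Sum>p\<in>primes_le M. real p) \<le> (\<Sum>p\<in>primes_le M. real M)" by (intro sum_mono) auto
    also have "\<dots> = real (card (primes_le M)) * real M" by simp
    also have "\<dots> \<le> (10 * real M / ln (real M)) * real M" by (intro mult_right_mono card_primes_le assms) auto
    finally show "(\<Sum>p\<in>primes_le M. real p) \<le> 10 * (real M)\<^sup>2 / ln (real M)" by (simp add: power2_eq_square mult.assoc)
  qed (auto intro!: sum_nonneg)
  finally show ?thesis .
qed

lemma sum_sadd_approx: "\<bar>(\<Sum>n=1..M. sadd g n) - real M * pmean g M\<bar> \<le> (\<Sum>p\<in>primes_le M. \<bar>g p\<bar>)"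
proof -
  have "(\<Sum>n=1..M. sadd g n) - real M * pmean g M = (\<Sum>p\<in>primes_le M. g p * (real (M div p) - real M / real p))"
    unfolding sum_sadd pmean_def by (simp add: sum_distrib_left sum_subtractf algebra_simps)
  also have "\<bar>\<dots>\<bar> \<le> (\<Sum>p\<in>primes_le M. \<bar>g p * (real (M div p) - real M / real p)\<bar>)" by (rule sum_abs)
  also have "\<dots> \<le> (\<Sum>p\<in>primes_le M. \<bar>g p\<bar> * 1)"
    unfolding abs_mult
  proof (intro sum_mono mult_left_mono)
    fix p
    show "\<bar>real (M div p) - real M / real p\<bar> \<le> 1"
      using floor_divide_of_nat_eq[of M p, where ?'a = real] by linarith
  qed auto
  finally show ?thesis by simp
qed

text \<open>Since sadd g (p m) = g p + sadd g m for most m, the average over the multiples of p is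
  governed by g p and the mean up to N div p.\<close>
lemma multiples_average:
  assumes p: "prime p" and M: "M = N div p"
  shows "\<bar>real p * real M * (g p + pmean g M - pmean g N) -
      real p * (\<Sum>n=1..N. if p dvd n then sadd g n - pmean g N else 0)\<bar>
     \<le> real M * \<bar>g p\<bar> + real p * (\<Sum>q\<in>primes_le M. \<bar>g q\<bar>)"
proof -
  define A where "A = pmean g N"
  have p0: "p > 0" using p by (simp add: prime_gt_0_nat)
  have "(\<Sum>n=1..N. if p dvd n then sadd g n - A else 0) = (\<Sum>m=1..M. sadd g (p * m) - A)"
    unfolding M by (rule sum_multiples[OF p0])
  also have "\<dots> = (\<Sum>m=1..M. sadd g m + g p - (if p dvd m then g p else 0) - A)"
    by (intro sum.cong refl) (auto simp: sadd_prime_mult[OF p])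
  also have "\<dots> = (\<Sum>m=1..M. sadd g m) + real M * g p - (\<Sum>m=1..M. if p dvd m then g p else 0) - real M * A"
    by (simp add: sum.distrib sum_subtractf)
  also have "(\<Sum>m=1..M. if p dvd m then g p else 0) = real (M div p) * g p"
    using sum_multiples[OF p0, of "\<lambda>_. g p" M] by simp
  finally have eq0: "(\<Sum>n=1..N. if p dvd n then sadd g n - A else 0) =
      (\<Sum>m=1..M. sadd g m) + real M * g p - real (M div p) * g p - real M * A" .
  have eq: "real p * real M * (g p + pmean g M - A) - real p * (\<Sum>n=1..N. if p dvd n then sadd g n - A else 0) =
      real p * real (M div p) * g p - real p * ((\<Sum>m=1..M. sadd g m) - real M * pmean g M)"
    unfolding eq0 by (simp add: algebra_simps)
  have "\<bar>real p * real (M div p) * g p\<bar> \<le> real M * \<bar>g p\<bar>"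
  proof -
    have "real p * real (M div p) \<le> real M" by (metis of_nat_le_iff of_nat_mult times_div_less_eq_dividend)
    thus ?thesis by (simp add: abs_mult mult_right_mono)
  qed
  moreover have "\<bar>real p * ((\<Sum>m=1..M. sadd g m) - real M * pmean g M)\<bar> \<le> real p * (\<Sum>q\<in>primes_le M. \<bar>g q\<bar>)"
    using sum_sadd_approx[of g M] by (simp add: abs_mult mult_left_mono)
  ultimately show ?thesis unfolding A_def[symmetric] eq by linarith
qed

section \<open>The approximate functional equation\<close>

lemma finite_cube_le: "finite {p::nat. prime p \<and> p ^ 3 \<le> N}"
proof (rule finite_subset)
  show "{p::nat. prime p \<and> p ^ 3 \<le> N} \<subseteq> {..N}"
  proof
    fix p :: nat assume "p \<in> {p. prime p \<and> p ^ 3 \<le> N}"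
    hence "prime p" "p ^ 3 \<le> N" by auto
    moreover have "p \<le> p ^ 3" using \<open>prime p\<close> by (intro self_le_power) (auto simp: Suc_le_eq prime_gt_0_nat)
    ultimately show "p \<in> {..N}" by simp
  qed
qed auto

text \<open>The hypothesis amounts to p^2 \<le> M. Hence M is at least the square root of N, and
  logarithms of M and N are comparable.\<close>

lemma cube_root_div_facts:
  fixes p N :: nat
  assumes p: "prime p" "p ^ 3 \<le> N" and M: "M = N div p"
  shows "4 \<le> M" "N \<le> M * M" "N \<le> 2 * M * p" "M * p \<le> N" "M \<le> N"
proof -
  have p2: "p \<ge> 2" using p prime_ge_2_nat by simp
  show Mp: "M * p \<le> N" by (simp add: M)
  show "M \<le> N" by (simp add: M)
  have "(p * p) * p \<le> N" using p by (simp add: power3_eq_cube)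
  hence pp: "p * p \<le> M" using p2 unfolding M by (subst less_eq_div_iff_mult_less_eq) auto
  have "2 * 2 \<le> p * p" using p2 by (intro mult_le_mono) auto
  thus M4: "4 \<le> M" using pp by linarith
  have N: "N < (M + 1) * p"
    unfolding M using p2 by (metis Suc_eq_plus1 dividend_less_div_times mult.commute mult_Suc_right add.commute not_gr0 not_numeral_le_zero)
  also have "(M + 1) * p \<le> 2 * M * p" using M4 by (intro mult_le_mono) auto
  finally show "N \<le> 2 * M * p" by simp
  also have "2 * M * p \<le> M * M"
  proof -
    have "2 * M * p \<le> p * M * p" using p2 by (intro mult_le_mono) auto
    also have "\<dots> = M * (p * p)" by (simp add: mult_ac)
    also have "\<dots> \<le> M * M" using pp by (intro mult_le_mono) auto
    finally show ?thesis .
  qed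
  finally show "N \<le> M * M" .
qed

lemma ln_half_le:
  fixes M N :: nat
  assumes "4 \<le> M" "N \<le> M * M" "M \<le> N"
  shows "ln (real N) \<le> 2 * ln (real M)" "ln (real M) > 0" "ln (real N) > 0"
proof -
  have "real N \<le> real (M * M)" using assms(2) by (simp only: of_nat_le_iff)
  moreover have "real N > 0" using assms by simp
  ultimately have "ln (real N) \<le> ln (real (M * M))" by (subst ln_le_cancel_iff) linarith+
  thus "ln (real N) \<le> 2 * ln (real M)" using assms by (simp add: ln_mult)
  show "ln (real M) > 0" "ln (real N) > 0" using assms by simp_all
qed

context almost_increasing
begin

text \<open>The error in the approximate functional equation that equates g p with the drop of the
  prime mean from N to N / p.\<close>

definition defect :: "nat \<Rightarrow> nat \<Rightarrow> real" where
  "defect N p = g p + pmean g (N div p) - pmean g N"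

definition defect_energy :: "nat \<Rightarrow> real" where
  "defect_energy N = (\<Sum>p | prime p \<and> p ^ 3 \<le> N. 1 / real p * (defect N p)\<^sup>2)"

text \<open>The identity for averages over multiples, divided by p M, which is N up to a factor 2.
  The constant 12 is 3 for squaring three terms times 4 for that factor; 20 is twice the Chebyshev
  constant 10, as ln M \<ge> ln N / 2.\<close>

lemma defect_square_le:
  assumes p: "prime p" "p ^ 3 \<le> N"
  defines "c \<equiv> real p * (\<Sum>n=1..N. if p dvd n then sadd g n - pmean g N else 0)"
  shows "(defect N p)\<^sup>2 \<le> 12 * (c\<^sup>2 / (real N)\<^sup>2 + (g p)\<^sup>2 / (real p)\<^sup>2 + 20 * (\<beta> N)\<^sup>2 / ln (real N))"
proof -
  define M where "M = N div p"
  note M = cube_root_div_facts[OF p M_def]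
  note l = ln_half_le[OF M(1,2,5)]
  define E where "E = (\<Sum>q\<in>primes_le M. \<bar>g q\<bar>)"
  define D where "D = defect N p"
  have p0: "p > 0" using p by (simp add: prime_gt_0_nat)
  have N0: "real N > 0" using M by simp
  have "\<bar>real p * real M * D - c\<bar> \<le> real M * \<bar>g p\<bar> + real p * E"
    using multiples_average[OF p(1) M_def, of g] by (simp only: c_def D_def defect_def E_def M_def[symmetric])
  hence "\<bar>real p * real M * D\<bar> \<le> \<bar>c\<bar> + (real M * \<bar>g p\<bar> + real p * E)" by linarith
  hence "\<bar>real p * real M * D\<bar>\<^sup>2 \<le> (\<bar>c\<bar> + (real M * \<bar>g p\<bar> + real p * E))\<^sup>2"
    by (intro power_mono) auto
  also have "\<dots> \<le> 3 * (c\<^sup>2 + (real M * \<bar>g p\<bar>)\<^sup>2 + (real p * E)\<^sup>2)"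
  proof -
    have "(x + (y + z))\<^sup>2 \<le> 3 * (x\<^sup>2 + y\<^sup>2 + z\<^sup>2)" for x y z :: real
    proof -
      have "0 \<le> (x - y)\<^sup>2 + (y - z)\<^sup>2 + (x - z)\<^sup>2" by simp
      thus ?thesis by (simp add: power2_eq_square algebra_simps)
    qed
    from this[of "\<bar>c\<bar>"] show ?thesis by simp
  qed
  finally have 1: "(real p * real M)\<^sup>2 * D\<^sup>2 \<le> 3 * (c\<^sup>2 + (real M * g p)\<^sup>2 + (real p * E)\<^sup>2)"
    by (simp add: power_mult_distrib)
  have pM: "real p * real M \<le> real N" "real N \<le> 2 * (real p * real M)"
  proof -
    have "real (M * p) \<le> real N" "real N \<le> real (2 * M * p)" using M(3,4) by (simp_all only: of_nat_le_iff)
    thus "real p * real M \<le> real N" "real N \<le> 2 * (real p * real M)" by (simp_all add: mult_ac)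
  qed
  have "(real N)\<^sup>2 * D\<^sup>2 \<le> (2 * (real p * real M))\<^sup>2 * D\<^sup>2"
    using pM by (intro mult_right_mono power_mono) auto
  also have "\<dots> = 4 * ((real p * real M)\<^sup>2 * D\<^sup>2)" by (simp add: power_mult_distrib)
  also have "\<dots> \<le> 12 * (c\<^sup>2 + (real M * g p)\<^sup>2 + (real p * E)\<^sup>2)" using 1 by simp
  finally have 2: "D\<^sup>2 \<le> 12 * (c\<^sup>2 + (real M * g p)\<^sup>2 + (real p * E)\<^sup>2) / (real N)\<^sup>2"
    using N0 by (simp add: field_simps)
  have 3: "(real M * g p)\<^sup>2 / (real N)\<^sup>2 \<le> (g p)\<^sup>2 / (real p)\<^sup>2"
  proof -
    have "(real p * real M)\<^sup>2 * (g p)\<^sup>2 \<le> (real N)\<^sup>2 * (g p)\<^sup>2"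
      using pM by (intro mult_right_mono power_mono) auto
    thus ?thesis using N0 p0 by (simp add: field_simps power_mult_distrib)
  qed
  have 4: "(real p * E)\<^sup>2 / (real N)\<^sup>2 \<le> 20 * (\<beta> N)\<^sup>2 / ln (real N)"
  proof -
    have "E\<^sup>2 \<le> (\<beta> M)\<^sup>2 * (10 * (real M)\<^sup>2 / ln (real M))"
      unfolding E_def using M by (intro sum_abs_primes_square) auto
    also have "\<dots> \<le> (\<beta> N)\<^sup>2 * (10 * (real M)\<^sup>2 / ln (real M))"
      using M l by (intro mult_right_mono power_mono B_add_mono B_add_nonneg) auto
    also have "10 * (real M)\<^sup>2 / ln (real M) \<le> 10 * (real M)\<^sup>2 / (ln (real N) / 2)"
      using l by (intro divide_left_mono) auto
    finally have "E\<^sup>2 \<le> (\<beta> N)\<^sup>2 * (20 * (real M)\<^sup>2 / ln (real N))" by (simp add: mult_left_mono)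
    hence "(real p)\<^sup>2 * E\<^sup>2 \<le> (real p)\<^sup>2 * ((\<beta> N)\<^sup>2 * (20 * (real M)\<^sup>2 / ln (real N)))"
      by (intro mult_left_mono) auto
    also have "\<dots> = (20 * (\<beta> N)\<^sup>2 / ln (real N)) * (real p * real M)\<^sup>2"
      by (simp add: power_mult_distrib)
    also have "\<dots> \<le> (20 * (\<beta> N)\<^sup>2 / ln (real N)) * (real N)\<^sup>2"
      using pM l by (intro mult_left_mono power_mono) auto
    finally show ?thesis using N0 by (simp add: power_mult_distrib divide_le_eq)
  qed
  have "D\<^sup>2 \<le> 12 * (c\<^sup>2 / (real N)\<^sup>2 + (real M * g p)\<^sup>2 / (real N)\<^sup>2 + (real p * E)\<^sup>2 / (real N)\<^sup>2)"
    using 2 by (simp add: add_divide_distrib)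
  also have "\<dots> \<le> 12 * (c\<^sup>2 / (real N)\<^sup>2 + (g p)\<^sup>2 / (real p)\<^sup>2 + 20 * (\<beta> N)\<^sup>2 / ln (real N))"
    using 3 4 by (intro mult_left_mono add_mono) auto
  finally show ?thesis by (simp add: D_def)
qed

text \<open>H stays fixed while N grows, and \<kappa> is independent of H. Divided by N^2, the
  Bessel bound has a defect term made small by the increments, a variance term with the gain 1 / H,
  and squared totals of F and G; the latter save a factor N or ln N, which beats the ln ln N coming
  from the sum of 1 / p.\<close>

lemma sum_defect_large:
  "\<exists>\<kappa>>0. \<forall>H\<ge>1. \<forall>\<^sub>F N in sequentially.
     (\<Sum>p | prime p \<and> p ^ 3 \<le> N \<and> H < p. 1 / real p * (defect N p)\<^sup>2) \<le> \<kappa> / real H * (\<beta> N)\<^sup>2"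
proof -
  obtain C where C: "C > 0" "\<forall>\<^sub>F N in sequentially. (\<Sum>n=1..N. (sadd g n - pmean g N)\<^sup>2) \<le> C * real N * (\<beta> N)\<^sup>2"
    using variance_sadd by blast
  obtain C0 where C0: "C0 > 0" "\<And>N. N \<ge> 2 \<Longrightarrow> (\<Sum>p\<in>primes_le N. 1 / real p) \<le> ln (ln (real N)) + C0"
    using sum_prime_recip_le by blast
  \<comment> \<open>The summands are 8 + 8 C from the mean squares of F and G, 4 from their totals,
    1 from the energy of g, and 1 from the error of the averages over multiples.\<close>
  define \<kappa> where "\<kappa> = 12 * (14 + 8 * C)"
  have "\<forall>\<^sub>F N in sequentially. (\<Sum>p | prime p \<and> p ^ 3 \<le> N \<and> H < p. 1 / real p * (defect N p)\<^sup>2) \<le> \<kappa> / real H * (\<beta> N)\<^sup>2"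
    if H: "H \<ge> 1" for H :: nat
  proof -
    define K where "K = 2 * real H * C + 2 * (real H)\<^sup>2"
    have K: "K \<ge> 0" using C by (simp add: K_def)
    have lim: "(\<lambda>N. (ln (ln (real N)) + C0) * (K / real N + 30 / ln (real N))) \<longlonglongrightarrow> 0"
    proof -
      have "(\<lambda>N. ln (ln (real N)) / real N) \<longlonglongrightarrow> 0" "(\<lambda>N. ln (ln (real N)) / ln (real N)) \<longlonglongrightarrow> 0"
        "(\<lambda>N. 1 / real N) \<longlonglongrightarrow> 0" "(\<lambda>N. 1 / ln (real N)) \<longlonglongrightarrow> 0"
        by real_asymp+
      hence "(\<lambda>N. K * (ln (ln (real N)) / real N) + 30 * (ln (ln (real N)) / ln (real N)) + C0 * K * (1 / real N) + C0 * 30 * (1 / ln (real N)))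
        \<longlonglongrightarrow> K * 0 + 30 * 0 + C0 * K * 0 + C0 * 30 * 0"
        by (intro tendsto_intros)
      thus ?thesis by (simp add: algebra_simps add_divide_distrib)
    qed
    have small: "\<forall>\<^sub>F N in sequentially. (ln (ln (real N)) + C0) * (K / real N + 30 / ln (real N)) < 1 / real H"
      using order_tendstoD(2)[OF lim, of "1 / real H"] H by simp
    \<comment> \<open>Passing from increments to backward defects costs H^2, so this choice leaves 1
      / H.\<close>
    have \<eta>: "1 / real H ^ 3 > 0" using H by simp
    show ?thesis
      using C(2) sum_square_diff_consecutive[OF \<eta>] small eventually_ge_at_top[of "64 * H ^ 3"] eventually_ge_at_top[of H]
    proof eventually_elim
      case (elim N)
      define b where "b = (\<beta> N)\<^sup>2"
      define L where "L = (\<Sum>p\<in>primes_le N. 1 / real p)"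
      define z where "z = nat \<lfloor>root 3 (real N)\<rfloor>"
      define G where "G = (\<lambda>n. sadd g n - pmean g N)"
      define F where "F = backward_defect H G"
      define P where "P = {p. prime p \<and> H < p \<and> p \<le> z}"
      define c where "c = (\<lambda>p. real p * (\<Sum>n=1..N. if p dvd n then G n else 0))"
      have b0: "b \<ge> 0" by (simp add: b_def)
      have N64: "N \<ge> 64" using elim H by (metis le_trans mult_le_mono2 nat_mult_1_right one_le_power)
      hence N0: "real N > 0" and lN: "ln (real N) > 0" by auto
      have L: "0 \<le> L" "L \<le> ln (ln (real N)) + C0" using C0(2)[of N] N64 by (auto simp: L_def intro!: sum_nonneg)
      have LK: "L * (K / real N + 30 / ln (real N)) \<le> 1 / real H"
      proof -
        have "L * (K / real N + 30 / ln (real N)) \<le> (ln (ln (real N)) + C0) * (K / real N + 30 / ln (real N))"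
          using L K lN by (intro mult_right_mono) auto
        thus ?thesis using elim by linarith
      qed
      have z3: "(real z) ^ 3 \<le> real N"
      proof -
        have "real z \<le> root 3 (real N)" by (simp add: z_def)
        hence "(real z) ^ 3 \<le> (root 3 (real N)) ^ 3" by (intro power_mono) auto
        thus ?thesis by simp
      qed
      have zN: "z \<le> N"
      proof (cases "z = 0")
        case False
        hence "real z \<le> real z ^ 3" by (intro self_le_power) auto
        thus ?thesis using z3 by linarith
      qed auto
      \<comment> \<open>For z \<ge> 4 H this is z^3 \<le> N; for smaller z it is the requirement N
        \<ge> 64 H^3.\<close>
      have z2: "4 * (real z)\<^sup>2 \<le> real N / real H"
      proof (cases "z \<ge> 4 * H")
        case True
        have "4 * real H * (real z)\<^sup>2 \<le> real z * (real z)\<^sup>2" using True by (intro mult_right_mono) auto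
        also have "\<dots> = real z ^ 3" by (simp add: power2_eq_square power3_eq_cube)
        also note z3
        finally show ?thesis using H by (simp add: field_simps)
      next
        case False
        hence "(real z)\<^sup>2 \<le> (4 * real H)\<^sup>2" by (intro power_mono) auto
        hence "4 * real H * (real z)\<^sup>2 \<le> 4 * real H * (4 * real H)\<^sup>2" by (intro mult_left_mono) auto
        also have "\<dots> = real (64 * H ^ 3)" by (simp add: power2_eq_square power3_eq_cube)
        also have "\<dots> \<le> real N" using elim by (simp only: of_nat_le_iff)
        finally show ?thesis using H by (simp add: field_simps)
      qed
      have Psub: "{p. prime p \<and> p ^ 3 \<le> N \<and> H < p} = {p\<in>P. p ^ 3 \<le> N}"
      proof -
        have "p \<le> z" if "p ^ 3 \<le> N" for p :: nat
        proof -
          have "real p ^ 3 \<le> real N" using that by (metis of_nat_le_iff of_nat_power)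
          hence "root 3 (real p ^ 3) \<le> root 3 (real N)" by simp
          hence "real p \<le> root 3 (real N)" by (simp add: real_root_power_cancel)
          thus ?thesis unfolding z_def by (rule le_nat_floor)
        qed
        thus ?thesis by (auto simp: P_def)
      qed
      have finP: "finite P" "P \<subseteq> primes_le N" using zN by (auto simp: P_def intro: finite_subset[of _ "{..z}"])
      have G2: "(\<Sum>n=1..N. (G n)\<^sup>2) \<le> C * real N * b" using elim by (simp add: G_def b_def)
      have FG: "F = backward_defect H (sadd g)" unfolding F_def G_def by (rule backward_defect_shift[OF H])
      have F2: "(\<Sum>n=1..N. (F n)\<^sup>2) \<le> real N * b / real H"
      proof -
        have "(\<Sum>n=1..N. (F n)\<^sup>2) \<le> (real H)\<^sup>2 * (\<Sum>n=1..N. (sadd g n - sadd g (n - 1))\<^sup>2)"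
          unfolding FG by (rule sum_square_backward_defect[OF H])
        also have "\<dots> \<le> (real H)\<^sup>2 * (1 / real H ^ 3 * real N * b)"
          using elim by (intro mult_left_mono) (auto simp: b_def)
        also have "\<dots> = real N * b / real H" using H by (simp add: power2_eq_square power3_eq_cube)
        finally show ?thesis .
      qed
      have SF: "(\<Sum>n=1..N. F n)\<^sup>2 \<le> K * real N * b"
      proof -
        have "(\<Sum>n=1..N. F n)\<^sup>2 \<le> 2 * real H * (\<Sum>n=1..N. (G n)\<^sup>2) + 2 * (real H)\<^sup>2 * (pmean g N)\<^sup>2"
          unfolding FG G_def using H elim by (intro sum_backward_defect_square) auto
        also have "\<dots> \<le> 2 * real H * (C * real N * b) + 2 * (real H)\<^sup>2 * (real N * b)"
          using G2 pmean_square_le[of N] by (intro add_mono mult_left_mono) (auto simp: b_def)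
        also have "\<dots> = K * real N * b" by (simp add: K_def algebra_simps)
        finally show ?thesis .
      qed
      have SG: "(\<Sum>n=1..N. G n)\<^sup>2 \<le> 10 * (real N)\<^sup>2 / ln (real N) * b"
      proof -
        have "\<bar>\<Sum>n=1..N. G n\<bar> \<le> (\<Sum>p\<in>primes_le N. \<bar>g p\<bar>)"
          using sum_sadd_approx[of g N] by (simp add: G_def sum_subtractf)
        hence "\<bar>\<Sum>n=1..N. G n\<bar>\<^sup>2 \<le> (\<Sum>p\<in>primes_le N. \<bar>g p\<bar>)\<^sup>2" by (intro power_mono) auto
        also have "\<dots> \<le> (\<beta> N)\<^sup>2 * (10 * (real N)\<^sup>2 / ln (real N))" using N64 by (intro sum_abs_primes_square) auto
        finally show ?thesis by (simp add: b_def mult.commute)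
      qed
      have cb: "(\<Sum>p\<in>P. 1 / real p * (c p)\<^sup>2) \<le> (real N)\<^sup>2 * (b * ((8 + 8 * C) / real H + 4 * (L * (K / real N + 10 / ln (real N)))))"
      proof -
        have "(\<Sum>p\<in>P. 1 / real p * (c p)\<^sup>2) \<le>
          4 * ((real N + 4 * (real z)\<^sup>2) * (\<Sum>n=1..N. (F n)\<^sup>2) + (real N / real H + 4 * (real z)\<^sup>2) * (\<Sum>n=1..N. (G n)\<^sup>2)
           + L * ((\<Sum>n=1..N. F n)\<^sup>2 + (\<Sum>n=1..N. G n)\<^sup>2))"
          unfolding c_def P_def F_def L_def by (rule sum_multiples_bessel[OF H zN])
        also have "\<dots> \<le> 4 * ((2 * real N) * (real N * b / real H) + (2 * real N / real H) * (C * real N * b)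
           + L * (K * real N * b + 10 * (real N)\<^sup>2 / ln (real N) * b))"
        proof (intro mult_left_mono add_mono mult_mono F2 G2 SF SG)
          have "real N / real H \<le> real N / 1" using H by (intro divide_left_mono) auto
          thus "real N + 4 * (real z)\<^sup>2 \<le> 2 * real N" using z2 by simp
          show "real N / real H + 4 * (real z)\<^sup>2 \<le> 2 * real N / real H" using z2 by simp
        qed (use L b0 in \<open>auto intro!: sum_nonneg\<close>)
        also have "\<dots> = (real N)\<^sup>2 * (b * ((8 + 8 * C) / real H + 4 * (L * (K / real N + 10 / ln (real N)))))"
          using N0 H lN by (simp add: field_simps power2_eq_square)
        finally show ?thesis .
      qed
      have "(\<Sum>p | prime p \<and> p ^ 3 \<le> N \<and> H < p. 1 / real p * (defect N p)\<^sup>2) \<le>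
         (\<Sum>p\<in>{p\<in>P. p ^ 3 \<le> N}. 12 * ((1 / real p * (c p)\<^sup>2) / (real N)\<^sup>2 + ((g p)\<^sup>2 / real p) / (real H) + (1 / real p) * (20 * b / ln (real N))))"
        unfolding Psub
      proof (rule sum_mono)
        fix p assume p: "p \<in> {p\<in>P. p ^ 3 \<le> N}"
        hence pp: "prime p" "p ^ 3 \<le> N" "H < p" by (auto simp: P_def)
        have "1 / real p * (defect N p)\<^sup>2 \<le> 1 / real p * (12 * ((c p)\<^sup>2 / (real N)\<^sup>2 + (g p)\<^sup>2 / (real p)\<^sup>2 + 20 * b / ln (real N)))"
          using defect_square_le[OF pp(1,2)] unfolding c_def G_def b_def by (intro mult_left_mono) auto
        also have "\<dots> = 12 * ((1 / real p * (c p)\<^sup>2) / (real N)\<^sup>2 + ((g p)\<^sup>2 / real p) / (real p)\<^sup>2 + (1 / real p) * (20 * b / ln (real N)))"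
          by (simp add: algebra_simps add_divide_distrib)
        also have "\<dots> \<le> 12 * ((1 / real p * (c p)\<^sup>2) / (real N)\<^sup>2 + ((g p)\<^sup>2 / real p) / real H + (1 / real p) * (20 * b / ln (real N)))"
        proof (intro mult_left_mono add_mono order_refl)
          have "real H * 1 \<le> real p * real p" using pp H by (intro mult_mono) auto
          thus "((g p)\<^sup>2 / real p) / (real p)\<^sup>2 \<le> ((g p)\<^sup>2 / real p) / real H"
            using pp H by (intro divide_left_mono) (auto simp: power2_eq_square prime_gt_0_nat)
        qed auto
        finally show "1 / real p * (defect N p)\<^sup>2 \<le> \<dots>" .
      qed
      also have "\<dots> \<le> (\<Sum>p\<in>P. 12 * ((1 / real p * (c p)\<^sup>2) / (real N)\<^sup>2 + ((g p)\<^sup>2 / real p) / (real H) + (1 / real p) * (20 * b / ln (real N))))"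
        using finP b0 lN by (intro sum_mono2) (auto intro!: add_nonneg_nonneg)
      also have "\<dots> = 12 * ((\<Sum>p\<in>P. 1 / real p * (c p)\<^sup>2) / (real N)\<^sup>2 + (\<Sum>p\<in>P. (g p)\<^sup>2 / real p) / real H + (\<Sum>p\<in>P. 1 / real p) * (20 * b / ln (real N)))"
        by (simp only: sum_distrib_left[symmetric] sum.distrib sum_distrib_right[symmetric] sum_divide_distrib[symmetric])
      also have "\<dots> \<le> 12 * (b * ((8 + 8 * C) / real H + 4 * (L * (K / real N + 10 / ln (real N)))) + b / real H + L * (20 * b / ln (real N)))"
      proof (intro mult_left_mono add_mono mult_right_mono divide_right_mono)
        show "(\<Sum>p\<in>P. 1 / real p * (c p)\<^sup>2) / (real N)\<^sup>2 \<le> b * ((8 + 8 * C) / real H + 4 * (L * (K / real N + 10 / ln (real N))))"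
          using cb N0 by (simp add: divide_le_eq mult.commute)
        have "(\<Sum>p\<in>P. (g p)\<^sup>2 / real p) \<le> (\<Sum>p\<in>primes_le N. (g p)\<^sup>2 / real p)" using finP by (intro sum_mono2) auto
        thus "(\<Sum>p\<in>P. (g p)\<^sup>2 / real p) \<le> b" using sum_beta_le[of N] by (simp add: b_def)
        show "(\<Sum>p\<in>P. 1 / real p) \<le> L" unfolding L_def using finP by (intro sum_mono2) auto
      qed (use b0 lN in auto)
      also have "\<dots> \<le> 12 * (b * ((8 + 8 * C) / real H + 4 * (1 / real H)) + b / real H + b * (1 / real H))"
      proof (intro mult_left_mono add_mono order_refl)
        have "L * (K / real N + 10 / ln (real N)) \<le> L * (K / real N + 30 / ln (real N))"
          using L lN by (intro mult_left_mono add_left_mono divide_right_mono) auto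
        thus "L * (K / real N + 10 / ln (real N)) \<le> 1 / real H" using LK by linarith
        have "L * (20 * b / ln (real N)) = b * (L * (20 / ln (real N)))" by simp
        also have "\<dots> \<le> b * (L * (K / real N + 30 / ln (real N)))"
        proof -
          have "20 / ln (real N) \<le> 30 / ln (real N)" using lN by (intro divide_right_mono) auto
          moreover have "K / real N \<ge> 0" using K by simp
          ultimately have "20 / ln (real N) \<le> K / real N + 30 / ln (real N)" by linarith
          thus ?thesis using b0 L by (intro mult_left_mono) auto
        qed
        also have "\<dots> \<le> b * (1 / real H)" using LK b0 by (intro mult_left_mono) auto
        finally show "L * (20 * b / ln (real N)) \<le> b * (1 / real H)" .
      qed (use b0 in auto)
      also have "\<dots> = \<kappa> / real H * b" using H by (simp add: \<kappa>_def field_simps)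
      finally show ?case by (simp add: b_def)
    qed
  qed
  moreover have "\<kappa> > 0" using C by (simp add: \<kappa>_def)
  ultimately show ?thesis by blast
qed

text \<open>The Bessel argument needs p > H, but only boundedly many primes are excluded. For these
  g p is bounded, and N / p is so close to N that the prime mean moves by O(\<beta> / sqrt (ln
  N)).\<close>

lemma sum_defect_small_primes:
  assumes H: "H \<ge> 1" and \<epsilon>: "\<epsilon> > 0"
  shows "\<forall>\<^sub>F N in sequentially. (\<Sum>p | prime p \<and> p ^ 3 \<le> N \<and> p \<le> H. 1 / real p * (defect N p)\<^sup>2) \<le> \<epsilon> * (\<beta> N)\<^sup>2"
proof -
  define c where "c = (\<Sum>p\<in>primes_le H. (g p)\<^sup>2)"
  have c: "c \<ge> 0" by (simp add: c_def sum_nonneg)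
  define \<beta>0 where "\<beta>0 = 1 + 4 * c / \<epsilon>"
  have lim: "(\<lambda>N. 2 * real H * (2 * (ln (2 * real H) + 5)) * (1 / ln (real N))) \<longlonglongrightarrow> 2 * real H * (2 * (ln (2 * real H) + 5)) * 0"
    by (intro tendsto_mult tendsto_const) real_asymp
  have small: "\<forall>\<^sub>F N in sequentially. 2 * real H * (2 * (ln (2 * real H) + 5)) * (1 / ln (real N)) < \<epsilon> / 2"
    using order_tendstoD(2)[OF lim, of "\<epsilon> / 2"] \<epsilon> by simp
  show ?thesis
    using small beta_ge[of \<beta>0]
  proof eventually_elim
    case (elim N)
    define b where "b = (\<beta> N)\<^sup>2"
    define r where "r = 2 * (ln (2 * real H) + 5) / ln (real N)"
    have b0: "b \<ge> 0" by (simp add: b_def)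
    have "\<beta>0 \<ge> 1" using c \<epsilon> by (simp add: \<beta>0_def)
    hence "1 * \<beta>0 \<le> \<beta> N * \<beta> N" using elim by (intro mult_mono) auto
    hence cb: "2 * c \<le> \<epsilon> / 2 * b" using \<epsilon> by (simp add: b_def power2_eq_square \<beta>0_def field_simps)
    have "(\<Sum>p | prime p \<and> p ^ 3 \<le> N \<and> p \<le> H. 1 / real p * (defect N p)\<^sup>2) \<le>
       (\<Sum>p | prime p \<and> p ^ 3 \<le> N \<and> p \<le> H. 2 * (g p)\<^sup>2 + 2 * (b * (max 0 r)))"
    proof (rule sum_mono)
      fix p assume "p \<in> {p. prime p \<and> p ^ 3 \<le> N \<and> p \<le> H}"
      hence p: "prime p" "p ^ 3 \<le> N" "p \<le> H" by auto
      define M where "M = N div p"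
      note M = cube_root_div_facts[OF p(1,2) M_def]
      note l = ln_half_le[OF M(1,2,5)]
      have p1: "p \<ge> 1" using p by (simp add: prime_gt_0_nat Suc_le_eq)
      have "real N \<le> real (2 * M * p)" using M(3) by (simp only: of_nat_le_iff)
      also have "\<dots> = real p * (2 * real M)" by simp
      also have "\<dots> \<le> real H * (2 * real M)" using p by (intro mult_right_mono) auto
      also have "\<dots> = 2 * real H * real M" by simp
      finally have "ln (real N) \<le> ln (2 * real H * real M)" using M H by (subst ln_le_cancel_iff) auto
      also have "\<dots> = ln (2 * real H) + ln (real M)" using M H by (subst ln_mult) auto
      finally have 1: "ln (real N) - ln (real M) \<le> ln (2 * real H)" by simp
      have "(pmean g N - pmean g M)\<^sup>2 \<le> b * ((ln (real N) - ln (real M) + 5) / ln (real M))"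
        unfolding b_def using M by (intro pmean_diff_square) auto
      also have "(ln (real N) - ln (real M) + 5) / ln (real M) \<le> (ln (2 * real H) + 5) / ln (real M)"
        using 1 l by (intro divide_right_mono) auto
      also have "\<dots> \<le> (ln (2 * real H) + 5) / (ln (real N) / 2)"
        using l H by (intro divide_left_mono) auto
      also have "\<dots> = r" by (simp add: r_def)
      finally have 2: "(pmean g N - pmean g M)\<^sup>2 \<le> b * max 0 r" using b0
        by (simp add: mult_left_mono order_trans[OF _ mult_left_mono[of r "max 0 r" b]])
      have "1 / real p * (defect N p)\<^sup>2 \<le> 1 * (defect N p)\<^sup>2" using p1 by (intro mult_right_mono) auto
      also have "\<dots> \<le> 2 * (g p)\<^sup>2 + 2 * (pmean g N - pmean g M)\<^sup>2"
        using square_minus_le[of "g p" "pmean g N - pmean g M"] by (simp add: defect_def M_def algebra_simps)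
      finally show "1 / real p * (defect N p)\<^sup>2 \<le> 2 * (g p)\<^sup>2 + 2 * (b * (max 0 r))" using 2 by linarith
    qed
    also have "\<dots> \<le> (\<Sum>p\<in>primes_le H. 2 * (g p)\<^sup>2 + 2 * (b * (max 0 r)))"
      using b0 by (intro sum_mono2) auto
    also have "\<dots> = 2 * c + real (card (primes_le H)) * (2 * (b * max 0 r))"
      by (simp add: c_def sum.distrib sum_distrib_left)
    also have "real (card (primes_le H)) \<le> real H"
    proof -
      have "card (primes_le H) \<le> card {1..H}" by (intro card_mono) (auto simp: Suc_le_eq prime_gt_0_nat)
      thus ?thesis by simp
    qed
    also have "real H * (2 * (b * max 0 r)) = b * (2 * real H * max 0 r)" by simp
    also have "2 * real H * max 0 r \<le> \<epsilon> / 2"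
    proof -
      have "2 * real H * r < \<epsilon> / 2" using elim by (simp add: r_def)
      thus ?thesis using \<epsilon> by (simp add: max_def)
    qed
    also have "2 * c + b * (\<epsilon> / 2) \<le> \<epsilon> * b" using cb by (simp add: field_simps)
    finally show ?case using b0 by (simp add: b_def mult_left_mono mult_right_mono)
  qed
qed

lemma sum_defect:
  assumes \<epsilon>: "\<epsilon> > 0"
  shows "\<forall>\<^sub>F N in sequentially. defect_energy N \<le> \<epsilon> * (\<beta> N)\<^sup>2"
proof -
  obtain \<kappa> where \<kappa>: "\<kappa> > 0" "\<And>H. H \<ge> 1 \<Longrightarrow> \<forall>\<^sub>F N in sequentially.
     (\<Sum>p | prime p \<and> p ^ 3 \<le> N \<and> H < p. 1 / real p * (defect N p)\<^sup>2) \<le> \<kappa> / real H * (\<beta> N)\<^sup>2"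
    using sum_defect_large by blast
  define H where "H = nat \<lceil>2 * \<kappa> / \<epsilon>\<rceil>"
  have Hr: "real H \<ge> 2 * \<kappa> / \<epsilon>" unfolding H_def by (rule real_nat_ceiling_ge)
  hence "real H > 0" using \<kappa> \<epsilon> by (intro less_le_trans[OF _ Hr]) auto
  hence H: "H \<ge> 1" by simp
  have \<epsilon>2: "\<epsilon> / 2 > 0" using \<epsilon> by simp
  show ?thesis
    using \<kappa>(2)[OF H] sum_defect_small_primes[OF H \<epsilon>2]
  proof eventually_elim
    case (elim N)
    have fin: "finite {p. prime p \<and> p ^ 3 \<le> N \<and> H < p}" "finite {p. prime p \<and> p ^ 3 \<le> N \<and> p \<le> H}"
      by (rule finite_subset[OF _ finite_cube_le[of N]]; auto)+
    have "{p. prime p \<and> p ^ 3 \<le> N} = {p. prime p \<and> p ^ 3 \<le> N \<and> H < p} \<union> {p. prime p \<and> p ^ 3 \<le> N \<and> p \<le> H}" by auto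
    hence "defect_energy N =
       (\<Sum>p | prime p \<and> p ^ 3 \<le> N \<and> H < p. 1 / real p * (defect N p)\<^sup>2) + (\<Sum>p | prime p \<and> p ^ 3 \<le> N \<and> p \<le> H. 1 / real p * (defect N p)\<^sup>2)"
      by (simp only: defect_energy_def) (rule sum.union_disjoint, use fin in auto)
    also have "\<dots> \<le> \<kappa> / real H * (\<beta> N)\<^sup>2 + \<epsilon> / 2 * (\<beta> N)\<^sup>2" using elim by (intro add_mono) auto
    also have "\<kappa> / real H \<le> \<epsilon> / 2" using Hr H \<epsilon> by (simp add: field_simps)
    finally show ?case by (simp add: mult_right_mono field_simps)
  qed
qed

end

section \<open>Lower and upper bounds for further sums over primes\<close>

text \<open>Mertens' estimate with the proper prime powers removed. For d \<ge> 2 the logarithm is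
  at least 1/2, so \<open>mangoldt d \<le> 2 (ln d)^2\<close>, and the removed terms total at most 2
  C.\<close>

lemma sum_ln_prime_interval_ge:
  "\<exists>C>0. \<forall>a b. 1 \<le> a \<longrightarrow> a \<le> b \<longrightarrow>
     ln (real b) - ln (real a) - C \<le> (\<Sum>p | prime p \<and> a < p \<and> p \<le> b. ln (real p) / real p)"
proof -
  obtain C where C: "C > 0" "\<And>X. (\<Sum>q\<in>higher_prime_powers_upto X. (ln (real q))\<^sup>2 / real q) \<le> C"
    using sum_higher_prime_powers_le by blast
  have "ln (real b) - ln (real a) - (5 + 2 * C) \<le> (\<Sum>p | prime p \<and> a < p \<and> p \<le> b. ln (real p) / real p)"
    if ab: "1 \<le> a" "a \<le> b" for a b
  proof -
    define h where "h = (\<lambda>d. if d \<in> higher_prime_powers_upto (real b) then (ln (real d))\<^sup>2 / real d else 0)"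
    define v where "v = (\<lambda>d. if prime d then ln (real d) / real d else 0)"
    have fin: "finite {p. prime p \<and> a < p \<and> p \<le> b}" by (rule finite_subset[of _ "{..b}"]) auto
    have "ln (real b) - ln (real a) - 5 \<le> (\<Sum>d=a+1..b. mangoldt d / real d)"
      using mertens_interval(2)[OF ab] .
    also have "\<dots> \<le> (\<Sum>d=a+1..b. v d + 2 * h d)"
    proof (rule sum_mono)
      fix d assume d: "d \<in> {a+1..b}"
      have v0: "v d \<ge> 0" using d by (auto simp: v_def)
      have h0: "h d \<ge> 0" by (auto simp: h_def)
      show "mangoldt d / real d \<le> v d + 2 * h d"
      proof (cases "primepow d")
        case True
        then obtain p k where pk: "prime p" "k > 0" "d = p ^ k" by (auto simp: primepow_def)
        show ?thesis
        proof (cases "k = 1")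
          case True
          hence "mangoldt d / real d = v d" using pk by (simp add: v_def)
          thus ?thesis using h0 by simp
        next
          case False
          hence "\<exists>p k. prime p \<and> k \<ge> 2 \<and> d = p ^ k"
            using pk by (intro exI[of _ p] exI[of _ k]) auto
          hence "d \<in> higher_prime_powers_upto (real b)"
            using d by (simp add: higher_prime_powers_upto_def)
          hence hd: "h d = (ln (real d))\<^sup>2 / real d" by (simp add: h_def)
          have d2: "d \<ge> 2" using True primepow_gt_Suc_0[of d] by simp
          have "ln 2 \<ge> (1/2 :: real)" using ln2_ge_two_thirds by simp
          moreover have "ln 2 \<le> ln (real d)" using d2 by simp
          ultimately have l: "1 / 2 \<le> ln (real d)" by linarith
          have "mangoldt d \<le> ln (real d)" using d2 by (intro mangoldt_le) auto
          also have "\<dots> \<le> 2 * (ln (real d))\<^sup>2"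
          proof -
            have "ln (real d) * (1 / 2) \<le> ln (real d) * ln (real d)" using l by (intro mult_left_mono) auto
            thus ?thesis by (simp add: power2_eq_square)
          qed
          finally have "mangoldt d / real d \<le> 2 * (ln (real d))\<^sup>2 / real d" by (intro divide_right_mono) auto
          thus ?thesis using v0 hd by simp
        qed
      qed (use v0 h0 in \<open>simp add: mangoldt_def\<close>)
    qed
    also have "\<dots> = (\<Sum>d=a+1..b. v d) + 2 * (\<Sum>d=a+1..b. h d)" by (simp add: sum.distrib sum_distrib_left)
    also have "(\<Sum>d=a+1..b. v d) = (\<Sum>p | prime p \<and> a < p \<and> p \<le> b. ln (real p) / real p)"
      using fin by (intro sum.mono_neutral_cong_right) (auto simp: v_def)
    also have "(\<Sum>d=a+1..b. h d) \<le> (\<Sum>q\<in>higher_prime_powers_upto (real b). (ln (real q))\<^sup>2 / real q)"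
    proof -
      have "(\<Sum>d=a+1..b. h d) = (\<Sum>d\<in>{a+1..b} \<inter> higher_prime_powers_upto (real b). (ln (real d))\<^sup>2 / real d)"
        unfolding h_def by (rule sum.inter_restrict[symmetric]) auto
      also have "\<dots> \<le> (\<Sum>q\<in>higher_prime_powers_upto (real b). (ln (real q))\<^sup>2 / real q)"
        by (intro sum_mono2) auto
      finally show ?thesis .
    qed
    also note C(2)[of "real b"]
    finally show ?thesis by simp
  qed
  thus ?thesis using C(1) by (intro exI[of _ "5 + 2 * C"]) auto
qed

text \<open>The primes above sqrt N suffice: their sum of ln p / p is at least ln N / 4, and each
  carries another factor ln p \<ge> ln N / 2.\<close>

lemma sum_ln_square_prime_ge:
  "\<forall>\<^sub>F N in sequentially. (ln (real N))\<^sup>2 / 8 \<le> (\<Sum>p\<in>primes_le N. (ln (real p))\<^sup>2 / real p)"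
proof -
  obtain C where C: "C > 0" "\<And>a b. 1 \<le> a \<Longrightarrow> a \<le> b \<Longrightarrow>
     ln (real b) - ln (real a) - C \<le> (\<Sum>p | prime p \<and> a < p \<and> p \<le> b. ln (real p) / real p)"
    using sum_ln_prime_interval_ge by blast
  have "filterlim (\<lambda>N. ln (real N)) at_top sequentially" by real_asymp
  hence "\<forall>\<^sub>F N in sequentially. ln (real N) \<ge> 4 * C" by (simp add: filterlim_at_top)
  thus ?thesis using eventually_ge_at_top[of 1]
  proof eventually_elim
    case (elim N)
    define a where "a = nat \<lfloor>sqrt (real N)\<rfloor>"
    have sq: "sqrt (real N) \<ge> 1" using elim by simp
    have a1: "1 \<le> a" using sq unfolding a_def by (simp add: le_nat_floor)
    have al: "real a \<le> sqrt (real N)" by (simp add: a_def)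
    have "sqrt (real N) * 1 \<le> sqrt (real N) * sqrt (real N)" using sq by (intro mult_left_mono) auto
    hence aN: "a \<le> N" using al by simp
    have fin: "finite {p. prime p \<and> a < p \<and> p \<le> N}" by (rule finite_subset[of _ "{..N}"]) auto
    have l0: "ln (real N) > 0" using elim C(1) by linarith
    have ls: "ln (sqrt (real N)) = ln (real N) / 2" using elim by (simp add: ln_sqrt)
    have "ln (real a) \<le> ln (sqrt (real N))" using a1 al sq by (subst ln_le_cancel_iff) linarith+
    hence "ln (real N) / 4 \<le> ln (real N) - ln (real a) - C" using elim ls by linarith
    also have "\<dots> \<le> (\<Sum>p | prime p \<and> a < p \<and> p \<le> N. ln (real p) / real p)" by (rule C(2)[OF a1 aN])
    finally have "ln (real N) / 2 * (ln (real N) / 4) \<le> ln (real N) / 2 * (\<Sum>p | prime p \<and> a < p \<and> p \<le> N. ln (real p) / real p)"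
      using l0 by (intro mult_left_mono) auto
    also have "\<dots> = (\<Sum>p | prime p \<and> a < p \<and> p \<le> N. ln (real N) / 2 * (ln (real p) / real p))"
      by (rule sum_distrib_left)
    also have "\<dots> \<le> (\<Sum>p | prime p \<and> a < p \<and> p \<le> N. (ln (real p))\<^sup>2 / real p)"
    proof (rule sum_mono)
      fix p assume "p \<in> {p. prime p \<and> a < p \<and> p \<le> N}"
      hence p: "prime p" "a < p" by auto
      have "sqrt (real N) < real a + 1" unfolding a_def using sq by linarith
      also have "\<dots> \<le> real p" using p by simp
      finally have "ln (sqrt (real N)) \<le> ln (real p)" using sq by (subst ln_le_cancel_iff) linarith+
      hence "ln (real N) / 2 \<le> ln (real p)" using ls by simp
      moreover have "ln (real p) / real p \<ge> 0" using p a1 by simp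
      ultimately have "ln (real N) / 2 * (ln (real p) / real p) \<le> ln (real p) * (ln (real p) / real p)"
        by (intro mult_right_mono)
      thus "ln (real N) / 2 * (ln (real p) / real p) \<le> (ln (real p))\<^sup>2 / real p" by (simp add: power2_eq_square)
    qed
    also have "\<dots> \<le> (\<Sum>p\<in>primes_le N. (ln (real p))\<^sup>2 / real p)" by (intro sum_mono2) auto
    finally show ?case by (simp add: power2_eq_square)
  qed
qed

text \<open>The interval from b^n to b^(n+1) contributes at most 2 / n, which is at most 6 (sqrt
  (n+1) - sqrt n). A bound of order ln J would be true, but sqrt J is enough: it multiplies an error
  of order B^2 / J.\<close>

lemma sum_prime_recip_powers_le:
  assumes b: "ln (real b) \<ge> 5" and J: "J \<ge> 1"
  shows "(\<Sum>p | prime p \<and> b < p \<and> p \<le> b ^ J. 1 / real p) \<le> 6 * sqrt (real J)"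
  using J
proof (induction J rule: dec_induct)
  case base
  have "{p. prime p \<and> b < p \<and> p \<le> b ^ 1} = {}" by auto
  thus ?case by (simp only: sum.empty) simp
next
  case (step n)
  have b2: "b \<ge> 2"
  proof (rule ccontr)
    assume "\<not> b \<ge> 2"
    hence "b = 0 \<or> b = 1" by auto
    thus False using b by auto
  qed
  have bn: "b \<le> b ^ n" "b ^ n \<le> b ^ Suc n" using b2 step by (auto simp: self_le_power)
  have n1: "real n \<ge> 1" using step by simp
  have fin: "finite {p. prime p \<and> x < p \<and> p \<le> (y::nat)}" for x y by (rule finite_subset[of _ "{..y}"]) auto
  have "{p. prime p \<and> b < p \<and> p \<le> b ^ Suc n} = {p. prime p \<and> b < p \<and> p \<le> b ^ n} \<union> {p. prime p \<and> b ^ n < p \<and> p \<le> b ^ Suc n}"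
    using bn by (auto intro: le_trans le_less_trans simp del: power_Suc)
  hence "(\<Sum>p | prime p \<and> b < p \<and> p \<le> b ^ Suc n. 1 / real p) =
     (\<Sum>p | prime p \<and> b < p \<and> p \<le> b ^ n. 1 / real p) + (\<Sum>p | prime p \<and> b ^ n < p \<and> p \<le> b ^ Suc n. 1 / real p)"
    by (simp only:) (rule sum.union_disjoint, use fin in auto)
  also have "(\<Sum>p | prime p \<and> b ^ n < p \<and> p \<le> b ^ Suc n. 1 / real p) \<le> (ln (real (b ^ Suc n)) - ln (real (b ^ n)) + 5) / ln (real (b ^ n))"
    using b2 bn by (intro sum_prime_recip_interval_le) auto
  also have "\<dots> = (ln (real b) + 5) / (real n * ln (real b))" using b2 by (simp add: ln_realpow ln_mult algebra_simps)
  also have "\<dots> \<le> (2 * ln (real b)) / (real n * ln (real b))" using b n1 by (intro divide_right_mono) auto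
  also have "\<dots> = 2 / real n" using b by simp
  also have "\<dots> \<le> 6 * sqrt (real (Suc n)) - 6 * sqrt (real n)"
  proof -
    define x where "x = sqrt (real n)"
    define y where "y = sqrt (real (Suc n))"
    have sq: "x * x = real n" "y * y = real n + 1" by (auto simp: x_def y_def)
    have x1: "x \<ge> 1" using n1 by (simp add: x_def)
    have xy: "x \<le> y" by (simp add: x_def y_def)
    have "x * 1 \<le> x * x" "y * 1 \<le> y * y" using x1 xy by (intro mult_left_mono; simp)+
    hence "x + y \<le> 3 * real n" using sq n1 by linarith
    have "2 * (x + y) \<le> 6 * real n" using \<open>x + y \<le> 3 * real n\<close> by simp
    also have "\<dots> = 6 * real n * ((y - x) * (y + x))" using sq by (simp add: algebra_simps)
    finally have "2 * (x + y) \<le> (6 * real n * (y - x)) * (x + y)" by (simp add: algebra_simps)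
    hence "2 \<le> 6 * real n * (y - x)" using x1 xy by (metis add_pos_pos less_le_trans mult_le_cancel_right_pos zero_less_one)
    thus ?thesis using n1 by (simp add: x_def y_def field_simps)
  qed
  finally show ?case using step.IH by simp
qed

section \<open>Slow growth of B\<close>

context almost_increasing
begin

text \<open>What B at X = Y^\<rho> gains over B at Y comes from proper prime powers, from primes
  with |g p| > K B, and from other primes in between. Each group accounts for at most a quarter of
  B^2 at X, so at least a quarter is already present at Y.\<close>

lemma growth_step:
  "\<exists>\<rho>>1. \<forall>\<^sub>F Y::real in at_top. (B_add g (Y powr \<rho>))\<^sup>2 \<le> 4 * (B_add g Y)\<^sup>2"
proof -
  obtain K where K: "K \<ge> 1" "\<forall>\<^sub>F X::real in at_top.
     (\<Sum>p | prime p \<and> real p \<le> X \<and> \<bar>g p\<bar> > K * B_add g X. (g p)\<^sup>2 / real p) \<le> (1 / 4) * (B_add g X)\<^sup>2"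
    using large_small[of "1 / 4"] by auto
  \<comment> \<open>The primes between Y and Y^(1+\<delta>) have reciprocal sum at most 2 \<delta>;
    each carries at most K^2 B^2, and 2 \<delta> K^2 = 1 / 4.\<close>
  define \<delta> where "\<delta> = 1 / (8 * K\<^sup>2)"
  define \<rho> where "\<rho> = 1 + \<delta>"
  have \<delta>: "\<delta> > 0" using K(1) by (simp add: \<delta>_def)
  have lim: "filterlim (\<lambda>Y::real. Y powr \<rho>) at_top at_top" using \<delta> unfolding \<rho>_def by real_asymp
  have lnY: "\<forall>\<^sub>F Y::real in at_top. ln Y \<ge> 2 + 8 / \<delta>"
    using ln_at_top by (simp add: filterlim_at_top)
  have hs: "\<forall>\<^sub>F X::real in at_top. (\<Sum>q\<in>higher_prime_powers_upto X. (g q)\<^sup>2 / real q) \<le> 1 / 4 * (B_add g X)\<^sup>2"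
    by (rule higher_small) simp
  have "\<forall>\<^sub>F Y::real in at_top. (B_add g (Y powr \<rho>))\<^sup>2 \<le> 4 * (B_add g Y)\<^sup>2"
    using eventually_compose_filterlim[OF K(2) lim]
      eventually_compose_filterlim[OF hs lim] lnY eventually_ge_at_top[of 2]
  proof eventually_elim
    case (elim Y)
    define X where "X = Y powr \<rho>"
    define b where "b = (B_add g X)\<^sup>2"
    define N where "N = nat \<lfloor>X\<rfloor>"
    define M where "M = nat \<lfloor>Y\<rfloor>"
    define I where "I = {p. prime p \<and> M < p \<and> p \<le> N}"
    define L where "L = {p. prime p \<and> real p \<le> X \<and> \<bar>g p\<bar> > K * B_add g X}"
    have b0: "b \<ge> 0" by (simp add: b_def)
    have Y2: "Y \<ge> 2" using elim by simp
    have "Y powr 1 \<le> Y powr \<rho>" using Y2 \<delta> by (intro powr_mono) (auto simp: \<rho>_def)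
    hence YX: "Y \<le> X" using Y2 by (simp add: X_def)
    have M2: "M \<ge> 2" unfolding M_def using Y2 by (simp add: le_nat_floor)
    have MN: "M \<le> N" unfolding M_def N_def using YX by (intro nat_mono floor_mono)
    have fI: "finite I" by (rule finite_subset[of _ "{..N}"]) (auto simp: I_def)
    have fL: "finite L" by (rule finite_subset[of _ "{..N}"]) (auto simp: L_def N_def le_nat_floor)
    have "prime_powers_upto X \<subseteq> prime_powers_upto Y \<union> higher_prime_powers_upto X \<union> L \<union> (I - L)"
    proof
      fix q assume q: "q \<in> prime_powers_upto X"
      then obtain p k where pk: "prime p" "k > 0" "q = p ^ k" "real q \<le> X"
        by (auto simp: prime_powers_upto_def primepow_def)
      show "q \<in> prime_powers_upto Y \<union> higher_prime_powers_upto X \<union> L \<union> (I - L)"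
      proof (cases "k = 1")
        case True
        have "q \<in> I" if "\<not> real q \<le> Y"
        proof -
          have "M < q" unfolding M_def using that Y2 by linarith
          moreover have "q \<le> N" unfolding N_def using pk(4) by (rule le_nat_floor)
          ultimately show ?thesis using True pk by (simp add: I_def)
        qed
        thus ?thesis using q by (auto simp: prime_powers_upto_def)
      next
        case False
        hence "\<exists>p k. prime p \<and> k \<ge> 2 \<and> q = p ^ k"
          using pk by (intro exI[of _ p] exI[of _ k]) auto
        thus ?thesis using pk(4) by (simp add: higher_prime_powers_upto_def)
      qed
    qed
    hence "b \<le> (\<Sum>q\<in>prime_powers_upto Y \<union> higher_prime_powers_upto X \<union> L \<union> (I - L). (g q)\<^sup>2 / real q)"
      unfolding b_def B_add_sq using fI fL by (intro sum_mono2) auto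
    also have "\<dots> \<le> (\<Sum>q\<in>prime_powers_upto Y. (g q)\<^sup>2 / real q) + (\<Sum>q\<in>higher_prime_powers_upto X. (g q)\<^sup>2 / real q)
        + (\<Sum>q\<in>L. (g q)\<^sup>2 / real q) + (\<Sum>q\<in>I - L. (g q)\<^sup>2 / real q)"
    proof -
      have un: "(\<Sum>q\<in>S \<union> T. (g q)\<^sup>2 / real q) \<le> (\<Sum>q\<in>S. (g q)\<^sup>2 / real q) + (\<Sum>q\<in>T. (g q)\<^sup>2 / real q)"
        if "finite S" "finite T" for S T
        using sum.union_inter[OF that, of "\<lambda>q. (g q)\<^sup>2 / real q"] sum_nonneg[of "S \<inter> T" "\<lambda>q. (g q)\<^sup>2 / real q"] by simp
      show ?thesis
        using un[of "prime_powers_upto Y \<union> higher_prime_powers_upto X \<union> L" "I - L"]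
          un[of "prime_powers_upto Y \<union> higher_prime_powers_upto X" L] un[of "prime_powers_upto Y" "higher_prime_powers_upto X"]
          fI fL by simp
    qed
    also have "(\<Sum>q\<in>prime_powers_upto Y. (g q)\<^sup>2 / real q) = (B_add g Y)\<^sup>2" by (simp add: B_add_sq)
    also have "(\<Sum>q\<in>higher_prime_powers_upto X. (g q)\<^sup>2 / real q) \<le> 1 / 4 * b" using elim by (simp add: X_def b_def)
    also have "(\<Sum>q\<in>L. (g q)\<^sup>2 / real q) \<le> 1 / 4 * b" using elim by (simp add: X_def b_def L_def)
    also have "(\<Sum>q\<in>I - L. (g q)\<^sup>2 / real q) \<le> 1 / 4 * b"
    proof -
      have "(\<Sum>q\<in>I - L. (g q)\<^sup>2 / real q) \<le> (\<Sum>q\<in>I - L. K\<^sup>2 * b * (1 / real q))"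
      proof (rule sum_mono)
        fix q assume q: "q \<in> I - L"
        hence "q \<le> N" by (simp add: I_def)
        hence "real q \<le> X" unfolding N_def using YX Y2 by linarith
        hence "\<bar>g q\<bar> \<le> K * B_add g X" using q by (auto simp: I_def L_def)
        hence "\<bar>g q\<bar>\<^sup>2 \<le> (K * B_add g X)\<^sup>2" by (intro power_mono) auto
        hence "(g q)\<^sup>2 / real q \<le> (K\<^sup>2 * b) / real q" by (intro divide_right_mono) (auto simp: b_def power_mult_distrib)
        thus "(g q)\<^sup>2 / real q \<le> K\<^sup>2 * b * (1 / real q)" by simp
      qed
      also have "\<dots> \<le> (\<Sum>q\<in>I. K\<^sup>2 * b * (1 / real q))" using fI b0 by (intro sum_mono2) auto
      also have "\<dots> = K\<^sup>2 * b * (\<Sum>q\<in>I. 1 / real q)" by (simp add: sum_distrib_left)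
      also have "\<dots> \<le> K\<^sup>2 * b * (2 * \<delta>)"
      proof (rule mult_left_mono)
        have "(\<Sum>q\<in>I. 1 / real q) \<le> (ln (real N) - ln (real M) + 5) / ln (real M)"
          unfolding I_def by (rule sum_prime_recip_interval_le[OF M2 MN])
        also have "\<dots> \<le> 2 * \<delta>"
        proof -
          have "real M \<ge> Y / 2" unfolding M_def using Y2 by linarith
          hence "ln (Y / 2) \<le> ln (real M)" using Y2 M2 by (subst ln_le_cancel_iff) auto
          hence 1: "ln Y - 1 \<le> ln (real M)" using Y2 ln_2_less_1 by (simp add: ln_div)
          have "real N \<le> X" unfolding N_def using YX Y2 by linarith
          hence "ln (real N) \<le> ln X" using MN M2 YX Y2 by (subst ln_le_cancel_iff) auto
          also have "ln X = ln Y + \<delta> * ln Y" using Y2 by (simp add: X_def ln_powr \<rho>_def algebra_simps)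
          finally have 2: "ln (real N) - ln (real M) + 5 \<le> \<delta> * ln Y + 6" using 1 by linarith
          have "\<delta> * (2 + 8 / \<delta>) \<le> \<delta> * ln Y" using elim \<delta> by (intro mult_left_mono) auto
          hence "2 * \<delta> + 8 \<le> \<delta> * ln Y" using \<delta> by (simp add: distrib_left)
          hence "\<delta> * ln Y + 6 \<le> 2 * \<delta> * (ln Y - 1)" by (simp add: algebra_simps)
          also have "\<dots> \<le> 2 * \<delta> * ln (real M)" using 1 \<delta> by (intro mult_left_mono) auto
          finally have "ln (real N) - ln (real M) + 5 \<le> 2 * \<delta> * ln (real M)" using 2 by linarith
          moreover have "ln (real M) > 0" using M2 by simp
          ultimately show ?thesis by (simp add: divide_le_eq)
        qed
        finally show "(\<Sum>q\<in>I. 1 / real q) \<le> 2 * \<delta>" .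
      qed (use b0 in auto)
      also have "\<dots> = 1 / 4 * b" using K(1) by (simp add: \<delta>_def)
      finally show ?thesis .
    qed
    finally show ?case by (simp add: b_def X_def)
  qed
  thus ?thesis using \<delta> by (intro exI[of _ \<rho>]) (auto simp: \<rho>_def)
qed

text \<open>Finitely many steps of ratio \<rho> > 1 reach the exponent 5. That exponent is needed
  because X will be enclosed by b^J with b^(4J) \<le> 2^(4J) X^4 \<le> X^5.\<close>

lemma growth: "\<exists>C>0. \<forall>\<^sub>F X::real in at_top. (B_add g (X powr 5))\<^sup>2 \<le> C * (B_add g X)\<^sup>2"
proof -
  obtain \<rho> where \<rho>: "\<rho> > 1" "\<forall>\<^sub>F Y::real in at_top. (B_add g (Y powr \<rho>))\<^sup>2 \<le> 4 * (B_add g Y)\<^sup>2"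
    using growth_step by blast
  have it: "\<forall>\<^sub>F Y::real in at_top. (B_add g (Y powr (\<rho> ^ j)))\<^sup>2 \<le> 4 ^ j * (B_add g Y)\<^sup>2" for j
  proof (induction j)
    case 0
    show ?case using eventually_gt_at_top[of 0] by eventually_elim simp
  next
    case (Suc j)
    have r: "\<rho> ^ j > 0" using \<rho> by simp
    have lim: "filterlim (\<lambda>Y::real. Y powr (\<rho> ^ j)) at_top at_top" using r by real_asymp
    show ?case using Suc eventually_compose_filterlim[OF \<rho>(2) lim]
    proof eventually_elim
      case (elim Y)
      have "(B_add g (Y powr (\<rho> ^ Suc j)))\<^sup>2 = (B_add g ((Y powr (\<rho> ^ j)) powr \<rho>))\<^sup>2"
        by (simp add: powr_powr mult.commute)
      also have "\<dots> \<le> 4 * (4 ^ j * (B_add g Y)\<^sup>2)" using elim by linarith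
      finally show ?case by simp
    qed
  qed
  obtain j where j: "\<rho> ^ j > 5" using real_arch_pow[OF \<rho>(1)] by blast
  have "\<forall>\<^sub>F X::real in at_top. (B_add g (X powr 5))\<^sup>2 \<le> 4 ^ j * (B_add g X)\<^sup>2"
    using it[of j] eventually_ge_at_top[of 1]
  proof eventually_elim
    case (elim X)
    have "(B_add g (X powr 5))\<^sup>2 \<le> (B_add g (X powr (\<rho> ^ j)))\<^sup>2"
      using elim j by (intro power_mono B_add_mono powr_mono B_add_nonneg) auto
    thus ?case using elim by linarith
  qed
  thus ?thesis by (intro exI[of _ "4 ^ j"]) auto
qed

end

section \<open>The functional equation forces a logarithm\<close>

lemma ln_of_nat_mono:
  fixes m n :: nat
  assumes "0 < m" "m \<le> n"
  shows "ln (real m) \<le> ln (real n)"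
  using assms by simp

context almost_increasing
begin

lemma pmean_diff_square_le:
  assumes "2 \<le> M" "M \<le> N" "N \<le> Z" "ln (real N) - ln (real M) + 5 \<le> x" "0 < y" "y \<le> ln (real M)"
  shows "(pmean g N - pmean g M)\<^sup>2 \<le> (\<beta> Z)\<^sup>2 * (x / y)"
proof -
  have "ln (real M) \<le> ln (real N)" using assms by simp
  hence x0: "x \<ge> 0" using assms by linarith
  have "(pmean g N - pmean g M)\<^sup>2 \<le> (\<beta> N)\<^sup>2 * ((ln (real N) - ln (real M) + 5) / ln (real M))"
    by (rule pmean_diff_square[OF assms(1,2)])
  also have "(ln (real N) - ln (real M) + 5) / ln (real M) \<le> x / y"
    using assms x0 by (intro frac_le) auto
  also have "(\<beta> N)\<^sup>2 * (x / y) \<le> (\<beta> Z)\<^sup>2 * (x / y)"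
    using assms x0 by (intro mult_right_mono power_mono B_add_mono B_add_nonneg) auto
  finally show ?thesis by (simp add: mult_left_mono)
qed

text \<open>The drop of the prime mean from Z = b^(4J) to Z / p is a sum of about ln p / ln b
  increments d k with 3J \<le> k \<le> 4J. These agree with each other, since each is close to g at
  the primes just below b, so the drop is nearly proportional to ln p. Starting at 4J keeps Z / p
  above b^(3J), where a further factor b moves the prime mean by at most B / sqrt J; it also puts
  every p up to b^J below the cube root of Z.\<close>

lemma approximation_at_powers:
  assumes J: "J \<ge> (1::nat)"
  shows "\<forall>\<^sub>F b in sequentially. \<exists>\<theta>. (\<Sum>p\<in>primes_le (b ^ J). 1 / real p * (g p - \<theta> * ln (real p))\<^sup>2)
      \<le> 222 / sqrt (real J) * (\<beta> (b ^ (4 * J)))\<^sup>2"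
proof -
  obtain C1 where C1: "C1 > 0" "\<And>a b. 1 \<le> a \<Longrightarrow> a \<le> b \<Longrightarrow>
     ln (real b) - ln (real a) - C1 \<le> (\<Sum>p | prime p \<and> a < p \<and> p \<le> b. ln (real p) / real p)"
    using sum_ln_prime_interval_ge by blast
  text \<open>Windows of relative width \<open>\<kappa>\<close> make the errors of J consecutive increments add up to
    only B / sqrt J.\<close>
  define \<kappa> where "\<kappa> = 1 / (24 * real J ^ 3)"
  have J1: "real J \<ge> 1" using J by simp
  have \<kappa>: "\<kappa> > 0" "\<kappa> \<le> 1 / real J" "\<kappa> < 1"
  proof -
    show "\<kappa> > 0" using J1 by (simp add: \<kappa>_def)
    have "real J \<le> real J ^ 3" using J1 by (intro self_le_power) auto
    hence "real J < 24 * real J ^ 3" using J1 by linarith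
    thus "\<kappa> \<le> 1 / real J" "\<kappa> < 1" using J1 by (auto simp: \<kappa>_def intro!: divide_left_mono)
  qed
  have \<kappa>2: "\<kappa>\<^sup>2 > 0" using \<kappa> by simp
  \<comment> \<open>Three demands on ln b: 5 and 5 / \<kappa> absorb the additive 5 of the prime
    sums, for a full factor b and for a window of relative width \<kappa>; 2 C1 / \<kappa>
    guarantees that the window carries reciprocal mass at least \<kappa> / 2.\<close>
  define \<Lambda> where "\<Lambda> = 5 + 5 / \<kappa> + 2 * C1 / \<kappa>"
  have pow_lim: "filterlim (\<lambda>b::nat. b ^ k) sequentially sequentially" if "k \<ge> 1" for k
  proof (rule filterlim_at_top_mono[OF filterlim_ident])
    show "\<forall>\<^sub>F b::nat in sequentially. b \<le> b ^ k"
      using eventually_ge_at_top[of 1] by eventually_elim (use that in \<open>auto intro: self_le_power\<close>)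
  qed
  have "\<forall>\<^sub>F b in sequentially. \<forall>k\<in>{3*J..4*J}. defect_energy (b ^ k) \<le> \<kappa>\<^sup>2 * (\<beta> (b ^ k))\<^sup>2"
  proof (rule eventually_ball_finite)
    show "\<forall>k\<in>{3*J..4*J}. \<forall>\<^sub>F b in sequentially. defect_energy (b ^ k) \<le> \<kappa>\<^sup>2 * (\<beta> (b ^ k))\<^sup>2"
    proof
      fix k assume "k \<in> {3*J..4*J}"
      hence "k \<ge> 1" using J by auto
      from eventually_compose_filterlim[OF sum_defect[OF \<kappa>2] pow_lim[OF this]]
      show "\<forall>\<^sub>F b in sequentially. defect_energy (b ^ k) \<le> \<kappa>\<^sup>2 * (\<beta> (b ^ k))\<^sup>2" .
    qed
  qed auto
  moreover have "filterlim (\<lambda>b. ln (real b)) at_top sequentially" by real_asymp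
  hence "\<forall>\<^sub>F b in sequentially. ln (real b) \<ge> \<Lambda>" by (simp add: filterlim_at_top)
  ultimately show ?thesis using eventually_ge_at_top[of 2]
  proof eventually_elim
    case (elim b)
    define l where "l = ln (real b)"
    define Z where "Z = b ^ (4 * J)"
    define s where "s = \<beta> Z"
    define B where "B = s\<^sup>2"
    define r where "r = s / sqrt (real J)"
    define d where "d = (\<lambda>k. pmean g (b ^ k) - pmean g (b ^ (k - 1)))"
    have b2: "b \<ge> 2" using elim by simp
    have s0: "s \<ge> 0" by (simp add: s_def B_add_nonneg)
    have B0: "B \<ge> 0" by (simp add: B_def)
    have r0: "r \<ge> 0" using s0 by (simp add: r_def)
    have r2: "r\<^sup>2 = B / real J" by (simp add: r_def B_def power_divide)
    have l\<Lambda>: "l \<ge> \<Lambda>" using elim by (simp add: l_def)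
    have l5: "l \<ge> 5" "l \<ge> 5 / \<kappa>" "l \<ge> 2 * C1 / \<kappa>"
    proof -
      have "5 / \<kappa> \<ge> 0" "2 * C1 / \<kappa> \<ge> 0" using \<kappa> C1 by auto
      thus "l \<ge> 5" "l \<ge> 5 / \<kappa>" "l \<ge> 2 * C1 / \<kappa>" using l\<Lambda> unfolding \<Lambda>_def by linarith+
    qed
    have lk: "ln (real (b ^ k)) = real k * l" for k using b2 by (simp add: l_def ln_realpow)
    have bk2: "b ^ k \<ge> 2" if "k \<ge> 1" for k
      using self_le_power[of b k] b2 that by linarith
    have bkl: "b ^ k \<le> b ^ m" if "k \<le> m" for k m using b2 that by (intro power_increasing) auto
    have sumdef: "defect_energy (b ^ k) \<le> \<kappa>\<^sup>2 * B" if "3 * J \<le> k" "k \<le> 4 * J" for k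
    proof -
      have "defect_energy (b ^ k) \<le> \<kappa>\<^sup>2 * (\<beta> (b ^ k))\<^sup>2"
        using elim that by auto
      also have "\<beta> (b ^ k) \<le> s" unfolding s_def Z_def using bkl[OF that(2)] by (intro B_add_mono) (simp only: of_nat_le_iff)
      hence "\<kappa>\<^sup>2 * (\<beta> (b ^ k))\<^sup>2 \<le> \<kappa>\<^sup>2 * B" unfolding B_def by (intro mult_left_mono power_mono B_add_nonneg) auto
      finally show ?thesis .
    qed

    \<comment> \<open>The primes of the window between b^(1-\<kappa>) and b serve as common
      witnesses: dividing b^k by any of them lands close to b^(k-1), whatever k is.\<close>
    define a where "a = nat \<lfloor>real b powr (1 - \<kappa>)\<rfloor>"
    define W where "W = {p. prime p \<and> a < p \<and> p \<le> b}"
    define \<mu> where "\<mu> = (\<Sum>p\<in>W. 1 / real p)"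
    have finW: "finite W" by (rule finite_subset[of _ "{..b}"]) (auto simp: W_def)
    have bp1: "real b powr (1 - \<kappa>) \<ge> 1" using b2 \<kappa> by (intro ge_one_powr_ge_zero) auto
    have ap: "real a \<le> real b powr (1 - \<kappa>)" using bp1 unfolding a_def by simp
    have a1: "1 \<le> a" using bp1 unfolding a_def by (simp add: le_nat_floor)
    have ab: "a \<le> b"
    proof -
      have "real b powr (1 - \<kappa>) \<le> real b powr 1" using b2 \<kappa> by (intro powr_mono) auto
      thus ?thesis using ap b2 by simp
    qed
    have \<mu>: "\<mu> \<ge> \<kappa> / 2"
    proof -
      have "ln (real a) \<le> ln (real b powr (1 - \<kappa>))" using ap a1 b2 by (subst ln_le_cancel_iff) auto
      also have "\<dots> = (1 - \<kappa>) * l" using b2 by (simp add: ln_powr l_def)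
      finally have "\<kappa> * l - C1 \<le> l - ln (real a) - C1" by (simp add: algebra_simps)
      also have "\<dots> \<le> (\<Sum>p\<in>W. ln (real p) / real p)" unfolding W_def l_def by (rule C1(2)[OF a1 ab])
      also have "\<dots> \<le> (\<Sum>p\<in>W. l * (1 / real p))"
      proof (rule sum_mono)
        fix p assume p: "p \<in> W"
        hence "ln (real p) \<le> l" unfolding l_def using a1 by (subst ln_le_cancel_iff) (auto simp: W_def)
        thus "ln (real p) / real p \<le> l * (1 / real p)" by (simp add: divide_right_mono)
      qed
      also have "\<dots> = l * \<mu>" by (simp add: \<mu>_def sum_distrib_left)
      finally have 1: "\<kappa> * l - C1 \<le> l * \<mu>" .
      have "2 * C1 \<le> \<kappa> * l" using l5(3) \<kappa> by (simp add: divide_le_eq mult.commute)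
      hence "l * (\<kappa> / 2) \<le> l * \<mu>" using 1 by (simp add: mult.commute)
      thus ?thesis using l5 by simp
    qed
    \<comment> \<open>For p in the window, b^k / p exceeds b^(k-1) by at most the factor b^\<kappa>.
      The log gap including the additive 5 is at most 2 \<kappa> l, set against 2 l since k \<ge> 3,
      whence the error \<kappa> B.\<close>
    have window: "(g p - d k)\<^sup>2 \<le> 2 * (defect (b ^ k) p)\<^sup>2 + 2 * (\<kappa> * B)"
      if k: "3 * J \<le> k" "k \<le> 4 * J" and p: "p \<in> W" for k p
    proof -
      define M where "M = b ^ k div p"
      have pp: "prime p" "a < p" "p \<le> b" using p by (auto simp: W_def)
      have p0: "p > 0" using pp by simp
      have k3: "k \<ge> 3" using k J by simp
      have "b ^ (k - 1) * p \<le> b ^ (k - 1) * b" using pp by (intro mult_left_mono) auto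
      also have "\<dots> = b ^ k" using k3 by (metis One_nat_def Suc_diff_le diff_Suc_1 le_add_diff_inverse mult.commute numeral_3_eq_3 plus_1_eq_Suc power_Suc Suc_leD order_trans Suc_le_mono le0)
      finally have M1: "b ^ (k - 1) \<le> M" unfolding M_def using p0 by (simp add: less_eq_div_iff_mult_less_eq)
      have bk1: "b ^ (k - 1) \<ge> 2" using k3 by (intro bk2) auto
      have "real M \<le> real (b ^ k) / real p" unfolding M_def by (rule of_nat_div_le_of_nat)
      hence "ln (real M) \<le> ln (real (b ^ k) / real p)" using M1 bk1 p0 b2 by (subst ln_le_cancel_iff) auto
      also have "\<dots> = real k * l - ln (real p)" using p0 b2 by (subst ln_div) (auto simp: lk[simplified])
      finally have lnM': "ln (real M) \<le> real k * l - ln (real p)" .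
      have "real b powr (1 - \<kappa>) \<le> real p" using pp(2) bp1 unfolding a_def by linarith
      hence "ln (real b powr (1 - \<kappa>)) \<le> ln (real p)" using p0 b2 by (subst ln_le_cancel_iff) auto
      hence "(1 - \<kappa>) * l \<le> ln (real p)" using b2 by (simp add: ln_powr l_def)
      hence lnM: "ln (real M) \<le> real k * l - (1 - \<kappa>) * l" using lnM' by linarith
      have "(pmean g M - pmean g (b ^ (k - 1)))\<^sup>2 \<le> (\<beta> Z)\<^sup>2 * ((2 * \<kappa> * l) / (2 * l))"
      proof (rule pmean_diff_square_le[OF bk1 M1])
        have "M \<le> b ^ k" by (simp add: M_def)
        also have "\<dots> \<le> Z" unfolding Z_def using k by (intro bkl) auto
        finally show "M \<le> Z" .
        have "5 \<le> \<kappa> * l" using l5(2) \<kappa> by (simp add: divide_le_eq mult.commute)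
        moreover have "ln (real (b ^ (k - 1))) = real k * l - l" using k3 by (subst lk) (simp add: of_nat_diff algebra_simps)
        ultimately show "ln (real M) - ln (real (b ^ (k - 1))) + 5 \<le> 2 * \<kappa> * l"
          using lnM by (simp add: algebra_simps)
        show "0 < 2 * l" using l5 by simp
        have "2 * l \<le> real (k - 1) * l" using k3 l5 by (intro mult_right_mono) auto
        thus "2 * l \<le> ln (real (b ^ (k - 1)))" by (simp only: lk)
      qed
      also have "\<dots> = \<kappa> * B" using l5 by (simp add: B_def s_def)
      finally have 1: "(pmean g M - pmean g (b ^ (k - 1)))\<^sup>2 \<le> \<kappa> * B" .
      have "g p - d k = defect (b ^ k) p - (pmean g M - pmean g (b ^ (k - 1)))"
        by (simp add: d_def defect_def M_def)
      hence "(g p - d k)\<^sup>2 \<le> 2 * (defect (b ^ k) p)\<^sup>2 + 2 * (pmean g M - pmean g (b ^ (k - 1)))\<^sup>2"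
        by (simp only: square_minus_le)
      thus ?thesis using 1 by linarith
    qed
    \<comment> \<open>Both increments are compared with the same g p and averaged over the window.
      Division by its mass \<mu> is affordable because the defect energy was taken below \<kappa>^2
      B while \<mu> \<ge> \<kappa> / 2; the result 24 \<kappa> B is B / J^3 by the choice of
      \<kappa>.\<close>
    have dd: "real J * \<bar>d k - d m\<bar> \<le> r" if k: "3 * J \<le> k" "k \<le> 4 * J" and m: "3 * J \<le> m" "m \<le> 4 * J" for k m
    proof -
      have cube: "p ^ 3 \<le> b ^ k" if p: "p \<in> W" and k: "3 * J \<le> k" for p k
      proof -
        have "p ^ 3 \<le> b ^ 3" using p by (intro power_mono) (auto simp: W_def)
        also have "\<dots> \<le> b ^ k" using k J by (intro bkl) auto
        finally show ?thesis .
      qed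
      have sW: "(\<Sum>p\<in>W. 1 / real p * (defect (b ^ k) p)\<^sup>2) \<le> \<kappa>\<^sup>2 * B" if "3 * J \<le> k" "k \<le> 4 * J" for k
      proof -
        have "(\<Sum>p\<in>W. 1 / real p * (defect (b ^ k) p)\<^sup>2) \<le> defect_energy (b ^ k)"
          unfolding defect_energy_def using that cube by (intro sum_mono2 finite_cube_le) (auto simp: W_def)
        thus ?thesis using sumdef[OF that] by linarith
      qed
      have "\<mu> * (d k - d m)\<^sup>2 = (\<Sum>p\<in>W. 1 / real p * (d k - d m)\<^sup>2)" by (simp add: \<mu>_def sum_distrib_right)
      also have "\<dots> \<le> (\<Sum>p\<in>W. 4 * (1 / real p * (defect (b ^ k) p)\<^sup>2) + 4 * (1 / real p * (defect (b ^ m) p)\<^sup>2) + 8 * \<kappa> * B * (1 / real p))"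
      proof (rule sum_mono)
        fix p assume p: "p \<in> W"
        have "(d k - d m)\<^sup>2 \<le> 2 * (d k - g p)\<^sup>2 + 2 * (d m - g p)\<^sup>2" by (rule square_diff_le)
        also have "\<dots> \<le> 4 * (defect (b ^ k) p)\<^sup>2 + 4 * (defect (b ^ m) p)\<^sup>2 + 8 * \<kappa> * B"
          using window[OF k p] window[OF m p] by (simp add: power2_commute[of _ "g p"])
        finally have "1 / real p * (d k - d m)\<^sup>2 \<le> 1 / real p * (4 * (defect (b ^ k) p)\<^sup>2 + 4 * (defect (b ^ m) p)\<^sup>2 + 8 * \<kappa> * B)"
          by (intro mult_left_mono) auto
        thus "1 / real p * (d k - d m)\<^sup>2 \<le> 4 * (1 / real p * (defect (b ^ k) p)\<^sup>2) + 4 * (1 / real p * (defect (b ^ m) p)\<^sup>2) + 8 * \<kappa> * B * (1 / real p)"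
          by (simp add: add_divide_distrib)
      qed
      also have "\<dots> = 4 * (\<Sum>p\<in>W. 1 / real p * (defect (b ^ k) p)\<^sup>2) + 4 * (\<Sum>p\<in>W. 1 / real p * (defect (b ^ m) p)\<^sup>2) + 8 * \<kappa> * B * \<mu>"
        by (simp only: sum.distrib sum_distrib_left[symmetric] \<mu>_def)
      also have "\<dots> \<le> 4 * (\<kappa>\<^sup>2 * B) + 4 * (\<kappa>\<^sup>2 * B) + 8 * \<kappa> * B * \<mu>"
        using sW[OF k] sW[OF m] by (intro add_mono mult_left_mono order_refl) auto
      also have "\<dots> = 16 * \<kappa> * B * (\<kappa> / 2) + 8 * \<kappa> * B * \<mu>" by (simp add: power2_eq_square)
      also have "\<dots> \<le> 16 * \<kappa> * B * \<mu> + 8 * \<kappa> * B * \<mu>" using \<mu> \<kappa> B0 by (intro add_right_mono mult_left_mono) auto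
      also have "\<dots> = \<mu> * (24 * \<kappa> * B)" by simp
      finally have "(d k - d m)\<^sup>2 \<le> 24 * \<kappa> * B" using \<mu> \<kappa> by simp
      hence "(real J)\<^sup>2 * (d k - d m)\<^sup>2 \<le> (real J)\<^sup>2 * (24 * \<kappa> * B)" by (intro mult_left_mono) auto
      also have "\<dots> = B / real J" using J1 by (simp add: \<kappa>_def power2_eq_square power3_eq_cube)
      also have "\<dots> = r\<^sup>2" by (rule r2[symmetric])
      finally have "(real J * \<bar>d k - d m\<bar>)\<^sup>2 \<le> r\<^sup>2" by (simp add: power_mult_distrib)
      thus ?thesis using r0 by (rule power2_le_imp_le)
    qed
    \<comment> \<open>Any increment could represent the common value; the last one is taken, and the
      slope is this increment per unit of ln b.\<close>
    define D where "D = d (4 * J)"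
    define \<theta> where "\<theta> = D / l"
    have D: "\<bar>D\<bar> \<le> r"
    proof -
      have "(pmean g (b ^ (4 * J)) - pmean g (b ^ (4 * J - 1)))\<^sup>2 \<le> (\<beta> Z)\<^sup>2 * ((2 * l) / (2 * real J * l))"
      proof (rule pmean_diff_square_le)
        show "2 \<le> b ^ (4 * J - 1)" using J by (intro bk2) auto
        show "b ^ (4 * J - 1) \<le> b ^ (4 * J)" by (intro bkl) auto
        show "ln (real (b ^ (4 * J))) - ln (real (b ^ (4 * J - 1))) + 5 \<le> 2 * l"
          using J l5 unfolding lk by (simp add: of_nat_diff algebra_simps)
        show "0 < 2 * real J * l" using J1 l5 by simp
        have "2 * real J * l \<le> real (4 * J - 1) * l" using J l5 by (intro mult_right_mono) auto
        thus "2 * real J * l \<le> ln (real (b ^ (4 * J - 1)))" by (simp only: lk)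
      qed (simp add: Z_def)
      also have "\<dots> = r\<^sup>2" using l5 by (simp add: r2 B_def s_def)
      finally have "\<bar>D\<bar>\<^sup>2 \<le> r\<^sup>2" by (simp add: D_def d_def)
      thus ?thesis using r0 by (rule power2_le_imp_le)
    qed
    have bounds: "2 \<le> Z div p" "Z div p \<le> Z" "real (Z div p) \<le> real Z / real p" "Z \<le> 2 * (Z div p) * p"
      "b ^ (4 * J - j) \<le> Z div p" if p: "prime p" "p \<le> b ^ j" and j: "j \<le> J" for p j
    proof -
      have p0: "p > 0" using p by (simp add: prime_gt_0_nat)
      have "b ^ (4 * J - j) * p \<le> b ^ (4 * J - j) * b ^ j" using p by (intro mult_left_mono) auto
      also have "\<dots> = Z" unfolding Z_def using j by (simp flip: power_add)
      finally show M: "b ^ (4 * J - j) \<le> Z div p" using p0 by (simp add: less_eq_div_iff_mult_less_eq)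
      have "2 \<le> b ^ (4 * J - j)" using j J by (intro bk2) auto
      thus M2: "2 \<le> Z div p" using M by linarith
      show "Z div p \<le> Z" by simp
      show "real (Z div p) \<le> real Z / real p" by (rule of_nat_div_le_of_nat)
      have "Z = Z div p * p + Z mod p" by simp
      also have "\<dots> \<le> Z div p * p + 1 * p" using p0 by (intro add_left_mono) simp
      also have "\<dots> \<le> Z div p * p + Z div p * p" using M2 by (intro add_left_mono mult_right_mono) auto
      finally show "Z \<le> 2 * (Z div p) * p" by simp
    qed
    \<comment> \<open>Three errors of size at most r = s / sqrt J add up: moving from Z / p to the
      nearest lower power b^(4J-j), replacing j increments by D, and rounding ln p / ln b up to j.
      Squared and doubled they give 18 B / J.\<close>
    have large: "(g p - \<theta> * ln (real p))\<^sup>2 \<le> 2 * (defect Z p)\<^sup>2 + 18 * B / real J"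
      if p: "prime p" "b < p" "p \<le> b ^ J" for p
    proof -
      define M where "M = Z div p"
      define x where "x = ln (real p) / l"
      define j where "j = nat \<lceil>x\<rceil>"
      have p0: "p > 0" using p by (simp add: prime_gt_0_nat)
      have xl: "x * l = ln (real p)" using l5 by (simp add: x_def)
      have "l < ln (real p)" unfolding l_def using p b2 by (subst ln_less_cancel_iff) auto
      hence x1: "x > 1" unfolding x_def using l5 by (simp add: less_divide_eq)
      hence jx: "x \<le> real j" "real j < x + 1" unfolding j_def by linarith+
      have "ln (real p) \<le> ln (real (b ^ J))" using p0 p(3) by (rule ln_of_nat_mono)
      hence "ln (real p) \<le> real J * l" by (simp only: lk)
      hence "x \<le> real J" unfolding x_def using l5(1) by (simp add: divide_le_eq)
      hence jJ: "j \<le> J" unfolding j_def by linarith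
      have j1: "j \<ge> 1" using x1 jx by linarith
      have pj: "p \<le> b ^ j"
      proof -
        have "x * l \<le> real j * l" using jx l5(1) by (intro mult_right_mono) auto
        hence "ln (real p) \<le> ln (real (b ^ j))" by (simp only: lk xl)
        moreover have "real (b ^ j) > 0" "real p > 0" using p0 b2 by simp_all
        ultimately have "real p \<le> real (b ^ j)" by (simp only: ln_le_cancel_iff)
        thus ?thesis by (simp only: of_nat_le_iff)
      qed
      note M = bounds[OF p(1) pj jJ, folded M_def]
      have "ln (real M) \<le> ln (real Z / real p)" using M p0 b2 by (subst ln_le_cancel_iff) (auto simp: Z_def)
      also have "\<dots> = ln (real Z) - ln (real p)" using p0 b2 by (subst ln_div) (auto simp: Z_def)
      also have "\<dots> = real (4 * J) * l - x * l" by (simp only: xl Z_def lk)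
      finally have lnM: "ln (real M) \<le> real (4 * J) * l - x * l" .
      have e1: "(pmean g M - pmean g (b ^ (4 * J - j)))\<^sup>2 \<le> r\<^sup>2"
      proof -
        have "(pmean g M - pmean g (b ^ (4 * J - j)))\<^sup>2 \<le> (\<beta> Z)\<^sup>2 * ((2 * l) / (2 * real J * l))"
        proof (rule pmean_diff_square_le)
          show "2 \<le> b ^ (4 * J - j)" using jJ J by (intro bk2) auto
          show "b ^ (4 * J - j) \<le> M" "M \<le> Z" by (rule M)+
          have "(real j - x) * l \<le> 1 * l" using jx l5 by (intro mult_right_mono) auto
          hence "ln (real M) - ln (real (b ^ (4 * J - j))) \<le> l"
            using lnM jJ unfolding lk by (simp add: of_nat_diff algebra_simps)
          thus "ln (real M) - ln (real (b ^ (4 * J - j))) + 5 \<le> 2 * l" using l5 by linarith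
          show "0 < 2 * real J * l" using J1 l5 by simp
          have "2 * real J * l \<le> real (4 * J - j) * l" using jJ l5 by (intro mult_right_mono) auto
          thus "2 * real J * l \<le> ln (real (b ^ (4 * J - j)))" by (simp only: lk)
        qed
        also have "\<dots> = r\<^sup>2" using l5 by (simp add: r2 B_def s_def)
        finally show ?thesis .
      qed
      hence "\<bar>pmean g M - pmean g (b ^ (4 * J - j))\<bar>\<^sup>2 \<le> r\<^sup>2" by (simp only: power2_abs)
      hence e1: "\<bar>pmean g M - pmean g (b ^ (4 * J - j))\<bar> \<le> r" using r0 by (rule power2_le_imp_le)
      have tel: "pmean g Z - pmean g (b ^ (4 * J - j)) = (\<Sum>i<j. d (4 * J - i))"
        using diff_telescope[of "\<lambda>k. pmean g (b ^ k)" "4 * J" j] unfolding Z_def d_def .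
      have e2: "\<bar>(\<Sum>i<j. d (4 * J - i)) - real j * D\<bar> \<le> r"
      proof -
        have "\<bar>(\<Sum>i<j. d (4 * J - i)) - real (card {..<j}) * D\<bar> \<le> real (card {..<j}) * (r / real J)"
        proof (rule sum_abs_diff_const_le)
          fix i assume "i \<in> {..<j}"
          hence "real J * \<bar>d (4 * J - i) - D\<bar> \<le> r" unfolding D_def using jJ by (intro dd) auto
          thus "\<bar>d (4 * J - i) - D\<bar> \<le> r / real J" using J1 by (simp add: le_divide_eq mult.commute)
        qed auto
        also have "real (card {..<j}) * (r / real J) \<le> real J * (r / real J)" using jJ r0 by (intro mult_right_mono) auto
        also have "\<dots> = r" using J1 by simp
        finally show ?thesis by simp
      qed
      have e3: "\<bar>real j * D - \<theta> * ln (real p)\<bar> \<le> r"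
      proof -
        have "\<theta> * ln (real p) = D * x" by (simp add: \<theta>_def x_def)
        hence "real j * D - \<theta> * ln (real p) = (real j - x) * D" by (simp add: algebra_simps)
        also have "\<bar>\<dots>\<bar> = \<bar>real j - x\<bar> * \<bar>D\<bar>" by (rule abs_mult)
        also have "\<dots> \<le> 1 * r" using jx D by (intro mult_mono) auto
        finally show ?thesis by simp
      qed
      have "\<bar>pmean g Z - pmean g M - \<theta> * ln (real p)\<bar> \<le> 3 * r" using e1 e2 e3 tel by linarith
      hence "\<bar>pmean g Z - pmean g M - \<theta> * ln (real p)\<bar>\<^sup>2 \<le> (3 * r)\<^sup>2" by (intro power_mono) auto
      hence e4: "(pmean g Z - pmean g M - \<theta> * ln (real p))\<^sup>2 \<le> 9 * B / real J" by (simp add: power_mult_distrib r2)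
      have "g p - \<theta> * ln (real p) = defect Z p + (pmean g Z - pmean g M - \<theta> * ln (real p))"
        by (simp add: defect_def M_def)
      hence "(g p - \<theta> * ln (real p))\<^sup>2 \<le> 2 * (defect Z p)\<^sup>2 + 2 * (pmean g Z - pmean g M - \<theta> * ln (real p))\<^sup>2"
        by (simp only: square_plus_le)
      thus ?thesis using e4 by linarith
    qed
    \<comment> \<open>For p \<le> b the error must shrink with ln p, because the sum of 1 / p over
      these primes is unbounded, whereas that of ln p / p is at most 2 l. Since y \<ge> 1/2, the log
      gap plus 5 is at most 13 y; the constant is 56 = 2 (2 + 26).\<close>
    have small: "(g p - \<theta> * ln (real p))\<^sup>2 \<le> 2 * (defect Z p)\<^sup>2 + 56 * B / (real J * l) * ln (real p)"
      if p: "prime p" "p \<le> b" for p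
    proof -
      define M where "M = Z div p"
      define y where "y = ln (real p)"
      have p2: "p \<ge> 2" using p prime_ge_2_nat by simp
      have "ln 2 \<le> y" unfolding y_def using p2 by simp
      hence y: "1 / 2 \<le> y" using ln2_ge_two_thirds by linarith
      have yl: "y \<le> l" unfolding y_def l_def using p p2 by simp
      have p1: "p \<le> b ^ 1" using p by simp
      note M = bounds[OF p(1) p1 J, folded M_def]
      have "(pmean g Z - pmean g M)\<^sup>2 \<le> (\<beta> Z)\<^sup>2 * ((13 * y) / (real J * l))"
      proof (rule pmean_diff_square_le)
        show "2 \<le> M" "M \<le> Z" by (use M in auto)
        have "real Z \<le> real (2 * M * p)" using M(4) by (simp only: of_nat_le_iff)
        moreover have "real Z > 0" using b2 by (simp add: Z_def)
        ultimately have "ln (real Z) \<le> ln (2 * real M * real p)" by (subst ln_le_cancel_iff) auto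
        also have "\<dots> = ln 2 + ln (real M) + y" using M p2 by (simp add: ln_mult y_def)
        finally show "ln (real Z) - ln (real M) + 5 \<le> 13 * y" using y ln_2_less_1 by linarith
        show "0 < real J * l" using J1 l5 by simp
        have "real J * l \<le> real (4 * J - 1) * l" using J l5 by (intro mult_right_mono) auto
        also have "\<dots> = ln (real (b ^ (4 * J - 1)))" by (simp only: lk)
        also have "\<dots> \<le> ln (real M)"
        proof -
          have "b ^ (4 * J - 1) \<le> M" "b ^ (4 * J - 1) > 0" using M b2 by auto
          thus ?thesis by (intro ln_of_nat_mono) auto
        qed
        finally show "real J * l \<le> ln (real M)" .
      qed auto
      hence e1: "(pmean g Z - pmean g M)\<^sup>2 \<le> 13 * B / (real J * l) * y" by (simp add: B_def s_def mult_ac)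
      have e2: "(\<theta> * y)\<^sup>2 \<le> B / (real J * l) * y"
      proof -
        have "D\<^sup>2 \<le> r\<^sup>2" using D by (metis abs_ge_zero power2_abs power_mono)
        hence "D\<^sup>2 * (y / l * (y / l)) \<le> (B / real J) * (y / l * 1)"
          using y yl l5 B0 J1 unfolding r2 by (intro mult_mono) auto
        thus ?thesis using l5 by (simp add: \<theta>_def power2_eq_square mult_ac)
      qed
      have "g p - \<theta> * y = defect Z p - (\<theta> * y - (pmean g Z - pmean g M))"
        by (simp add: defect_def M_def)
      hence "(g p - \<theta> * y)\<^sup>2 \<le> 2 * (defect Z p)\<^sup>2 + 2 * (\<theta> * y - (pmean g Z - pmean g M))\<^sup>2"
        by (simp only: square_minus_le)
      also have "(\<theta> * y - (pmean g Z - pmean g M))\<^sup>2 \<le> 2 * (\<theta> * y)\<^sup>2 + 2 * (pmean g Z - pmean g M)\<^sup>2"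
        by (rule square_minus_le)
      also have "\<dots> \<le> 2 * (B / (real J * l) * y) + 2 * (13 * B / (real J * l) * y)"
        using e1 e2 by (intro add_mono mult_left_mono) auto
      finally show ?thesis by (simp add: y_def algebra_simps)
    qed
    have "(\<Sum>p\<in>primes_le (b ^ J). 1 / real p * (g p - \<theta> * ln (real p))\<^sup>2) \<le>
       (\<Sum>p\<in>primes_le (b ^ J). 2 * (1 / real p * (defect Z p)\<^sup>2) + (if p \<le> b then 56 * B / (real J * l) * (ln (real p) / real p) else 0)
          + (if b < p then 18 * B / real J * (1 / real p) else 0))"
    proof (rule sum_mono)
      fix p assume p: "p \<in> primes_le (b ^ J)"
      show "1 / real p * (g p - \<theta> * ln (real p))\<^sup>2 \<le> 2 * (1 / real p * (defect Z p)\<^sup>2) + (if p \<le> b then 56 * B / (real J * l) * (ln (real p) / real p) else 0)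
          + (if b < p then 18 * B / real J * (1 / real p) else 0)"
      proof (cases "p \<le> b")
        case True
        have "1 / real p * (g p - \<theta> * ln (real p))\<^sup>2 \<le> 1 / real p * (2 * (defect Z p)\<^sup>2 + 56 * B / (real J * l) * ln (real p))"
          using p True by (intro mult_left_mono small) auto
        thus ?thesis using True by (simp add: add_divide_distrib)
      next
        case False
        have "1 / real p * (g p - \<theta> * ln (real p))\<^sup>2 \<le> 1 / real p * (2 * (defect Z p)\<^sup>2 + 18 * B / real J)"
          using p False by (intro mult_left_mono large) auto
        thus ?thesis using False by (simp add: add_divide_distrib mult.commute)
      qed
    qed
    also have "\<dots> = 2 * (\<Sum>p\<in>primes_le (b ^ J). 1 / real p * (defect Z p)\<^sup>2)
        + (\<Sum>p\<in>primes_le (b ^ J). if p \<le> b then 56 * B / (real J * l) * (ln (real p) / real p) else 0)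
        + (\<Sum>p\<in>primes_le (b ^ J). if b < p then 18 * B / real J * (1 / real p) else 0)"
      by (simp only: sum.distrib sum_distrib_left[symmetric])
    also have "(\<Sum>p\<in>primes_le (b ^ J). if p \<le> b then 56 * B / (real J * l) * (ln (real p) / real p) else 0) =
       56 * B / (real J * l) * (\<Sum>p\<in>primes_le b. ln (real p) / real p)"
      unfolding sum_distrib_left using self_le_power[of b J] b2 J
      by (intro sum.mono_neutral_cong_right) auto
    also have "(\<Sum>p\<in>primes_le (b ^ J). if b < p then 18 * B / real J * (1 / real p) else 0) =
       18 * B / real J * (\<Sum>p | prime p \<and> b < p \<and> p \<le> b ^ J. 1 / real p)"
      unfolding sum_distrib_left by (intro sum.mono_neutral_cong_right) auto
    also have "(\<Sum>p\<in>primes_le (b ^ J). 1 / real p * (defect Z p)\<^sup>2) \<le> defect_energy Z"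
      unfolding defect_energy_def
    proof (intro sum_mono2 finite_cube_le)
      show "primes_le (b ^ J) \<subseteq> {p. prime p \<and> p ^ 3 \<le> Z}"
      proof
        fix p assume p: "p \<in> primes_le (b ^ J)"
        have "p ^ 3 \<le> (b ^ J) ^ 3" using p by (intro power_mono) auto
        also have "\<dots> = b ^ (J * 3)" by (rule power_mult[symmetric])
        also have "\<dots> \<le> Z" unfolding Z_def by (intro bkl) auto
        finally show "p \<in> {p. prime p \<and> p ^ 3 \<le> Z}" using p by simp
      qed
    qed auto
    also have "\<dots> \<le> \<kappa>\<^sup>2 * B" unfolding Z_def by (rule sumdef) auto
    also have "\<kappa>\<^sup>2 * B \<le> 1 / real J * B"
    proof (rule mult_right_mono[OF _ B0])
      have "\<kappa> * \<kappa> \<le> \<kappa> * 1" using \<kappa> by (intro mult_left_mono) auto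
      thus "\<kappa>\<^sup>2 \<le> 1 / real J" unfolding power2_eq_square using \<kappa>(2) by linarith
    qed
    also have "(\<Sum>p\<in>primes_le b. ln (real p) / real p) \<le> 2 * l"
      using sum_ln_prime_div_le[of b] b2 l5 by (simp add: l_def)
    also have "56 * B / (real J * l) * (2 * l) = 112 * (1 / real J * B)" using l5 by simp
    also have "(\<Sum>p | prime p \<and> b < p \<and> p \<le> b ^ J. 1 / real p) \<le> 6 * sqrt (real J)"
      using l5 J unfolding l_def by (intro sum_prime_recip_powers_le) auto
    also have "18 * B / real J * (6 * sqrt (real J)) = 108 * (1 / sqrt (real J) * B)"
    proof -
      have "sqrt (real J) / real J = 1 / sqrt (real J)" using J1 by (simp add: real_div_sqrt field_simps)
      moreover have "18 * B / real J * (6 * sqrt (real J)) = 108 * (sqrt (real J) / real J * B)" by simp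
      ultimately show ?thesis by (simp only:)
    qed
    \<comment> \<open>The constant 222 is 2 + 112 + 108: the defect energy, the primes up to b, and
      the primes from b to b^J. Only the last group forces sqrt J instead of J.\<close>
    also have "2 * (1 / real J * B) + 112 * (1 / real J * B) + 108 * (1 / sqrt (real J) * B) \<le>
      2 * (1 / sqrt (real J) * B) + 112 * (1 / sqrt (real J) * B) + 108 * (1 / sqrt (real J) * B)"
    proof -
      have "sqrt (real J) * 1 \<le> sqrt (real J) * sqrt (real J)" using J1 by (intro mult_left_mono) auto
      hence "1 / real J \<le> 1 / sqrt (real J)" using J1 by (intro divide_left_mono) auto
      thus ?thesis using B0 by (intro add_mono mult_left_mono mult_right_mono) auto
    qed
    finally show ?case
      using B0 l5 J1 by (intro exI[of _ \<theta>]) (simp add: B_def s_def Z_def mult_left_mono divide_right_mono)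
  qed
qed

end

section \<open>Projection onto the logarithm\<close>

definition log_energy :: "real \<Rightarrow> real" where
  "log_energy X = (\<Sum>q\<in>prime_powers_upto X. (ln (real q))\<^sup>2 / real q)"

definition log_distance :: "(nat \<Rightarrow> real) \<Rightarrow> real \<Rightarrow> real \<Rightarrow> real" where
  "log_distance g X \<theta> = (\<Sum>q\<in>prime_powers_upto X. (g q - \<theta> * ln (real q))\<^sup>2 / real q)"

text \<open>The coefficient of the orthogonal projection of g onto the logarithm.\<close>
definition log_coeff :: "(nat \<Rightarrow> real) \<Rightarrow> real \<Rightarrow> real" where
  "log_coeff g X = (\<Sum>q\<in>prime_powers_upto X. g q * ln (real q) / real q) / log_energy X"

lemma log_distance_expand:
  "log_distance g X \<theta> = (B_add g X)\<^sup>2 - 2 * \<theta> * (\<Sum>q\<in>prime_powers_upto X. g q * ln (real q) / real q) + \<theta>\<^sup>2 * log_energy X"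
proof -
  have "log_distance g X \<theta> = (\<Sum>q\<in>prime_powers_upto X. (g q)\<^sup>2 / real q - 2 * \<theta> * (g q * ln (real q) / real q) + \<theta>\<^sup>2 * ((ln (real q))\<^sup>2 / real q))"
    unfolding log_distance_def
    by (intro sum.cong refl) (simp add: power2_diff power_mult_distrib add_divide_distrib diff_divide_distrib algebra_simps)
  thus ?thesis
    by (simp add: B_add_sq log_energy_def sum.distrib sum_subtractf sum_distrib_left)
qed

text \<open>Pythagoras in the space of functions on prime powers up to X with weight 1 / q; in
  particular \<open>log_coeff\<close> minimises the distance.\<close>

lemma log_distance_projection:
  assumes "log_energy X > 0"
  shows "log_distance g X \<theta> = log_distance g X (log_coeff g X) + log_energy X * (\<theta> - log_coeff g X)\<^sup>2"
proof -
  define S where "S = (\<Sum>q\<in>prime_powers_upto X. g q * ln (real q) / real q)"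
  have "S = log_coeff g X * log_energy X" using assms by (simp add: log_coeff_def S_def)
  thus ?thesis unfolding log_distance_expand S_def[symmetric] by (simp add: power2_eq_square algebra_simps)
qed

lemma log_distance_0: "log_distance g X 0 = (B_add g X)\<^sup>2"
  by (simp add: log_distance_expand)

lemma log_distance_nonneg: "log_distance g X \<theta> \<ge> 0"
  by (simp add: log_distance_def sum_nonneg)

lemma log_distance_mono: "X \<le> Y \<Longrightarrow> log_distance g X \<theta> \<le> log_distance g Y \<theta>"
  unfolding log_distance_def
  by (intro sum_mono2 finite_prime_powers_upto) (auto simp: prime_powers_upto_def)

text \<open>On the prime powers up to X both multiples of the logarithm are close to g, hence to
  each other; restricting the distance at Y to these prime powers can only decrease it.\<close>

lemma log_coeff_diff_le:
  assumes "X \<le> Y"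
  shows "log_energy X * (log_coeff g Y - log_coeff g X)\<^sup>2 \<le>
     2 * log_distance g Y (log_coeff g Y) + 2 * log_distance g X (log_coeff g X)"
proof -
  define u v where "u = log_coeff g Y" and "v = log_coeff g X"
  have "log_energy X * (u - v)\<^sup>2 = (\<Sum>q\<in>prime_powers_upto X. (u * ln (real q) - v * ln (real q))\<^sup>2 / real q)"
    unfolding log_energy_def sum_distrib_right
    by (intro sum.cong refl) (simp add: power_mult_distrib flip: left_diff_distrib)
  also have "\<dots> \<le> (\<Sum>q\<in>prime_powers_upto X. 2 * ((g q - u * ln (real q))\<^sup>2 / real q) + 2 * ((g q - v * ln (real q))\<^sup>2 / real q))"
  proof (rule sum_mono)
    fix q
    have "(u * ln (real q) - v * ln (real q))\<^sup>2 \<le> 2 * (u * ln (real q) - g q)\<^sup>2 + 2 * (v * ln (real q) - g q)\<^sup>2"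
      by (rule square_diff_le)
    hence "(u * ln (real q) - v * ln (real q))\<^sup>2 / real q \<le> (2 * (u * ln (real q) - g q)\<^sup>2 + 2 * (v * ln (real q) - g q)\<^sup>2) / real q"
      by (intro divide_right_mono) auto
    thus "(u * ln (real q) - v * ln (real q))\<^sup>2 / real q \<le> 2 * ((g q - u * ln (real q))\<^sup>2 / real q) + 2 * ((g q - v * ln (real q))\<^sup>2 / real q)"
      by (simp add: add_divide_distrib power2_commute[of "g q"])
  qed
  also have "\<dots> = 2 * log_distance g X u + 2 * log_distance g X v"
    by (simp add: log_distance_def sum.distrib sum_distrib_left)
  also have "\<dots> \<le> 2 * log_distance g Y u + 2 * log_distance g X v"
    using log_distance_mono[OF assms] by simp
  finally show ?thesis by (simp add: u_def v_def)
qed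

lemma ln_floor_ge: "X \<ge> 4 \<Longrightarrow> ln X / 2 \<le> ln (real (nat \<lfloor>X\<rfloor>))"
proof -
  assume X: "X \<ge> 4"
  have "sqrt X * 2 \<le> sqrt X * sqrt X" using X by (intro mult_left_mono real_le_rsqrt) auto
  hence "sqrt X \<le> X / 2" using X by simp
  also have "\<dots> \<le> real (nat \<lfloor>X\<rfloor>)" using X by linarith
  finally have "ln (sqrt X) \<le> ln (real (nat \<lfloor>X\<rfloor>))" using X by (subst ln_le_cancel_iff) auto
  thus ?thesis using X by (simp add: ln_sqrt)
qed

lemma log_energy_ge: "\<forall>\<^sub>F X in at_top. (ln X)\<^sup>2 / 32 \<le> log_energy X"
  using eventually_nat_floor[OF sum_ln_square_prime_ge] eventually_ge_at_top[of 4]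
proof eventually_elim
  case (elim X)
  define N where "N = nat \<lfloor>X\<rfloor>"
  have "(ln X / 2)\<^sup>2 \<le> (ln (real N))\<^sup>2"
    using elim ln_floor_ge[of X] by (intro power_mono) (auto simp: N_def)
  hence "(ln X)\<^sup>2 / 32 \<le> (ln (real N))\<^sup>2 / 8" by (simp add: power_divide)
  also have "\<dots> \<le> (\<Sum>p\<in>primes_le N. (ln (real p))\<^sup>2 / real p)" using elim by (simp add: N_def)
  also have "\<dots> \<le> log_energy X" unfolding log_energy_def
  proof (intro sum_mono2 finite_prime_powers_upto)
    have "real N \<le> X" using elim by (simp add: N_def)
    thus "primes_le N \<subseteq> prime_powers_upto X" by (auto simp: prime_powers_upto_def)
  qed auto
  finally show ?case .
qed

context almost_increasing
begin

text \<open>A general X is enclosed by taking b just above X^(1/J): the added 1 gives X \<le> b^J,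
  and b is at most twice X^(1/J). The growth bound then brings B from b^(4J) \<le> X^5 back to
  X.\<close>

lemma approximation_at_primes:
  assumes \<eta>: "\<eta> > 0"
  shows "\<forall>\<^sub>F X::real in at_top. \<exists>\<theta>. (\<Sum>p\<in>primes_le (nat \<lfloor>X\<rfloor>). 1 / real p * (g p - \<theta> * ln (real p))\<^sup>2) \<le> \<eta> * (B_add g X)\<^sup>2"
proof -
  obtain C where C: "C > 0" "\<forall>\<^sub>F X::real in at_top. (B_add g (X powr 5))\<^sup>2 \<le> C * (B_add g X)\<^sup>2"
    using growth by blast
  \<comment> \<open>The growth constant C is known before J is chosen and does not depend on it, so
    J can make 222 C / sqrt J at most \<eta>.\<close>
  define J where "J = nat \<lceil>(222 * C / \<eta>)\<^sup>2\<rceil> + 1"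
  have J: "J \<ge> 1" by (simp add: J_def)
  have "(222 * C / \<eta>)\<^sup>2 \<le> real (nat \<lceil>(222 * C / \<eta>)\<^sup>2\<rceil>)" by (rule real_nat_ceiling_ge)
  hence "(222 * C / \<eta>)\<^sup>2 \<le> real J" by (rule order_trans) (simp add: J_def)
  hence "222 * C / \<eta> \<le> sqrt (real J)" by (rule real_le_rsqrt)
  hence J\<eta>: "222 / sqrt (real J) * C \<le> \<eta>" using \<eta> J by (simp add: field_simps)
  define bb where "bb = (\<lambda>X::real. nat \<lfloor>X powr (1 / real J)\<rfloor> + 1)"
  have lim: "filterlim bb sequentially at_top"
  proof -
    have "filterlim (\<lambda>X::real. X powr (1 / real J)) at_top at_top" using J by real_asymp
    hence "filterlim (\<lambda>X::real. nat \<lfloor>X powr (1 / real J)\<rfloor>) sequentially at_top"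
      by (intro filterlim_compose[OF filterlim_nat_sequentially] filterlim_compose[OF filterlim_floor_sequentially])
    thus ?thesis unfolding bb_def
      by (rule filterlim_at_top_mono) simp
  qed
  show ?thesis
    using eventually_compose_filterlim[OF approximation_at_powers[OF J] lim] C(2)
      eventually_ge_at_top[of 1] eventually_ge_at_top[of "2 ^ (4 * J)"]
  proof eventually_elim
    case (elim X)
    define b where "b = bb X"
    define t where "t = X powr (1 / real J)"
    obtain \<theta> where \<theta>: "(\<Sum>p\<in>primes_le (b ^ J). 1 / real p * (g p - \<theta> * ln (real p))\<^sup>2)
      \<le> 222 / sqrt (real J) * (\<beta> (b ^ (4 * J)))\<^sup>2" using elim by (auto simp: b_def)
    have X1: "X \<ge> 1" using elim(3) .
    have t1: "t \<ge> 1" unfolding t_def using X1 J by (intro ge_one_powr_ge_zero) auto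
    hence "t ^ J = t powr real J" by (intro powr_realpow[symmetric]) auto
    also have "\<dots> = X powr (1 / real J * real J)" unfolding t_def by (rule powr_powr)
    also have "\<dots> = X" using X1 J by simp
    finally have tJ: "t ^ J = X" .
    have bt: "t \<le> real b" "real b \<le> 2 * t" unfolding b_def bb_def t_def[symmetric] using t1 by linarith+
    have "X \<le> real b ^ J" using bt(1) t1 unfolding tJ[symmetric] by (intro power_mono) auto
    hence Xb: "nat \<lfloor>X\<rfloor> \<le> b ^ J" by (simp add: nat_le_iff floor_le_iff flip: of_nat_power)
    have "real (b ^ (4 * J)) \<le> (2 * t) ^ (4 * J)" unfolding of_nat_power using bt(2) by (intro power_mono) auto
    also have "\<dots> = 2 ^ (4 * J) * t ^ (J * 4)" by (simp only: power_mult_distrib mult.commute)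
    also have "t ^ (J * 4) = X ^ 4" by (simp only: power_mult tJ)
    also have "2 ^ (4 * J) * X ^ 4 \<le> X * X ^ 4" using elim(4) by (intro mult_right_mono) auto
    also have "\<dots> = X ^ 5" by (simp add: eval_nat_numeral)
    also have "\<dots> = X powr 5" using powr_realpow[of X 5] X1 by simp
    finally have "B_add g (real (b ^ (4 * J))) \<le> B_add g (X powr 5)" by (rule B_add_mono)
    hence "(\<beta> (b ^ (4 * J)))\<^sup>2 \<le> (B_add g (X powr 5))\<^sup>2" by (intro power_mono B_add_nonneg)
    also have "\<dots> \<le> C * (B_add g X)\<^sup>2" using elim(2) .
    finally have "222 / sqrt (real J) * (\<beta> (b ^ (4 * J)))\<^sup>2 \<le> 222 / sqrt (real J) * (C * (B_add g X)\<^sup>2)"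
      by (intro mult_left_mono) auto
    also have "\<dots> = (222 / sqrt (real J) * C) * (B_add g X)\<^sup>2" by simp
    also have "\<dots> \<le> \<eta> * (B_add g X)\<^sup>2" using J\<eta> by (intro mult_right_mono) auto
    finally have "(\<Sum>p\<in>primes_le (b ^ J). 1 / real p * (g p - \<theta> * ln (real p))\<^sup>2) \<le> \<eta> * (B_add g X)\<^sup>2"
      using \<theta> by linarith
    moreover have "(\<Sum>p\<in>primes_le (nat \<lfloor>X\<rfloor>). 1 / real p * (g p - \<theta> * ln (real p))\<^sup>2) \<le>
       (\<Sum>p\<in>primes_le (b ^ J). 1 / real p * (g p - \<theta> * ln (real p))\<^sup>2)"
      using Xb by (intro sum_mono2) auto
    ultimately show ?case by (intro exI[of _ \<theta>]) linarith
  qed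
qed

text \<open>At proper prime powers g is small by hypothesis, and \<theta> ln q is small because
  \<theta> = O(B / ln X) while the logarithm has bounded energy there. The unspecified \<theta> is
  finally replaced by the minimising coefficient.\<close>

lemma log_distance_small:
  assumes \<eta>: "\<eta> > 0"
  shows "\<forall>\<^sub>F X::real in at_top. log_distance g X (log_coeff g X) \<le> \<eta> * (B_add g X)\<^sup>2"
proof -
  obtain C where C: "C > 0" "\<And>X. (\<Sum>q\<in>higher_prime_powers_upto X. (ln (real q))\<^sup>2 / real q) \<le> C"
    using sum_higher_prime_powers_le by blast
  define \<eta>1 where "\<eta>1 = min 1 (\<eta> / 2)"
  have \<eta>1: "\<eta>1 > 0" "\<eta>1 \<le> 1" "\<eta>1 \<le> \<eta> / 2" using \<eta> by (auto simp: \<eta>1_def)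
  have \<eta>8: "\<eta> / 8 > 0" using \<eta> by simp
  have "((\<lambda>X::real. 256 * C * (1 / (ln X)\<^sup>2)) \<longlongrightarrow> 256 * C * 0) at_top"
    by (intro tendsto_mult tendsto_const) real_asymp
  hence small: "\<forall>\<^sub>F X::real in at_top. 256 * C * (1 / (ln X)\<^sup>2) < \<eta> / 4"
    using order_tendstoD(2)[of "\<lambda>X::real. 256 * C * (1 / (ln X)\<^sup>2)" 0 at_top "\<eta> / 4"] \<eta> by simp
  show ?thesis
    using approximation_at_primes[OF \<eta>1(1)] higher_small[OF \<eta>8] small log_energy_ge
      eventually_nat_floor[OF sum_ln_square_prime_ge] eventually_ge_at_top[of 4]
  proof eventually_elim
    case (elim X)
    define N where "N = nat \<lfloor>X\<rfloor>"
    define B where "B = (B_add g X)\<^sup>2"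
    define h where "h = (\<lambda>q \<theta>. (g q - \<theta> * ln (real q))\<^sup>2 / real q)"
    obtain \<theta> where "(\<Sum>p\<in>primes_le N. 1 / real p * (g p - \<theta> * ln (real p))\<^sup>2) \<le> \<eta>1 * B"
      using elim by (auto simp: N_def B_def)
    hence \<theta>: "(\<Sum>p\<in>primes_le N. h p \<theta>) \<le> \<eta>1 * B" by (simp add: h_def)
    have B0: "B \<ge> 0" by (simp add: B_def)
    have lX: "ln X > 0" using elim by simp
    have NX: "real N \<le> X" using elim by (simp add: N_def)
    have subN: "primes_le N \<subseteq> prime_powers_upto X" using NX by (auto simp: prime_powers_upto_def)
    \<comment> \<open>The size of \<theta> is recovered from the approximation itself: on primes
      \<theta> ln p is close to g, whose energy is at most B, whereas the logarithm has energy of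
      order (ln X)^2.\<close>
    have "\<theta>\<^sup>2 * ((ln X)\<^sup>2 / 32) \<le> 4 * B"
    proof -
      have "(ln X / 2)\<^sup>2 \<le> (ln (real N))\<^sup>2"
        using elim ln_floor_ge[of X] by (intro power_mono) (auto simp: N_def)
      hence "(ln X)\<^sup>2 / 32 \<le> (ln (real N))\<^sup>2 / 8" by (simp add: power_divide)
      also have "\<dots> \<le> (\<Sum>p\<in>primes_le N. (ln (real p))\<^sup>2 / real p)" using elim by (simp add: N_def)
      finally have "\<theta>\<^sup>2 * ((ln X)\<^sup>2 / 32) \<le> \<theta>\<^sup>2 * (\<Sum>p\<in>primes_le N. (ln (real p))\<^sup>2 / real p)"
        by (intro mult_left_mono) auto
      also have "\<dots> = (\<Sum>p\<in>primes_le N. (\<theta> * ln (real p))\<^sup>2 / real p)" by (simp add: sum_distrib_left power_mult_distrib)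
      also have "\<dots> \<le> (\<Sum>p\<in>primes_le N. 2 * h p \<theta> + 2 * ((g p)\<^sup>2 / real p))"
      proof (rule sum_mono)
        fix p
        have "(\<theta> * ln (real p))\<^sup>2 \<le> 2 * (g p - \<theta> * ln (real p))\<^sup>2 + 2 * (g p)\<^sup>2"
          using square_diff_le[of "\<theta> * ln (real p)" 0 "g p"] by (simp add: power2_commute[of "g p"])
        hence "(\<theta> * ln (real p))\<^sup>2 / real p \<le> (2 * (g p - \<theta> * ln (real p))\<^sup>2 + 2 * (g p)\<^sup>2) / real p"
          by (intro divide_right_mono) auto
        thus "(\<theta> * ln (real p))\<^sup>2 / real p \<le> 2 * h p \<theta> + 2 * ((g p)\<^sup>2 / real p)" by (simp add: h_def add_divide_distrib)
      qed
      also have "\<dots> = 2 * (\<Sum>p\<in>primes_le N. h p \<theta>) + 2 * (\<Sum>p\<in>primes_le N. (g p)\<^sup>2 / real p)"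
        by (simp add: sum.distrib sum_distrib_left)
      also have "\<dots> \<le> 2 * (1 * B) + 2 * B"
      proof (intro add_mono mult_left_mono)
        show "(\<Sum>p\<in>primes_le N. h p \<theta>) \<le> 1 * B" using \<theta> mult_right_mono[OF \<eta>1(2) B0] by linarith
        show "(\<Sum>p\<in>primes_le N. (g p)\<^sup>2 / real p) \<le> B" unfolding B_def B_add_sq by (intro sum_mono2 subN) auto
      qed auto
      finally show ?thesis by simp
    qed
    hence \<theta>2: "\<theta>\<^sup>2 \<le> 128 * B * (1 / (ln X)\<^sup>2)" using lX by (simp add: field_simps)
    have "prime_powers_upto X \<subseteq> primes_le N \<union> higher_prime_powers_upto X"
    proof
      fix q assume q: "q \<in> prime_powers_upto X"
      then obtain p k where pk: "prime p" "k > 0" "q = p ^ k" "real q \<le> X"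
        by (auto simp: prime_powers_upto_def primepow_def)
      show "q \<in> primes_le N \<union> higher_prime_powers_upto X"
      proof (cases "k = 1")
        case True
        thus ?thesis using pk by (auto simp: N_def le_nat_floor)
      next
        case False
        hence "\<exists>p k. prime p \<and> k \<ge> 2 \<and> q = p ^ k"
          using pk by (intro exI[of _ p] exI[of _ k]) auto
        thus ?thesis using pk(4) by (simp add: higher_prime_powers_upto_def)
      qed
    qed
    hence "log_distance g X \<theta> \<le> (\<Sum>q\<in>primes_le N \<union> higher_prime_powers_upto X. h q \<theta>)"
      unfolding log_distance_def h_def by (intro sum_mono2) auto
    also have "\<dots> \<le> (\<Sum>q\<in>primes_le N. h q \<theta>) + (\<Sum>q\<in>higher_prime_powers_upto X. h q \<theta>)"
      using sum.union_inter[of "primes_le N" "higher_prime_powers_upto X" "\<lambda>q. h q \<theta>"]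
        sum_nonneg[of "primes_le N \<inter> higher_prime_powers_upto X" "\<lambda>q. h q \<theta>"] by (simp add: h_def)
    also have "(\<Sum>q\<in>higher_prime_powers_upto X. h q \<theta>) \<le>
       (\<Sum>q\<in>higher_prime_powers_upto X. 2 * ((g q)\<^sup>2 / real q) + 2 * \<theta>\<^sup>2 * ((ln (real q))\<^sup>2 / real q))"
    proof (rule sum_mono)
      fix q
      have "(g q - \<theta> * ln (real q))\<^sup>2 \<le> 2 * (g q)\<^sup>2 + 2 * (\<theta> * ln (real q))\<^sup>2" by (rule square_minus_le)
      hence "h q \<theta> \<le> (2 * (g q)\<^sup>2 + 2 * (\<theta> * ln (real q))\<^sup>2) / real q" unfolding h_def by (intro divide_right_mono) auto
      thus "h q \<theta> \<le> 2 * ((g q)\<^sup>2 / real q) + 2 * \<theta>\<^sup>2 * ((ln (real q))\<^sup>2 / real q)"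
        by (simp add: add_divide_distrib power_mult_distrib)
    qed
    also have "\<dots> = 2 * (\<Sum>q\<in>higher_prime_powers_upto X. (g q)\<^sup>2 / real q) + 2 * \<theta>\<^sup>2 * (\<Sum>q\<in>higher_prime_powers_upto X. (ln (real q))\<^sup>2 / real q)"
      by (simp add: sum.distrib sum_distrib_left)
    also have "\<dots> \<le> 2 * (\<eta> / 8 * B) + 2 * (128 * B * (1 / (ln X)\<^sup>2)) * C"
    proof (rule add_mono)
      show "2 * (\<Sum>q\<in>higher_prime_powers_upto X. (g q)\<^sup>2 / real q) \<le> 2 * (\<eta> / 8 * B)"
        using elim(2) by (simp add: B_def)
      have "2 * \<theta>\<^sup>2 \<le> 2 * (128 * B * (1 / (ln X)\<^sup>2))" using \<theta>2 by linarith
      thus "2 * \<theta>\<^sup>2 * (\<Sum>q\<in>higher_prime_powers_upto X. (ln (real q))\<^sup>2 / real q) \<le> 2 * (128 * B * (1 / (ln X)\<^sup>2)) * C"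
        by (rule mult_mono) (use C B0 in \<open>auto intro!: sum_nonneg\<close>)
    qed
    also have "2 * (128 * B * (1 / (ln X)\<^sup>2)) * C = B * (256 * C * (1 / (ln X)\<^sup>2))" by simp
    also have "\<dots> \<le> B * (\<eta> / 4)" using elim B0 by (intro mult_left_mono) auto
    also note \<theta>
    also have "\<eta>1 * B \<le> \<eta> / 2 * B" using \<eta>1(3) B0 by (rule mult_right_mono)
    also have "\<eta> / 2 * B + (2 * (\<eta> / 8 * B) + B * (\<eta> / 4)) = \<eta> * B" by simp
    finally have "log_distance g X \<theta> \<le> \<eta> * B" by simp
    moreover have "(ln X)\<^sup>2 / 32 > 0" using lX by simp
    hence e: "log_energy X > 0" using elim(4) by linarith
    hence "log_distance g X (log_coeff g X) \<le> log_distance g X \<theta>"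
      using log_distance_projection[OF e, of g \<theta>] by simp
    ultimately show ?case by (simp add: B_def)
  qed
qed

text \<open>Pythagoras at \<theta> = 0: the projection has norm at most B. With the lower bound (ln
  X)^2 / 32 for the energy, the constant would be sqrt 32, rounded up to 6.\<close>

lemma log_coeff_bound: "\<forall>\<^sub>F X in at_top. \<bar>log_coeff g X\<bar> \<le> 6 * (B_add g X / ln X)"
  using log_energy_ge eventually_ge_at_top[of 4]
proof eventually_elim
  case (elim X)
  have lX: "ln X > 0" using elim by simp
  have "(ln X)\<^sup>2 / 32 > 0" using lX by simp
  hence e: "log_energy X > 0" using elim(1) by linarith
  have "(ln X)\<^sup>2 / 32 * (log_coeff g X)\<^sup>2 \<le> log_energy X * (log_coeff g X)\<^sup>2"
    using elim by (intro mult_right_mono) auto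
  also have "\<dots> \<le> (B_add g X)\<^sup>2"
    using log_distance_projection[OF e, of g 0] log_distance_nonneg[of g X "log_coeff g X"] by (simp add: log_distance_0)
  finally have "(log_coeff g X)\<^sup>2 \<le> 32 * ((B_add g X)\<^sup>2 / (ln X)\<^sup>2)" using lX by (simp add: field_simps)
  also have "\<dots> \<le> 36 * ((B_add g X)\<^sup>2 / (ln X)\<^sup>2)" by (intro mult_right_mono) auto
  also have "\<dots> = (6 * (B_add g X / ln X))\<^sup>2" by (simp add: power_mult_distrib power_divide)
  finally have "\<bar>log_coeff g X\<bar>\<^sup>2 \<le> (6 * (B_add g X / ln X))\<^sup>2" by simp
  moreover have "6 * (B_add g X / ln X) \<ge> 0" using lX B_add_nonneg[of g X] by simp
  ultimately show ?case by (rule power2_le_imp_le)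
qed

text \<open>The logarithm still has energy at least u^2 (ln X)^2 / 32 on prime powers up to X^u, and
  both projections are close to g there. As B at X^u is at most B at X, a distance of \<eta> B^2 at
  each end suffices; 4 \<eta> times 32 / u^2 is c^2.\<close>

lemma log_coeff_slowly_varying:
  assumes u: "0 < u" "u \<le> 1"
  shows "(\<lambda>X. log_coeff g X - log_coeff g (X powr u)) \<in> o[at_top](\<lambda>X. B_add g X / ln X)"
proof (rule landau_o.smallI)
  fix c :: real assume c: "c > 0"
  define \<eta> where "\<eta> = c\<^sup>2 * u\<^sup>2 / 128"
  have \<eta>: "\<eta> > 0" using c u by (simp add: \<eta>_def)
  have lim: "filterlim (\<lambda>X::real. X powr u) at_top at_top" using u by real_asymp
  show "\<forall>\<^sub>F X in at_top. norm (log_coeff g X - log_coeff g (X powr u)) \<le> c * norm (B_add g X / ln X)"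
    using log_distance_small[OF \<eta>] eventually_compose_filterlim[OF log_distance_small[OF \<eta>] lim]
      eventually_compose_filterlim[OF log_energy_ge lim] eventually_ge_at_top[of 4]
  proof eventually_elim
    case (elim X)
    define Y where "Y = X powr u"
    define B where "B = (B_add g X)\<^sup>2"
    define D where "D = log_coeff g X - log_coeff g Y"
    have lX: "ln X > 0" using elim by simp
    have "X powr u \<le> X powr 1" using elim u by (intro powr_mono) auto
    hence YX: "Y \<le> X" using elim by (simp add: Y_def)
    have lY: "ln Y = u * ln X" using elim by (simp add: Y_def ln_powr)
    have "(B_add g Y)\<^sup>2 \<le> B" unfolding B_def using YX by (intro power_mono B_add_mono B_add_nonneg)
    hence "\<eta> * (B_add g Y)\<^sup>2 \<le> \<eta> * B" using \<eta> by (intro mult_left_mono) auto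
    hence "log_distance g Y (log_coeff g Y) \<le> \<eta> * B" using elim by (simp add: Y_def)
    moreover have "log_distance g X (log_coeff g X) \<le> \<eta> * B" using elim by (simp add: B_def)
    ultimately have "log_energy Y * D\<^sup>2 \<le> 4 * (\<eta> * B)" using log_coeff_diff_le[OF YX, of g] unfolding D_def by linarith
    moreover have "(ln Y)\<^sup>2 / 32 * D\<^sup>2 \<le> log_energy Y * D\<^sup>2" using elim by (intro mult_right_mono) (auto simp: Y_def)
    ultimately have "(ln Y)\<^sup>2 / 32 * D\<^sup>2 \<le> 4 * (\<eta> * B)" by linarith
    hence "u\<^sup>2 * (ln X)\<^sup>2 * D\<^sup>2 \<le> u\<^sup>2 * (c\<^sup>2 * B)" by (simp add: lY \<eta>_def power_mult_distrib field_simps)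
    hence "D\<^sup>2 \<le> c\<^sup>2 * (B / (ln X)\<^sup>2)" using u lX by (simp add: field_simps)
    also have "\<dots> = (c * (B_add g X / ln X))\<^sup>2" by (simp add: B_def power_mult_distrib power_divide)
    finally have "\<bar>D\<bar>\<^sup>2 \<le> (c * (B_add g X / ln X))\<^sup>2" by simp
    moreover have "c * (B_add g X / ln X) \<ge> 0" using c lX B_add_nonneg[of g X] by simp
    ultimately have "\<bar>D\<bar> \<le> c * (B_add g X / ln X)" by (rule power2_le_imp_le)
    thus ?case using lX B_add_nonneg[of g X] by (simp add: D_def Y_def)
  qed
qed

lemma log_distance_smallo:
  "(\<lambda>X. \<Sum>q\<in>prime_powers_upto X. \<bar>g q - log_coeff g X * ln (real q)\<bar>\<^sup>2 / real q)
     \<in> o[at_top](\<lambda>X. \<Sum>q\<in>prime_powers_upto X. (g q)\<^sup>2 / real q)"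
proof (rule landau_o.smallI)
  fix c :: real assume c: "c > 0"
  show "\<forall>\<^sub>F X in at_top. norm (\<Sum>q\<in>prime_powers_upto X. \<bar>g q - log_coeff g X * ln (real q)\<bar>\<^sup>2 / real q)
       \<le> c * norm (\<Sum>q\<in>prime_powers_upto X. (g q)\<^sup>2 / real q)"
    using log_distance_small[OF c]
  proof eventually_elim
    case (elim X)
    have "log_distance g X (log_coeff g X) \<le> c * (B_add g X)\<^sup>2" by (rule elim)
    thus ?case unfolding B_add_sq log_distance_def by (simp add: sum_nonneg)
  qed
qed

end

theorem theorem1p5:
  shows "\<exists>C>0. \<forall>g :: nat \<Rightarrow> real.
    additive_function g \<and> g 0 = 0 \<and> g \<in> class_A_s \<and>
    (\<lambda>X::real. real (card (decrease_set_upto g X))) \<in> o[at_top](\<lambda>X. X)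
    \<longrightarrow>
    (\<exists>lam :: real \<Rightarrow> real.
       (\<exists>X0\<ge>10. \<forall>X\<ge>X0. \<bar>lam X\<bar> \<le> C * (B_add g X / ln X)) \<and>
       (\<lambda>X. \<Sum>q\<in>prime_powers_upto X. \<bar>g q - lam X * ln (real q)\<bar>\<^sup>2 / real q)
         \<in> o[at_top](\<lambda>X. \<Sum>q\<in>prime_powers_upto X. (g q)\<^sup>2 / real q) \<and>
       (\<forall>u. 0 < u \<and> u \<le> 1 \<longrightarrow>
          (\<lambda>X. lam X - lam (X powr u)) \<in> o[at_top](\<lambda>X. B_add g X / ln X)))"
proof (intro exI[of _ "6::real"] conjI allI impI)
  fix g :: "nat \<Rightarrow> real"
  assume g: "additive_function g \<and> g 0 = 0 \<and> g \<in> class_A_s \<and>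
    (\<lambda>X::real. real (card (decrease_set_upto g X))) \<in> o[at_top](\<lambda>X. X)"
  then interpret almost_increasing g by (intro almost_increasingI) auto
  \<comment> \<open>The constant 6 does not depend on g; only the threshold from which the bound
    holds does.\<close>
  obtain X1 where X1: "\<And>X. X \<ge> X1 \<Longrightarrow> \<bar>log_coeff g X\<bar> \<le> 6 * (B_add g X / ln X)"
    using log_coeff_bound by (auto simp: eventually_at_top_linorder)
  have "\<exists>X0\<ge>10. \<forall>X\<ge>X0. \<bar>log_coeff g X\<bar> \<le> 6 * (B_add g X / ln X)"
    by (rule exI[of _ "max 10 X1"]) (use X1 in auto)
  thus "\<exists>lam :: real \<Rightarrow> real.
       (\<exists>X0\<ge>10. \<forall>X\<ge>X0. \<bar>lam X\<bar> \<le> 6 * (B_add g X / ln X)) \<and>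
       (\<lambda>X. \<Sum>q\<in>prime_powers_upto X. \<bar>g q - lam X * ln (real q)\<bar>\<^sup>2 / real q)
         \<in> o[at_top](\<lambda>X. \<Sum>q\<in>prime_powers_upto X. (g q)\<^sup>2 / real q) \<and>
       (\<forall>u. 0 < u \<and> u \<le> 1 \<longrightarrow>
          (\<lambda>X. lam X - lam (X powr u)) \<in> o[at_top](\<lambda>X. B_add g X / ln X))"
    using log_distance_smallo log_coeff_slowly_varying by (intro exI[of _ "log_coeff g"]) auto
qed auto

end
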